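(* Suppose that $A:\mathbb{R}^N\to\mathbb{R}^N$ is locally Lipschitz. Let $\Omega\subset\mathbb{R}^N$ be an open and bounded set and let $u\in BV_A(\Omega)$. Then there exists a sequence $\{u_k\}_{k\in\mathbb{N}}\subset C^\infty(\Omega,\mathbb{C})$ such that $$\lim_{k\to\infty}\int_\Omega|u_k-u|_1\,dx=0\quad\text{and}\quad\lim_{k\to\infty}|Du_k|_A(\Omega)=|Du|_A(\Omega).$$
   Context: For $z\in\mathbb{C}$, $|z|_1:=|\Re z|+|\Im z|$. For $u\in L^1(\Omega,\mathbb{C})$, let $$C_{1,A,u}(\Omega):=\sup\Big\{\int_\Omega \Re u\,\mathrm{div}\,\varphi-A\cdot\varphi\,\Im u\,dx : \varphi\in C_c^\infty(\Omega,\mathbb{R}^N),\ \|\varphi\|_{L^\infty(\Omega)}\le1\Big\},$$ $$C_{2,A,u}(\Omega):=\sup\Big\{\int_\Omega \Im u\,\mathrm{div}\,\varphi+A\cdot\varphi\,\Re u\,dx : \varphi\in C_c^\infty(\Omega,\mathbb{R}^N),\ \|\varphi\|_{L^\infty(\Omega)}\le1\Big\},$$ $|Du|_A(\Omega):=C_{1,A,u}(\Omega)+C_{2,A,u}(\Omega)$, and $BV_A(\Omega):=\{u\in L^1(\Omega,\mathbb{C}):|Du|_A(\Omega)<\infty\}$. *)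

theory Defs
  imports "HOL-Analysis.Analysis" "HOL-Probability.Essential_Supremum"
begin

(* Meaningful for open S only: differentiability is taken in the whole space at
   points of S.  Complex-valued functions are differentiated over the reals. *)
primrec C_k_on :: "nat \<Rightarrow> 'a::real_normed_vector set \<Rightarrow> ('a \<Rightarrow> 'b::real_normed_vector) \<Rightarrow> bool" where
  "C_k_on 0 S f \<longleftrightarrow> continuous_on S f"
| "C_k_on (Suc k) S f \<longleftrightarrow>
     (\<forall>x\<in>S. f differentiable (at x)) \<and>
     (\<forall>v. C_k_on k S (\<lambda>x. frechet_derivative f (at x) v))"

definition smooth_on :: "'a::real_normed_vector set \<Rightarrow> ('a \<Rightarrow> 'b::real_normed_vector) \<Rightarrow> bool" where
  "smooth_on S f \<longleftrightarrow> (\<forall>k. C_k_on k S f)"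

definition locally_lipschitz :: "('a::metric_space \<Rightarrow> 'b::metric_space) \<Rightarrow> bool" where
  "locally_lipschitz f \<longleftrightarrow> (\<forall>x. \<exists>r>0. \<exists>L. L-lipschitz_on (ball x r) f)"

definition divergence :: "(real ^ 'n \<Rightarrow> real ^ 'n) \<Rightarrow> real ^ 'n \<Rightarrow> real" where
  "divergence \<phi> x = (\<Sum>i\<in>UNIV. frechet_derivative (\<lambda>y. \<phi> y $ i) (at x) (axis i 1))"

(* C_c^\<infinity>(\<Omega>, R^N), each element being represented by its extension by zero to
   the whole space. *)
definition test_fields :: "(real ^ 'n) set \<Rightarrow> (real ^ 'n \<Rightarrow> real ^ 'n) set" where
  "test_fields \<Omega> = {\<phi>. smooth_on \<Omega> \<phi> \<and>
     compact (closure (support_on UNIV \<phi>)) \<and> closure (support_on UNIV \<phi>) \<subseteq> \<Omega>}"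

definition Linf_norm :: "(real ^ 'n) set \<Rightarrow> (real ^ 'n \<Rightarrow> real ^ 'n) \<Rightarrow> ereal" where
  "Linf_norm \<Omega> \<phi> = esssup (lebesgue_on \<Omega>) (\<lambda>x. ereal (norm (\<phi> x)))"

definition C1 :: "(real ^ 'n \<Rightarrow> real ^ 'n) \<Rightarrow> (real ^ 'n) set \<Rightarrow> (real ^ 'n \<Rightarrow> complex) \<Rightarrow> ereal" where
  "C1 A \<Omega> u = (SUP \<phi>\<in>{\<phi>\<in>test_fields \<Omega>. Linf_norm \<Omega> \<phi> \<le> 1}.
     ereal (LINT x|lebesgue_on \<Omega>. Re (u x) * divergence \<phi> x - (A x \<bullet> \<phi> x) * Im (u x)))"

definition C2 :: "(real ^ 'n \<Rightarrow> real ^ 'n) \<Rightarrow> (real ^ 'n) set \<Rightarrow> (real ^ 'n \<Rightarrow> complex) \<Rightarrow> ereal" where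
  "C2 A \<Omega> u = (SUP \<phi>\<in>{\<phi>\<in>test_fields \<Omega>. Linf_norm \<Omega> \<phi> \<le> 1}.
     ereal (LINT x|lebesgue_on \<Omega>. Im (u x) * divergence \<phi> x + (A x \<bullet> \<phi> x) * Re (u x)))"

(* |Du|_A(\<Omega>), to be used for u in L^1(\<Omega>, C) only (the Bochner integrals in C1 and C2
   default to 0 on non-integrable integrands).  Both summands are nonnegative, by \<phi> = 0,
   so the sum is never of the form \<infinity> - \<infinity>. *)
definition magnetic_variation ::
    "(real ^ 'n \<Rightarrow> real ^ 'n) \<Rightarrow> (real ^ 'n) set \<Rightarrow> (real ^ 'n \<Rightarrow> complex) \<Rightarrow> ereal" where
  "magnetic_variation A \<Omega> u = C1 A \<Omega> u + C2 A \<Omega> u"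

definition BV :: "(real ^ 'n \<Rightarrow> real ^ 'n) \<Rightarrow> (real ^ 'n) set \<Rightarrow> (real ^ 'n \<Rightarrow> complex) set" where
  "BV A \<Omega> = {u. integrable (lebesgue_on \<Omega>) u \<and> magnetic_variation A \<Omega> u < \<infinity>}"

definition norm1 :: "complex \<Rightarrow> real" where
  "norm1 z = \<bar>Re z\<bar> + \<bar>Im z\<bar>"

end

theory Submission
  imports Defs
begin

text \<open>
  The functions are regularised as in the Meyers-Serrin theorem. A smooth locally finite partition of
  unity \<open>\<zeta> i\<close> of \<open>\<Omega>\<close> and symmetric mollifiers \<open>\<eta> i\<close> of small radius give, from the
  real and imaginary parts \<open>p, q\<close> of \<open>u\<close>, smooth functions \<open>P = (\<Sum>i. \<eta> i * (\<zeta> i p))\<close> and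
  \<open>Q = (\<Sum>i. \<eta> i * (\<zeta> i q))\<close>. Testing \<open>(P, Q)\<close> against a field \<open>\<phi>\<close> amounts, up to a small
  error, to testing \<open>(p, q)\<close> against \<open>\<psi> = (\<Sum>i. \<zeta> i (\<eta> i * \<phi>))\<close>, which again satisfies
  \<open>\<bar>\<psi>\<bar> \<le> 1\<close>: the terms with a derivative of \<open>\<zeta> i\<close> nearly cancel because the \<open>\<zeta> i\<close> sum
  to 1, and the commutator of \<open>\<eta> i\<close> with multiplication by \<open>A\<close> is small in \<open>L\<^sup>1\<close>. This bounds the
  variation of the regularisation from above, without any reference to the variation measure of \<open>u\<close>;
  the bound from below is lower semicontinuity under \<open>L\<^sup>1\<close> convergence.
\<close>

text \<open>For a component \<open>f\<close> of the test field write \<open>d\<close> for the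
  matching partial derivative and \<open>G\<close> for \<open>\<eta> i * f\<close>. Symmetry of the
  mollifier and the product rule give \<integral> (\<eta> i * (\<zeta> i p)) d f = \<integral>
  \<zeta> i p d G = \<integral> p d (\<zeta> i G) - \<integral> (d \<zeta> i) p G, and moving the
  mollifier back turns the last integral into \<integral> (\<eta> i * ((d \<zeta> i) p)) f.
  Replacing the mollified factor by (d \<zeta> i) p costs at most its distance in the mean, and what
  remains is free of \<eta> i, so it can be summed over i. Thus \<eta> i has to reproduce finitely
  many fixed integrable functions, listed before any test field is seen. The error is therefore
  uniform in \<phi>, as suprema require. With errors \<open>e i\<close>, N components and a bound M
  for the potential on \<Omega>, the total is N (2 + M) times the sum of the \<open>e i\<close>,
  which are taken geometric. \<open>C1\<close> and \<open>C2\<close> have to converge along the same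
  sequence, so the list contains the data of both (p, q, A) and (q, p, -A).\<close>

section \<open>Smooth functions\<close>

text \<open>Arbitrary where \<open>f\<close> is not differentiable.\<close>

definition dir_deriv :: "'a::real_normed_vector \<Rightarrow> ('a \<Rightarrow> 'b::real_normed_vector) \<Rightarrow> 'a \<Rightarrow> 'b" where
  "dir_deriv v f x = frechet_derivative f (at x) v"

lemma dir_deriv_eq: "(f has_derivative f') (at x) \<Longrightarrow> dir_deriv v f x = f' v"
  unfolding dir_deriv_def using frechet_derivative_at by metis

lemma has_derivative_dir_deriv:
  "f differentiable (at x) \<Longrightarrow> (f has_derivative (\<lambda>v. dir_deriv v f x)) (at x)"
  unfolding dir_deriv_def using frechet_derivative_works by blast

text \<open>Holds also where no derivative exists: \<open>frechet_derivative\<close> is a choice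
  among the derivatives at the point, and both functions have the same ones there.\<close>

lemma dir_deriv_cong:
  assumes "open S" "x \<in> S" "\<And>y. y \<in> S \<Longrightarrow> f y = g y"
  shows "dir_deriv v f x = dir_deriv v g x"
proof -
  have "(f has_derivative D) (at x) \<longleftrightarrow> (g has_derivative D) (at x)" for D
    using has_derivative_transform_within_open[of f D x UNIV S g]
      has_derivative_transform_within_open[of g D x UNIV S f] assms by auto
  then show ?thesis
    unfolding dir_deriv_def frechet_derivative_def by presburger
qed

lemma C_k_on_cong:
  assumes "open S"
  shows "(\<And>x. x \<in> S \<Longrightarrow> f x = g x) \<Longrightarrow> C_k_on k S f \<Longrightarrow> C_k_on k S g"
proof (induction k arbitrary: f g)
  case 0
  then show ?case using continuous_on_cong[of S S f g] by simp
next
  case (Suc k)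
  have "g differentiable (at x)" if "x \<in> S" for x
  proof -
    have "f differentiable (at x)" using Suc.prems that by simp
    then show ?thesis
      unfolding differentiable_def
      using has_derivative_transform_within_open[of f _ x UNIV S g] assms that Suc.prems(1) by blast
  qed
  moreover have "C_k_on k S (\<lambda>x. frechet_derivative g (at x) v)" for v
  proof (rule Suc.IH[of "\<lambda>x. frechet_derivative f (at x) v"])
    show "frechet_derivative f (at x) v = frechet_derivative g (at x) v" if "x \<in> S" for x
      using dir_deriv_cong[OF assms that, of f g v] Suc.prems(1) by (simp add: dir_deriv_def)
  qed (use Suc.prems(2) in simp)
  ultimately show ?case by simp
qed

text \<open>Replaces the chosen \<open>frechet_derivative\<close> by an explicit derivative
  formula.\<close>

lemma C_k_on_SucI:
  assumes "open S" "\<And>x. x \<in> S \<Longrightarrow> (f has_derivative f' x) (at x)" "\<And>v. C_k_on k S (\<lambda>x. f' x v)"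
  shows "C_k_on (Suc k) S f"
proof -
  have "C_k_on k S (\<lambda>x. frechet_derivative f (at x) v)" for v
  proof (rule C_k_on_cong[OF assms(1) _ assms(3)[of v]])
    show "f' x v = frechet_derivative f (at x) v" if "x \<in> S" for x
      using dir_deriv_eq[OF assms(2)[OF that], of v] by (simp add: dir_deriv_def)
  qed
  then show ?thesis using assms(2) by (auto simp: differentiable_def)
qed

text \<open>\<open>C_k_on\<close> demands continuity only of the derivatives of top order; for the
  lower orders it follows from differentiability.\<close>

lemma C_k_on_Suc_imp: "C_k_on (Suc k) S f \<Longrightarrow> C_k_on k S f"
proof (induction k arbitrary: f)
  case 0
  then show ?case
    by (auto intro!: continuous_at_imp_continuous_on differentiable_imp_continuous_within)
next
  case (Suc k)
  have "C_k_on (Suc k) S (\<lambda>x. frechet_derivative f (at x) v)" for v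
    using Suc.prems by auto
  then have "C_k_on k S (\<lambda>x. frechet_derivative f (at x) v)" for v
    by (rule Suc.IH)
  then show ?case using Suc.prems by auto
qed

lemma smooth_on_iff:
  "smooth_on S f \<longleftrightarrow> (\<forall>x\<in>S. f differentiable (at x)) \<and> (\<forall>v. smooth_on S (dir_deriv v f))"
proof
  assume *: "smooth_on S f"
  then have "C_k_on (Suc k) S f" for k
    unfolding smooth_on_def by blast
  then show "(\<forall>x\<in>S. f differentiable (at x)) \<and> (\<forall>v. smooth_on S (dir_deriv v f))"
    unfolding smooth_on_def dir_deriv_def by auto
next
  assume *: "(\<forall>x\<in>S. f differentiable (at x)) \<and> (\<forall>v. smooth_on S (dir_deriv v f))"
  then have "C_k_on (Suc k) S f" for k
    unfolding smooth_on_def dir_deriv_def by auto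
  then show "smooth_on S f"
    unfolding smooth_on_def using C_k_on_Suc_imp by blast
qed

lemma smooth_on_differentiable: "smooth_on S f \<Longrightarrow> x \<in> S \<Longrightarrow> f differentiable (at x)"
  using smooth_on_iff by blast

lemma smooth_on_dir_deriv: "smooth_on S f \<Longrightarrow> smooth_on S (dir_deriv v f)"
  using smooth_on_iff by blast

lemma smooth_on_has_derivative:
  "smooth_on S f \<Longrightarrow> x \<in> S \<Longrightarrow> (f has_derivative (\<lambda>v. dir_deriv v f x)) (at x)"
  using has_derivative_dir_deriv smooth_on_differentiable by blast

lemma smooth_on_continuous: "smooth_on S f \<Longrightarrow> continuous_on S f"
  unfolding smooth_on_def using C_k_on.simps(1) by blast

text \<open>Smoothness as a greatest fixed point: a family closed under directional derivatives
  satisfies \<open>C_k_on\<close> at every order, by induction on the order. In the applications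
  \<open>F\<close> is the set of all functions of a given shape.\<close>

lemma smooth_on_coinduct:
  assumes "open S" "f \<in> F"
    and "\<And>g. g \<in> F \<Longrightarrow> \<exists>g'. (\<forall>x\<in>S. (g has_derivative g' x) (at x)) \<and> (\<forall>v. (\<lambda>x. g' x v) \<in> F)"
  shows "smooth_on S f"
proof -
  have "g \<in> F \<Longrightarrow> C_k_on k S g" for k g
  proof (induction k arbitrary: g)
    case 0
    obtain g' where "\<forall>x\<in>S. (g has_derivative g' x) (at x)"
      using assms(3)[OF 0] by blast
    then show ?case
      by (auto intro!: continuous_at_imp_continuous_on has_derivative_continuous)
  next
    case (Suc k)
    obtain g' where g': "\<forall>x\<in>S. (g has_derivative g' x) (at x)" "\<forall>v. (\<lambda>x. g' x v) \<in> F"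
      using assms(3)[OF Suc.prems] by blast
    have "C_k_on k S (\<lambda>x. g' x v)" for v
      using g'(2) Suc.IH by blast
    then show ?case
      using g'(1) C_k_on_SucI[OF assms(1), of g g' k] by blast
  qed
  then show ?thesis using assms(2) by (simp add: smooth_on_def)
qed

lemma smooth_on_cong:
  assumes "open S" "\<And>x. x \<in> S \<Longrightarrow> f x = g x" "smooth_on S f"
  shows "smooth_on S g"
  using assms C_k_on_cong[OF assms(1), of f g] by (simp add: smooth_on_def)

lemma smooth_on_subset: "smooth_on S f \<Longrightarrow> T \<subseteq> S \<Longrightarrow> smooth_on T f"
proof -
  have "C_k_on k S f \<Longrightarrow> T \<subseteq> S \<Longrightarrow> C_k_on k T f" for k
    by (induction k arbitrary: f) (auto intro: continuous_on_subset)
  then show "smooth_on S f \<Longrightarrow> T \<subseteq> S \<Longrightarrow> smooth_on T f"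
    by (simp add: smooth_on_def)
qed

text \<open>Serves locally finite sums, which are finite sums near each point but not globally, and
  functions given by different formulas on different open sets.\<close>

lemma smooth_on_local:
  assumes "\<And>x. x \<in> S \<Longrightarrow> \<exists>T. open T \<and> x \<in> T \<and> smooth_on T f"
  shows "smooth_on S f"
proof -
  have "(\<And>x. x \<in> S \<Longrightarrow> \<exists>T. open T \<and> x \<in> T \<and> C_k_on k T f) \<Longrightarrow> C_k_on k S f" for k
  proof (induction k arbitrary: f)
    case 0
    have "isCont f x" if "x \<in> S" for x
      using 0[OF that] continuous_on_eq_continuous_at by auto
    then show ?case by (auto intro: continuous_at_imp_continuous_on)
  next
    case (Suc k)
    have "f differentiable (at x)" if "x \<in> S" for x
      using Suc.prems[OF that] by auto
    moreover have "C_k_on k S (\<lambda>x. frechet_derivative f (at x) v)" for v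
    proof (rule Suc.IH)
      fix x assume "x \<in> S"
      from Suc.prems[OF this] show "\<exists>T. open T \<and> x \<in> T \<and> C_k_on k T (\<lambda>x. frechet_derivative f (at x) v)"
        by auto
    qed
    ultimately show ?case by simp
  qed
  then show ?thesis
    using assms unfolding smooth_on_def by meson
qed

section \<open>Closure properties of smooth functions\<close>

lemma smooth_on_const:
  fixes c :: "'b::real_normed_vector"
  assumes "open S"
  shows "smooth_on S (\<lambda>x. c)"
proof (rule smooth_on_coinduct[OF assms, where F = "{\<lambda>x. c | c :: 'b. True}"])
  fix g :: "'a \<Rightarrow> 'b" assume "g \<in> {\<lambda>x. c | c. True}"
  then obtain c where "g = (\<lambda>x. c)" by blast
  then show "\<exists>g'. (\<forall>x\<in>S. (g has_derivative g' x) (at x)) \<and> (\<forall>v. (\<lambda>x. g' x v) \<in> {\<lambda>x. c | c :: 'b. True})"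
    by (intro exI[of _ "\<lambda>x v. 0"]) auto
qed blast

lemma smooth_on_add:
  assumes "open S" "smooth_on S f" "smooth_on S g"
  shows "smooth_on S (\<lambda>x. f x + g x)"
proof -
  define F :: "('a \<Rightarrow> 'b) set" where "F = {(\<lambda>x. f x + g x) | f g. smooth_on S f \<and> smooth_on S g}"
  show ?thesis
  proof (rule smooth_on_coinduct[OF assms(1), of _ F])
    fix h assume "h \<in> F"
    then obtain f g where h: "h = (\<lambda>x. f x + g x)" "smooth_on S f" "smooth_on S g"
      unfolding F_def by blast
    let ?h' = "\<lambda>x v. dir_deriv v f x + dir_deriv v g x"
    have "(h has_derivative ?h' x) (at x)" if "x \<in> S" for x
      unfolding h(1) by (intro has_derivative_add smooth_on_has_derivative[OF _ that] h)
    moreover have "(\<lambda>x. ?h' x v) \<in> F" for v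
      unfolding F_def using smooth_on_dir_deriv h by blast
    ultimately show "\<exists>h'. (\<forall>x\<in>S. (h has_derivative h' x) (at x)) \<and> (\<forall>v. (\<lambda>x. h' x v) \<in> F)"
      by (intro exI[of _ ?h'] conjI ballI allI)
  qed (use assms in \<open>auto simp: F_def\<close>)
qed

lemma smooth_on_bounded_linear:
  assumes "open S" "smooth_on S f" "bounded_linear L"
  shows "smooth_on S (\<lambda>x. L (f x))"
proof (rule smooth_on_coinduct[where F = "{(\<lambda>x. L (f x)) | f. smooth_on S f}"])
  fix h assume "h \<in> {(\<lambda>x. L (f x)) | f. smooth_on S f}"
  then obtain f where h: "h = (\<lambda>x. L (f x))" "smooth_on S f" by blast
  have "(h has_derivative (\<lambda>v. L (dir_deriv v f x))) (at x)" if "x \<in> S" for x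
    unfolding h(1) by (intro bounded_linear.has_derivative[OF assms(3)] smooth_on_has_derivative[OF _ that] h)
  moreover have "(\<lambda>x. L (dir_deriv v f x)) \<in> {(\<lambda>x. L (f x)) | f. smooth_on S f}" for v
    using smooth_on_dir_deriv h by blast
  ultimately show "\<exists>h'. (\<forall>x\<in>S. (h has_derivative h' x) (at x)) \<and>
      (\<forall>v. (\<lambda>x. h' x v) \<in> {(\<lambda>x. L (f x)) | f. smooth_on S f})"
    by fast
qed (use assms in auto)

lemma smooth_on_sum:
  assumes "open S" "\<And>i. i \<in> I \<Longrightarrow> smooth_on S (f i)"
  shows "smooth_on S (\<lambda>x. \<Sum>i\<in>I. f i x)"
proof (cases "finite I")
  case True
  then show ?thesis using assms(2)
    by induction (simp_all add: smooth_on_const smooth_on_add assms(1))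
qed (simp add: smooth_on_const assms(1))

text \<open>The product rule yields a sum of two products, so the set of products is not closed
  under differentiation and the coinduction rule does not fit it. Instead all smooth pairs are
  treated at once by induction on the order.\<close>

lemma smooth_on_mult:
  fixes f g :: "'a::real_normed_vector \<Rightarrow> real"
  assumes "open S" "smooth_on S f" "smooth_on S g"
  shows "smooth_on S (\<lambda>x. f x * g x)"
proof -
  have "C_k_on k S (\<lambda>x. f x * g x)" if "smooth_on S f" "smooth_on S g" for k and f g :: "'a \<Rightarrow> real"
    using that
  proof (induction k arbitrary: f g)
    case 0
    then show ?case by (simp add: continuous_on_mult smooth_on_continuous)
  next
    case (Suc k)
    \<comment> \<open>The induction hypothesis gives order \<open>k\<close> for each summand of the
      product rule, so additivity is required at a fixed order, whereas \<open>smooth_on_add\<close>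
      speaks of all orders together.\<close>
    have add: "C_k_on k S (\<lambda>x. a x + b x)" if "C_k_on k S a" "C_k_on k S b" for a b :: "'a \<Rightarrow> real"
      using that
    proof (induction k arbitrary: a b)
      case 0 then show ?case by (auto intro: continuous_on_add)
    next
      case (Suc k)
      have d: "(a has_derivative (\<lambda>v. frechet_derivative a (at x) v)) (at x)"
        "(b has_derivative (\<lambda>v. frechet_derivative b (at x) v)) (at x)" if "x \<in> S" for x
        using Suc.prems that by (auto simp: frechet_derivative_works)
      show ?case
        by (rule C_k_on_SucI[OF assms(1) has_derivative_add[OF d]]) (use Suc in auto)
    qed
    show ?case
    proof (rule C_k_on_SucI[OF assms(1)])
      show "((\<lambda>x. f x * g x) has_derivative (\<lambda>v. f x * dir_deriv v g x + dir_deriv v f x * g x)) (at x)"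
        if "x \<in> S" for x
        by (intro has_derivative_mult smooth_on_has_derivative[OF _ that] Suc.prems)
      show "C_k_on k S (\<lambda>x. f x * dir_deriv v g x + dir_deriv v f x * g x)" for v
        by (intro add Suc.IH smooth_on_dir_deriv Suc.prems)
    qed
  qed
  then show ?thesis unfolding smooth_on_def[of S "\<lambda>x. f x * g x"] using assms(2,3) by simp
qed

lemma smooth_on_prod:
  fixes f :: "'i \<Rightarrow> 'a::real_normed_vector \<Rightarrow> real"
  assumes "open S" "\<And>i. i \<in> I \<Longrightarrow> smooth_on S (f i)"
  shows "smooth_on S (\<lambda>x. \<Prod>i\<in>I. f i x)"
proof (cases "finite I")
  case True
  then show ?thesis using assms(2)
    by induction (simp_all add: smooth_on_const smooth_on_mult assms(1))
qed (simp add: smooth_on_const assms(1))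

section \<open>The functions p (1 / t) exp (- 1 / t), extended by zero\<close>

text \<open>This family is closed under differentiation, which makes its members smooth by coinduction.\<close>

definition flat :: "real poly \<Rightarrow> real \<Rightarrow> real" where
  "flat p t = (if t > 0 then poly p (1 / t) * exp (- (1 / t)) else 0)"

lemma poly_exp_tendsto_0: "((\<lambda>s. poly p s * exp (- s :: real)) \<longlongrightarrow> 0) at_top"
proof -
  have "((\<lambda>s. \<Sum>i\<le>degree p. coeff p i * (s ^ i / exp s)) \<longlongrightarrow> (\<Sum>i\<le>degree p. coeff p i * 0)) at_top"
    by (intro tendsto_sum tendsto_mult tendsto_const tendsto_power_div_exp_0)
  then show ?thesis
    by (simp add: poly_altdef sum_distrib_right exp_minus divide_inverse mult.assoc)
qed

text \<open>With \<open>s = 1 / t\<close> the chain rule gives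
  \<open>s^2 * (p s - p' s) * exp (- s)\<close>, and \<open>[:0, 0, 1:]\<close> is the factor
  \<open>s^2\<close>. At \<open>t = 0\<close> the difference quotient vanishes because the
  exponential beats every polynomial.\<close>

lemma flat_has_derivative:
  "(flat p has_real_derivative flat ([:0, 0, 1:] * (p - pderiv p)) t) (at t)"
proof -
  consider "t < 0" | "t = 0" | "t > 0" by linarith
  then show ?thesis
  proof cases
    case 1
    have "((\<lambda>t. 0) has_real_derivative 0) (at t)" by simp
    then have "(flat p has_real_derivative 0) (at t)"
      by (rule has_field_derivative_transform_within[where d = "-t"]) (use 1 in \<open>auto simp: flat_def dist_real_def\<close>)
    then show ?thesis using 1 by (simp add: flat_def)
  next
    case 2
    have "((\<lambda>h. flat p h / h) \<longlongrightarrow> 0) (at_right 0)"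
    proof -
      \<comment> \<open>Division by \<open>h\<close> is one more factor \<open>s = 1 / h\<close>,
        hence the polynomial \<open>[:0, 1:] * p\<close>.\<close>
      have "((\<lambda>h. poly ([:0,1:] * p) (inverse h) * exp (- inverse h)) \<longlongrightarrow> 0) (at_right 0)"
        by (rule filterlim_compose[OF poly_exp_tendsto_0 filterlim_inverse_at_top_right])
      then show ?thesis
        by (rule Lim_transform_eventually)
           (auto simp: eventually_at_right_field flat_def field_simps intro!: exI[of _ 1])
    qed
    moreover have "((\<lambda>h. flat p h / h) \<longlongrightarrow> 0) (at_left 0)"
      by (rule tendsto_eventually) (auto simp: eventually_at_left_field flat_def intro!: exI[of _ "-1"])
    ultimately have "((\<lambda>h. flat p h / h) \<longlongrightarrow> 0) (at 0)"
      by (simp add: filterlim_split_at_real)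
    then show ?thesis using 2 by (simp add: DERIV_def flat_def)
  next
    case 3
    let ?D = "poly ([:0, 0, 1:] * (p - pderiv p)) (1 / t) * exp (- (1 / t))"
    have "((\<lambda>t. poly p (1 / t) * exp (- (1 / t))) has_real_derivative ?D) (at t)"
      using 3 by (auto intro!: derivative_eq_intros DERIV_chain'[OF _ poly_DERIV] simp: field_simps power2_eq_square)
    then have "(flat p has_real_derivative ?D) (at t)"
      by (rule has_field_derivative_transform_within[where d = t]) (use 3 in \<open>auto simp: flat_def dist_real_def\<close>)
    then show ?thesis using 3 by (simp add: flat_def)
  qed
qed

text \<open>The constant \<open>c \<bullet> v\<close> produced by the chain rule is absorbed into
  the polynomial, so the derivative stays in the family.\<close>

lemma smooth_on_flat_affine:
  fixes c :: "'a::real_inner"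
  shows "smooth_on UNIV (\<lambda>x. flat p (c \<bullet> x + d))"
proof (rule smooth_on_coinduct[where F = "range (\<lambda>p x. flat p (c \<bullet> x + d))"])
  fix g assume "g \<in> range (\<lambda>p x. flat p (c \<bullet> x + d))"
  then obtain p where g: "g = (\<lambda>x. flat p (c \<bullet> x + d))" by auto
  define q where "q = [:0, 0, 1:] * (p - pderiv p)"
  have "(g has_derivative (\<lambda>v. flat q (c \<bullet> x + d) * (c \<bullet> v))) (at x)" for x
    unfolding g q_def
    by (rule has_derivative_compose[OF _ flat_has_derivative[unfolded has_field_derivative_def]])
       (auto intro!: derivative_eq_intros)
  moreover have "flat q s * r = flat (smult r q) s" for r s
    by (simp add: flat_def)
  ultimately show "\<exists>g'. (\<forall>x\<in>UNIV. (g has_derivative g' x) (at x)) \<and>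
      (\<forall>v. (\<lambda>x. g' x v) \<in> range (\<lambda>p x. flat p (c \<bullet> x + d)))"
    by (intro exI[of _ "\<lambda>x v. flat q (c \<bullet> x + d) * (c \<bullet> v)"]) auto
qed auto

section \<open>Convolution\<close>

definition smooth_cs :: "('a::euclidean_space \<Rightarrow> real) \<Rightarrow> bool" where
  "smooth_cs f \<longleftrightarrow> smooth_on UNIV f \<and> (\<exists>R. \<forall>x. f x \<noteq> 0 \<longrightarrow> norm x \<le> R)"

lemma smooth_cs_smooth: "smooth_cs f \<Longrightarrow> smooth_on UNIV f"
  by (simp add: smooth_cs_def)

lemma smooth_cs_continuous: "smooth_cs f \<Longrightarrow> continuous_on UNIV f"
  by (simp add: smooth_cs_def smooth_on_continuous)

lemma smooth_cs_measurable: "smooth_cs f \<Longrightarrow> f \<in> borel_measurable borel"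
  by (rule borel_measurable_continuous_onI[OF smooth_cs_continuous])

lemma smooth_cs_has_derivative:
  "smooth_cs f \<Longrightarrow> (f has_derivative (\<lambda>v. dir_deriv v f x)) (at x)"
  using smooth_on_has_derivative[of UNIV f x] by (simp add: smooth_cs_def)

lemma dir_deriv_eq_0:
  assumes "open S" "x \<in> S" "\<And>y. y \<in> S \<Longrightarrow> f y = c"
  shows "dir_deriv v f x = 0"
proof -
  have "dir_deriv v f x = dir_deriv v (\<lambda>y. c) x"
    using assms by (intro dir_deriv_cong)
  then show ?thesis by (simp add: dir_deriv_def)
qed

lemma smooth_cs_dir_deriv:
  assumes "smooth_cs f"
  shows "smooth_cs (dir_deriv v f)"
proof -
  obtain R where R: "\<And>x. f x \<noteq> 0 \<Longrightarrow> norm x \<le> R"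
    using assms by (auto simp: smooth_cs_def)
  have "dir_deriv v f x = 0" if "R < norm x" for x
    by (rule dir_deriv_eq_0[of "{x. R < norm x}"])
       (use that R in \<open>force intro: open_Collect_less continuous_on_norm continuous_on_id continuous_on_const\<close>)+
  then have "\<forall>x. dir_deriv v f x \<noteq> 0 \<longrightarrow> norm x \<le> R" by force
  then show ?thesis using assms smooth_on_dir_deriv by (auto simp: smooth_cs_def)
qed

lemma smooth_cs_mult: "smooth_on UNIV f \<Longrightarrow> smooth_cs g \<Longrightarrow> smooth_cs (\<lambda>x. f x * g x)"
  unfolding smooth_cs_def by (auto intro: smooth_on_mult)

lemma smooth_cs_bounded:
  assumes "smooth_cs f"
  obtains B where "\<And>x. \<bar>f x\<bar> \<le> B"
proof -
  obtain R where R: "\<And>x. f x \<noteq> 0 \<Longrightarrow> norm x \<le> R"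
    using assms by (auto simp: smooth_cs_def)
  have "bounded (f ` cball 0 R)"
    by (intro compact_imp_bounded compact_continuous_image continuous_on_subset[OF smooth_cs_continuous[OF assms]])
       auto
  then obtain B where B: "\<And>x. x \<in> cball 0 R \<Longrightarrow> \<bar>f x\<bar> \<le> B"
    unfolding bounded_iff by (metis imageI real_norm_def)
  have "\<bar>f x\<bar> \<le> max B 0" for x
    using B[of x] R[of x] by (cases "f x = 0") auto
  then show ?thesis using that by blast
qed

lemma smooth_cs_integrable:
  assumes "smooth_cs f"
  shows "integrable lborel f"
proof -
  obtain R where R: "\<And>x. f x \<noteq> 0 \<Longrightarrow> norm x \<le> R"
    using assms by (auto simp: smooth_cs_def)
  have "set_integrable lborel (cball 0 R) f"
    unfolding set_integrable_def
    by (intro borel_integrable_compact continuous_on_subset[OF smooth_cs_continuous[OF assms]]) auto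
  moreover have "(\<lambda>x. indicator (cball 0 R) x *\<^sub>R f x) = f"
    using R by (force simp: indicator_def)
  ultimately show ?thesis by (simp add: set_integrable_def)
qed

lemma smooth_cs_uniformly_continuous:
  assumes "smooth_cs f" "e > 0"
  obtains d where "d > 0" "\<And>x y. dist x y < d \<Longrightarrow> \<bar>f x - f y\<bar> < e"
proof -
  obtain R where R: "\<And>x. f x \<noteq> 0 \<Longrightarrow> norm x \<le> R"
    using assms by (auto simp: smooth_cs_def)
  have "uniformly_continuous_on (cball 0 (R + 1)) f"
    by (intro compact_uniformly_continuous continuous_on_subset[OF smooth_cs_continuous[OF assms(1)]]) auto
  then obtain d where d: "d > 0" "\<And>x y. x \<in> cball 0 (R+1) \<Longrightarrow> y \<in> cball 0 (R+1) \<Longrightarrow> dist x y < d \<Longrightarrow> dist (f x) (f y) < e"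
    unfolding uniformly_continuous_on_def using assms(2) by metis
  have "\<bar>f x - f y\<bar> < e" if "dist x y < min d 1" for x y
  proof (cases "x \<in> cball 0 (R+1) \<and> y \<in> cball 0 (R+1)")
    case True
    then show ?thesis using d(2) that by (auto simp: dist_real_def)
  next
    case False
    have "norm x \<le> norm y + dist x y" "norm y \<le> norm x + dist x y"
      by (metis dist_norm norm_triangle_sub norm_minus_commute add.commute)+
    then have "norm x > R \<and> norm y > R" using False that by auto
    then have "f x = 0" "f y = 0" using R by force+
    then show ?thesis using assms(2) by simp
  qed
  then show ?thesis using that[of "min d 1"] d(1) by auto
qed

text \<open>The first-order remainder is small uniformly in the base point, because the finitely
  many partial derivatives are uniformly continuous; each basis direction gets the share
  \<open>e / DIM('a)\<close>. This uniformity permits differentiation under the integral against a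
  function that is merely integrable.\<close>

lemma smooth_cs_uniform_derivative:
  fixes g :: "'a::euclidean_space \<Rightarrow> real"
  assumes "smooth_cs g" "e > 0"
  obtains d where "d > 0"
    "\<And>z h. norm h < d \<Longrightarrow> \<bar>g (z + h) - g z - dir_deriv h g z\<bar> \<le> e * norm h"
proof -
  define e' where "e' = e / DIM('a)"
  have e': "e' > 0" using assms(2) by (simp add: e'_def)
  have "\<forall>b. \<exists>d>0. \<forall>x y. dist x y < d \<longrightarrow> \<bar>dir_deriv b g x - dir_deriv b g y\<bar> < e'"
    using smooth_cs_uniformly_continuous[OF smooth_cs_dir_deriv[OF assms(1)] e'] by metis
  then obtain D where D: "\<And>b. D b > 0"
    "\<And>b x y. dist x y < D b \<Longrightarrow> \<bar>dir_deriv b g x - dir_deriv b g y\<bar> < e'" by metis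
  define d where "d = Min (D ` Basis)"
  have d: "d > 0" "\<And>b. b \<in> Basis \<Longrightarrow> d \<le> D b"
    using D(1) by (auto simp: d_def)
  have lin: "linear (\<lambda>v. dir_deriv v g x)" for x
    using smooth_cs_has_derivative[OF assms(1)] has_derivative_linear by blast
  have "\<bar>g (z + h) - g z - dir_deriv h g z\<bar> \<le> e * norm h" if h: "norm h < d" for z h
  proof -
    have on: "onorm (\<lambda>v. dir_deriv v g x - dir_deriv v g z) \<le> e" if "x \<in> ball z d" for x
    proof (rule onorm_bound)
      fix v :: 'a
      define L where "L = (\<lambda>v. dir_deriv v g x - dir_deriv v g z)"
      have L: "linear L" unfolding L_def by (intro linear_compose_sub lin)
      have "L v = L (\<Sum>b\<in>Basis. (v \<bullet> b) *\<^sub>R b)" by (simp add: euclidean_representation)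
      also have "\<dots> = (\<Sum>b\<in>Basis. (v \<bullet> b) * L b)"
        by (simp add: linear_sum[OF L] linear_scale[OF L])
      finally have "\<bar>L v\<bar> \<le> (\<Sum>b\<in>Basis. \<bar>(v \<bullet> b) * L b\<bar>)" by simp
      also have "\<dots> \<le> (\<Sum>b\<in>(Basis::'a set). norm v * e')"
      proof (rule sum_mono)
        fix b :: 'a assume b: "b \<in> Basis"
        have "dist x z < D b" using that d(2)[OF b] by (simp add: dist_commute)
        then have "\<bar>L b\<bar> \<le> e'" using D(2) by (auto simp: L_def less_imp_le)
        then show "\<bar>(v \<bullet> b) * L b\<bar> \<le> norm v * e'"
          using Basis_le_norm[OF b, of v] by (auto simp: abs_mult intro!: mult_mono)
      qed
      also have "\<dots> = e * norm v" by (simp add: e'_def)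
      finally show "norm (dir_deriv v g x - dir_deriv v g z) \<le> e * norm v" by (simp add: L_def)
    qed (use assms in simp)
    have "norm (g (z + h) - g z - dir_deriv (z + h - z) g z) \<le> norm (z + h - z) * e"
    proof (rule differentiable_bound_linearization[where S = "ball z d" and f' = "\<lambda>x v. dir_deriv v g x"])
      show "z + t *\<^sub>R (z + h - z) \<in> ball z d" if "t \<in> {0..1}" for t
      proof -
        have "\<bar>t\<bar> * norm h \<le> 1 * norm h" using that by (intro mult_right_mono) auto
        then show ?thesis using h by (simp add: dist_norm)
      qed
      show "(g has_derivative (\<lambda>v. dir_deriv v g x)) (at x within ball z d)" for x
        using smooth_cs_has_derivative[OF assms(1)] has_derivative_at_withinI by blast
      show "onorm ((\<lambda>v. dir_deriv v g x) - (\<lambda>v. dir_deriv v g z)) \<le> e" if "x \<in> ball z d" for x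
        using on[OF that] by (simp add: fun_diff_def)
    qed (use d in auto)
    then show ?thesis by (simp add: mult.commute)
  qed
  then show ?thesis using that d by blast
qed

section \<open>Reflection and translation of Lebesgue measure\<close>

lemma lborel_distr_reflect:
  fixes x :: "'a::euclidean_space"
  shows "distr lborel borel (\<lambda>y. x - y) = lborel"
  using lborel_affine[of "-1" x] by (simp add: density_1)

lemma lborel_distr_shift:
  fixes y :: "'a::euclidean_space"
  shows "distr lborel borel (\<lambda>x. x - y) = lborel"
  using lborel_affine[of 1 "-y"] by (simp add: density_1)

lemma lborel_integral_reflect:
  fixes f :: "'a::euclidean_space \<Rightarrow> 'b::{banach, second_countable_topology}"
  assumes f: "f \<in> borel_measurable borel"
  shows "(LINT y|lborel. f (x - y)) = (LINT y|lborel. f y)"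
  using f by (subst (2) lborel_distr_reflect[of x, symmetric]) (simp add: integral_distr)

lemma lborel_integrable_reflect:
  fixes f :: "'a::euclidean_space \<Rightarrow> 'b::{banach, second_countable_topology}"
  assumes f: "f \<in> borel_measurable borel"
  shows "integrable lborel (\<lambda>y. f (x - y)) \<longleftrightarrow> integrable lborel f"
  using f by (subst (2) lborel_distr_reflect[of x, symmetric]) (simp add: integrable_distr_eq)

lemma lborel_integral_shift:
  fixes f :: "'a::euclidean_space \<Rightarrow> 'b::{banach, second_countable_topology}"
  assumes f: "f \<in> borel_measurable borel"
  shows "(LINT x|lborel. f (x - y)) = (LINT y|lborel. f y)"
  using f by (subst (2) lborel_distr_shift[of y, symmetric]) (simp add: integral_distr)

lemma lborel_integrable_shift:
  fixes f :: "'a::euclidean_space \<Rightarrow> 'b::{banach, second_countable_topology}"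
  assumes f: "f \<in> borel_measurable borel"
  shows "integrable lborel (\<lambda>x. f (x - y)) \<longleftrightarrow> integrable lborel f"
  using f by (subst (2) lborel_distr_shift[of y, symmetric]) (simp add: integrable_distr_eq)

lemma integrable_bounded_mult:
  fixes f g :: "'a \<Rightarrow> real" and B :: real
  assumes "integrable M f" "g \<in> borel_measurable M" "\<And>x. \<bar>g x\<bar> \<le> B"
  shows "integrable M (\<lambda>x. g x * f x)"
proof (rule Bochner_Integration.integrable_bound[where f = "\<lambda>x. B * f x"])
  show "AE x in M. norm (g x * f x) \<le> norm (B * f x)"
    using assms(3) by (intro AE_I2) (auto simp: abs_mult intro!: mult_right_mono intro: order_trans[OF _ abs_ge_self])
qed (use assms in auto)

section \<open>Convolution: derivatives, integrability, self-adjointness\<close>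

definition conv :: "('a::euclidean_space \<Rightarrow> real) \<Rightarrow> ('a \<Rightarrow> real) \<Rightarrow> 'a \<Rightarrow> real" where
  "conv g f x = (LINT y|lborel. g (x - y) * f y)"

lemma conv_integrand:
  fixes g :: "'a::euclidean_space \<Rightarrow> real"
  assumes "integrable lborel f" "g \<in> borel_measurable borel" "\<And>x. \<bar>g x\<bar> \<le> B"
  shows "integrable lborel (\<lambda>y. g (x - y) * f y)"
  using assms by (intro integrable_bounded_mult[where B = B]) auto

lemma conv_commute:
  assumes [measurable]: "g \<in> borel_measurable borel" "f \<in> borel_measurable borel"
  shows "conv g f = conv f g"
proof
  fix x
  have "(LINT y|lborel. (\<lambda>y. g y * f (x - y)) (x - y)) = (LINT y|lborel. g y * f (x - y))"
    by (rule lborel_integral_reflect) measurable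
  then show "conv g f x = conv f g x"
    by (simp add: conv_def mult.commute)
qed

text \<open>The remainder of \<open>g\<close> is at most \<open>e' * norm h\<close> at every point,
  so the remainder of the convolution is at most this times the integral of
  \<open>\<bar>f\<bar>\<close>.\<close>

lemma conv_has_derivative:
  fixes f g :: "'a::euclidean_space \<Rightarrow> real"
  assumes g: "smooth_cs g" and f: "integrable lborel f"
  shows "(conv g f has_derivative (\<lambda>v. conv (dir_deriv v g) f x)) (at x)"
proof -
  have lin: "linear (\<lambda>v. dir_deriv v g x)" for x
    using smooth_cs_has_derivative[OF g] has_derivative_linear by blast
  have int: "integrable lborel (\<lambda>y. k (x - y) * f y)" if "smooth_cs k" for k x
    using smooth_cs_bounded[OF that] conv_integrand[OF f smooth_cs_measurable[OF that]] by metis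
  have intd: "integrable lborel (\<lambda>y. dir_deriv v g (x - y) * f y)" for v x
    by (intro int smooth_cs_dir_deriv g)
  have "linear (\<lambda>v. conv (dir_deriv v g) f x)"
    unfolding conv_def
    by (rule linearI)
       (simp_all add: linear_add[OF lin] linear_scale[OF lin] distrib_right mult.assoc
          Bochner_Integration.integral_add intd)
  then have 1: "bounded_linear (\<lambda>v. conv (dir_deriv v g) f x)"
    by (simp add: linear_conv_bounded_linear)
  have 2: "\<exists>d>0. \<forall>y. norm (y - x) < d \<longrightarrow>
      norm (conv g f y - conv g f x - conv (dir_deriv (y - x) g) f x) \<le> e * norm (y - x)"
    if "e > 0" for e
  proof -
    define I where "I = (LINT y|lborel. \<bar>f y\<bar>)"
    have I: "I \<ge> 0" by (simp add: I_def)
    \<comment> \<open>Dividing by \<open>I + 1\<close> covers the case \<open>I = 0\<close>.\<close>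
    define e' where "e' = e / (I + 1)"
    have e': "e' > 0" "e' * I \<le> e" using \<open>e > 0\<close> I by (auto simp: e'_def field_simps)
    obtain d where d: "d > 0"
      "\<And>z h. norm h < d \<Longrightarrow> \<bar>g (z + h) - g z - dir_deriv h g z\<bar> \<le> e' * norm h"
      using smooth_cs_uniform_derivative[OF g e'(1)] by metis
    have "norm (conv g f y - conv g f x - conv (dir_deriv (y - x) g) f x) \<le> e * norm (y - x)"
      if y: "norm (y - x) < d" for y
    proof -
      define h where "h = y - x"
      let ?k = "\<lambda>z. (g (y - z) - g (x - z) - dir_deriv h g (x - z)) * f z"
      have "conv g f y - conv g f x - conv (dir_deriv h g) f x = (LINT z|lborel. ?k z)"
        unfolding conv_def by (simp add: left_diff_distrib Bochner_Integration.integral_diff int g intd)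
      moreover have "norm (LINT z|lborel. ?k z) \<le> (LINT z|lborel. e' * norm h * \<bar>f z\<bar>)"
      proof (rule Bochner_Integration.integral_norm_bound_integral)
        show "integrable lborel ?k"
          by (simp add: left_diff_distrib Bochner_Integration.integrable_diff int g intd)
        show "integrable lborel (\<lambda>z. e' * norm h * \<bar>f z\<bar>)" using f by simp
        show "norm (?k z) \<le> e' * norm h * \<bar>f z\<bar>" for z
        proof -
          have "x - z + h = y - z" by (simp add: h_def)
          then have "\<bar>g (y - z) - g (x - z) - dir_deriv h g (x - z)\<bar> \<le> e' * norm h"
            using d(2)[of h "x - z"] y by (simp add: h_def)
          then show ?thesis unfolding real_norm_def abs_mult by (rule mult_right_mono) simp
        qed
      qed
      moreover have "(LINT z|lborel. e' * norm h * \<bar>f z\<bar>) = (e' * I) * norm h" by (simp add: I_def)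
      moreover have "\<dots> \<le> e * norm h" using e' by (intro mult_right_mono) auto
      ultimately show ?thesis unfolding h_def[symmetric] by (metis order_trans)
    qed
    then show ?thesis using d(1) by blast
  qed
  show ?thesis unfolding has_derivative_at_alt using 1 2 by blast
qed

lemma dir_deriv_conv:
  assumes "smooth_cs g" "integrable lborel f"
  shows "dir_deriv v (conv g f) = conv (dir_deriv v g) f"
  using dir_deriv_eq[OF conv_has_derivative[OF assms]] by blast

lemma smooth_on_conv:
  fixes f g :: "'a::euclidean_space \<Rightarrow> real"
  assumes g: "smooth_cs g" and f: "integrable lborel f"
  shows "smooth_on UNIV (conv g f)"
proof -
  define F where "F = {conv g f | g. smooth_cs g}"
  show ?thesis
  proof (rule smooth_on_coinduct[of _ _ F])
    fix k assume "k \<in> F"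
    then obtain g where k: "k = conv g f" "smooth_cs g" by (auto simp: F_def)
    show "\<exists>k'. (\<forall>x\<in>UNIV. (k has_derivative k' x) (at x)) \<and> (\<forall>v. (\<lambda>x. k' x v) \<in> F)"
      using conv_has_derivative[OF k(2) f] smooth_cs_dir_deriv[OF k(2)] k(1)
      by (intro exI[of _ "\<lambda>x v. conv (dir_deriv v g) f x"]) (auto simp: F_def)
  qed (use g in \<open>auto simp: F_def\<close>)
qed

text \<open>By commutativity the derivative may fall on either factor. In
  \<open>mollify_error\<close> it has to fall on the test component, so that
  \<open>conv_self_adjoint\<close> can be applied.\<close>

lemma dir_deriv_conv_right:
  assumes [measurable]: "g \<in> borel_measurable borel"
  assumes "smooth_cs f" "integrable lborel g"
  shows "dir_deriv v (conv g f) = conv g (dir_deriv v f)"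
  using dir_deriv_conv[OF assms(2,3)] conv_commute[of g f] conv_commute[of g "dir_deriv v f"]
    smooth_cs_measurable[OF assms(2)] smooth_cs_measurable[OF smooth_cs_dir_deriv[OF assms(2)]] assms(1)
  by simp

text \<open>Tonelli: integrating \<open>\<bar>g (x - y) * f y\<bar>\<close> first in
  \<open>x\<close>, translation invariance leaves \<open>\<bar>f y\<bar>\<close> times the integral
  of \<open>\<bar>g\<bar>\<close>. The pair is swapped in the proof to make \<open>x\<close> the
  inner variable.\<close>

lemma conv_product_integrable:
  fixes f g :: "'a::euclidean_space \<Rightarrow> real"
  assumes f: "integrable lborel f" and g: "integrable lborel g"
  shows "integrable (lborel \<Otimes>\<^sub>M lborel) (\<lambda>(x, y). g (x - y) * f y)"
proof -
  have [measurable]: "f \<in> borel_measurable borel" "g \<in> borel_measurable borel"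
    using f g by (auto dest: borel_measurable_integrable)
  have "integrable (lborel \<Otimes>\<^sub>M lborel) (\<lambda>(y, x). g (x - y) * f y)"
  proof (rule lborel_pair.Fubini_integrable)
    have "(LINT x|lborel. norm (g (x - y) * f y)) = (LINT x|lborel. \<bar>g x\<bar>) * \<bar>f y\<bar>" for y
      using lborel_integral_shift[of "\<lambda>x. \<bar>g x\<bar>" y] by (simp add: abs_mult)
    then show "integrable lborel (\<lambda>y. LINT x|lborel. norm (case (y, x) of (y, x) \<Rightarrow> g (x - y) * f y))"
      using f by simp
    show "AE y in lborel. integrable lborel (\<lambda>x. case (y, x) of (y, x) \<Rightarrow> g (x - y) * f y)"
      using g lborel_integrable_shift[of g] by simp
  qed measurable
  from lborel_pair.integrable_product_swap[OF this] show ?thesis by simp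
qed

lemma conv_integrable:
  assumes "integrable lborel f" "integrable lborel g"
  shows "integrable lborel (conv g f)"
  using lborel_pair.integrable_fst'[OF conv_product_integrable[OF assms]]
  by (simp add: conv_def[abs_def])

text \<open>Fubini, with evenness making the kernel symmetric in its two variables. It carries the
  mollifier from the function over to the test field.\<close>

lemma conv_self_adjoint:
  fixes f g h :: "'a::euclidean_space \<Rightarrow> real"
  assumes f: "integrable lborel f" and g: "integrable lborel g" and even: "\<And>x. g (- x) = g x"
    and h: "h \<in> borel_measurable borel" "\<And>x. \<bar>h x\<bar> \<le> B"
  shows "(LINT x|lborel. conv g f x * h x) = (LINT x|lborel. f x * conv g h x)"
proof -
  have [measurable]: "f \<in> borel_measurable borel" "g \<in> borel_measurable borel"
    using f g by (auto dest: borel_measurable_integrable)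
  note [measurable] = h(1)
  have "integrable (lborel \<Otimes>\<^sub>M lborel) (\<lambda>p. h (fst p) * (case p of (x, y) \<Rightarrow> g (x - y) * f y))"
    by (rule integrable_bounded_mult[OF conv_product_integrable[OF f g]]) (use h in auto)
  then have "integrable (lborel \<Otimes>\<^sub>M lborel) (\<lambda>(x, y). h x * (g (x - y) * f y))"
    by (simp add: case_prod_unfold)
  from lborel_pair.Fubini_integral[OF this]
  have "(LINT x|lborel. LINT y|lborel. h x * (g (x - y) * f y)) =
      (LINT y|lborel. LINT x|lborel. h x * (g (x - y) * f y))" ..
  moreover have "g (x - y) = g (y - x)" for x y using even[of "x - y"] by simp
  then have "(LINT x|lborel. h x * (g (x - y) * f y)) = f y * conv g h y" for y
    unfolding conv_def by (subst integral_mult_right_zero[symmetric]) (simp add: mult_ac)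
  moreover have "(LINT y|lborel. h x * (g (x - y) * f y)) = conv g f x * h x" for x
    unfolding conv_def by (simp add: mult.commute)
  ultimately show ?thesis by (simp only:)
qed

lemma conv_minus: "conv g (\<lambda>x. - f x) x = - conv g f x"
  by (simp add: conv_def)

lemma conv_nonzero:
  assumes "conv g f x \<noteq> 0"
  obtains y where "g (x - y) \<noteq> 0" "f y \<noteq> 0"
proof -
  have "\<exists>y. g (x - y) * f y \<noteq> 0"
  proof (rule ccontr)
    assume "\<not> ?thesis"
    then have "(\<lambda>y. g (x - y) * f y) = (\<lambda>y. 0)" by blast
    then have "conv g f x = 0" unfolding conv_def by (simp only: Bochner_Integration.integral_zero)
    then show False using assms by simp
  qed
  then show ?thesis using that by auto
qed

section \<open>Mollification in the mean\<close>

text \<open>Continuity of translation in the mean, put in terms of sequences so that dominated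
  convergence applies directly.\<close>

definition L1_shift_continuous :: "('a::euclidean_space \<Rightarrow> real) \<Rightarrow> bool" where
  "L1_shift_continuous f \<longleftrightarrow>
     (\<forall>h. h \<longlonglongrightarrow> 0 \<longrightarrow> (\<lambda>n::nat. LINT x|lborel. \<bar>f (x - h n) - f x\<bar>) \<longlonglongrightarrow> 0)"

lemma integrable_shift: "integrable lborel f \<Longrightarrow> integrable lborel (\<lambda>x. f (x - y))"
  for f :: "'a::euclidean_space \<Rightarrow> real"
  using lborel_integrable_shift[of f y] by simp

text \<open>Closedness under limits in the mean: a translation preserves the integral of
  \<open>\<bar>f - g\<bar>\<close>, so three terms of size at most \<open>e / 4\<close> stay below
  \<open>e\<close>.\<close>

lemma L1_shift_continuous_approx:
  fixes f :: "'a::euclidean_space \<Rightarrow> real"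
  assumes f: "integrable lborel f"
    and approx: "\<And>e. e > 0 \<Longrightarrow>
      \<exists>g. integrable lborel g \<and> L1_shift_continuous g \<and> (LINT x|lborel. \<bar>f x - g x\<bar>) \<le> e"
  shows "L1_shift_continuous f"
  unfolding L1_shift_continuous_def
proof (intro allI impI LIMSEQ_I)
  fix h :: "nat \<Rightarrow> 'a" and e :: real
  assume h: "h \<longlonglongrightarrow> 0" and e: "0 < e"
  obtain g where g: "integrable lborel g" "L1_shift_continuous g" "(LINT x|lborel. \<bar>f x - g x\<bar>) \<le> e / 4"
    using approx[of "e / 4"] e by auto
  have "(\<lambda>n. LINT x|lborel. \<bar>g (x - h n) - g x\<bar>) \<longlonglongrightarrow> 0"
    using g(2) h by (simp add: L1_shift_continuous_def)
  then have "eventually (\<lambda>n. (LINT x|lborel. \<bar>g (x - h n) - g x\<bar>) < e / 4) sequentially"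
    using e by (intro order_tendstoD) auto
  then obtain N where N: "\<And>n. n \<ge> N \<Longrightarrow> (LINT x|lborel. \<bar>g (x - h n) - g x\<bar>) < e / 4"
    by (auto simp: eventually_sequentially)
  have "(LINT x|lborel. \<bar>f (x - h n) - f x\<bar>) < e" if n: "n \<ge> N" for n
  proof -
    have [measurable]: "f \<in> borel_measurable borel" "g \<in> borel_measurable borel"
      using f g(1) by (auto dest: borel_measurable_integrable)
    have int: "integrable lborel (\<lambda>x. f (x - h n))" "integrable lborel (\<lambda>x. g (x - h n))"
      using f g(1) by (auto intro: integrable_shift)
    have "(LINT x|lborel. \<bar>f (x - h n) - f x\<bar>) \<le>
      (LINT x|lborel. \<bar>f (x - h n) - g (x - h n)\<bar> + \<bar>g (x - h n) - g x\<bar> + \<bar>f x - g x\<bar>)"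
      by (rule integral_mono) (use f g(1) int in auto)
    moreover have "\<dots> = (LINT x|lborel. \<bar>f (x - h n) - g (x - h n)\<bar>)
        + (LINT x|lborel. \<bar>g (x - h n) - g x\<bar>) + (LINT x|lborel. \<bar>f x - g x\<bar>)"
      using f g(1) int by simp
    moreover have "(LINT x|lborel. \<bar>f (x - h n) - g (x - h n)\<bar>) = (LINT x|lborel. \<bar>f x - g x\<bar>)"
      using lborel_integral_shift[of "\<lambda>x. \<bar>f x - g x\<bar>" "h n"] by simp
    ultimately show ?thesis using g(3) N[OF n] e by linarith
  qed
  then show "\<exists>no. \<forall>n\<ge>no. norm ((LINT x|lborel. \<bar>f (x - h n) - f x\<bar>) - 0) < e"
    by auto
qed

text \<open>An indicator and its translate have the same integral, so the integral of their distance
  is twice that of the part lost by shifting. This part is dominated by the indicator and tends to 0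
  pointwise, since a point of an open set stays inside under small shifts.\<close>

lemma L1_shift_continuous_open:
  fixes U :: "'a::euclidean_space set"
  assumes U: "open U" "emeasure lborel U < \<infinity>"
  shows "L1_shift_continuous (\<lambda>x. indicator U x * c)"
  unfolding L1_shift_continuous_def
proof (intro allI impI)
  fix h :: "nat \<Rightarrow> 'a"
  assume h: "h \<longlonglongrightarrow> 0"
  let ?u = "indicator U :: 'a \<Rightarrow> real"
  have u: "integrable lborel ?u" using U by simp
  have [measurable]: "U \<in> sets borel" using U by simp
  have uh: "integrable lborel (\<lambda>x. ?u (x - h n))" for n by (rule integrable_shift[OF u])
  have lim: "(\<lambda>n. LINT x|lborel. max 0 (?u x - ?u (x - h n))) \<longlonglongrightarrow> (LINT x|(lborel :: 'a measure). 0)"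
  proof (rule integral_dominated_convergence[where w = ?u])
    show "AE x in lborel. (\<lambda>n. max 0 (?u x - ?u (x - h n))) \<longlonglongrightarrow> 0"
    proof (intro AE_I2)
      fix x :: 'a
      show "(\<lambda>n. max 0 (?u x - ?u (x - h n))) \<longlonglongrightarrow> 0"
      proof (cases "x \<in> U")
        case True
        have "(\<lambda>n. x - h n) \<longlonglongrightarrow> x" using tendsto_diff[OF tendsto_const h, of x] by simp
        then have "eventually (\<lambda>n. x - h n \<in> U) sequentially"
          using U(1) True by (rule topological_tendstoD)
        then have "eventually (\<lambda>n. max 0 (?u x - ?u (x - h n)) = 0) sequentially"
          by eventually_elim (use True in auto)
        then show ?thesis by (rule tendsto_eventually)
      qed simp
    qed
    show "AE x in lborel. norm (max 0 (?u x - ?u (x - h n))) \<le> ?u x" for n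
      by (auto simp: indicator_def)
  qed (use u in auto)
  have "(LINT x|lborel. \<bar>?u (x - h n) * c - ?u x * c\<bar>) =
      2 * \<bar>c\<bar> * (LINT x|lborel. max 0 (?u x - ?u (x - h n)))" for n
  proof -
    \<comment> \<open>This is \<open>\<bar>t\<bar> = t + 2 * max 0 (- t)\<close> for the difference
      \<open>t\<close> of the shifted and the original indicator; the integral of \<open>t\<close>
      is 0.\<close>
    have "(LINT x|lborel. \<bar>?u (x - h n) * c - ?u x * c\<bar>) =
      (LINT x|lborel. \<bar>c\<bar> * (?u (x - h n) - ?u x + 2 * max 0 (?u x - ?u (x - h n))))"
      by (rule Bochner_Integration.integral_cong) (auto simp: indicator_def)
    also have "\<dots> = \<bar>c\<bar> * ((LINT x|lborel. ?u (x - h n)) - (LINT x|lborel. ?u x)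
        + 2 * (LINT x|lborel. max 0 (?u x - ?u (x - h n))))"
      using u uh by simp
    also have "(LINT x|lborel. ?u (x - h n)) = (LINT x|lborel. ?u x)"
      by (rule lborel_integral_shift) measurable
    finally show ?thesis by simp
  qed
  then show "(\<lambda>n. LINT x|lborel. \<bar>?u (x - h n) * c - ?u x * c\<bar>) \<longlonglongrightarrow> 0"
    using tendsto_mult_left[OF lim, of "2 * \<bar>c\<bar>"] by simp
qed

text \<open>Built up from indicators: outer regularity reduces sets of finite measure to open ones,
  sums follow by the triangle inequality, and limits by dominated convergence with
  \<open>L1_shift_continuous_approx\<close>.\<close>

lemma L1_shift_continuous_integrable:
  fixes f :: "'a::euclidean_space \<Rightarrow> real"
  assumes "integrable lborel f"
  shows "L1_shift_continuous f"
  using assms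
proof (induction rule: integrable_induct)
  case (base A c)
  then have A: "A \<in> sets borel" "emeasure lborel A < \<infinity>" by auto
  have int: "integrable lborel (\<lambda>x. indicator A x * c)" using A by simp
  have "L1_shift_continuous (\<lambda>x. indicator A x * c)"
  proof (rule L1_shift_continuous_approx[OF int])
    fix e :: real assume e: "e > 0"
    define e' where "e' = e / (\<bar>c\<bar> + 1)"
    have e': "e' > 0" "\<bar>c\<bar> * e' \<le> e" using e by (auto simp: e'_def field_simps)
    obtain U where U: "open U" "A \<subseteq> U" "U - A \<in> lmeasurable" "emeasure lebesgue (U - A) < ennreal e'"
      using sets_lebesgue_outer_open[of A e'] A e' by (metis sets_completionI_sets sets_lborel)
    have bor: "U - A \<in> sets borel" "U \<in> sets borel" using A U by auto
    have mUA: "emeasure lborel (U - A) < ennreal e'"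
      using U(4) bor by (simp add: emeasure_completion)
    have "U = A \<union> (U - A)" using U(2) by blast
    then have "emeasure lborel U \<le> emeasure lborel A + emeasure lborel (U - A)"
      using emeasure_subadditive[of A lborel "U - A"] A bor by simp
    also have "\<dots> < \<infinity>" using A(2) mUA less_trans[OF mUA ennreal_less_top] by simp
    finally have fin: "emeasure lborel U < \<infinity>" .
    have "(LINT x|lborel. \<bar>indicator A x * c - indicator U x * c\<bar>) = (LINT x|lborel. \<bar>c\<bar> * indicator (U - A) x)"
      using U(2) by (intro Bochner_Integration.integral_cong) (auto simp: indicator_def)
    also have "\<dots> = \<bar>c\<bar> * measure lborel (U - A)" using bor by simp
    also have "\<dots> \<le> \<bar>c\<bar> * e'"
      using mUA e' by (intro mult_left_mono) (auto simp: measure_def enn2real_leI less_imp_le)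
    finally have "(LINT x|lborel. \<bar>indicator A x * c - indicator U x * c\<bar>) \<le> e" using e' by simp
    moreover have "integrable lborel (\<lambda>x. indicator U x * c)" using fin bor by simp
    ultimately show "\<exists>g. integrable lborel g \<and> L1_shift_continuous g \<and>
        (LINT x|lborel. \<bar>indicator A x * c - g x\<bar>) \<le> e"
      using L1_shift_continuous_open[OF U(1) fin, of c] by blast
  qed
  then show ?case by simp
next
  case (add f g)
  show ?case unfolding L1_shift_continuous_def
  proof (intro allI impI)
    fix h :: "nat \<Rightarrow> 'a" assume h: "h \<longlonglongrightarrow> 0"
    have lim: "(\<lambda>n. (LINT x|lborel. \<bar>f (x - h n) - f x\<bar>) + (LINT x|lborel. \<bar>g (x - h n) - g x\<bar>)) \<longlonglongrightarrow> 0 + 0"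
      by (intro tendsto_add) (use add h in \<open>auto simp: L1_shift_continuous_def\<close>)
    have "(LINT x|lborel. \<bar>f (x - h n) + g (x - h n) - (f x + g x)\<bar>) \<le>
      (LINT x|lborel. \<bar>f (x - h n) - f x\<bar>) + (LINT x|lborel. \<bar>g (x - h n) - g x\<bar>)" for n
    proof -
      have int: "integrable lborel (\<lambda>x. f (x - h n))" "integrable lborel (\<lambda>x. g (x - h n))"
        using add by (auto intro: integrable_shift)
      have "(LINT x|lborel. \<bar>f (x - h n) + g (x - h n) - (f x + g x)\<bar>) \<le>
        (LINT x|lborel. \<bar>f (x - h n) - f x\<bar> + \<bar>g (x - h n) - g x\<bar>)"
        by (rule integral_mono) (use add int in auto)
      then show ?thesis using add int by simp
    qed
    then show "(\<lambda>n. LINT x|lborel. \<bar>f (x - h n) + g (x - h n) - (f x + g x)\<bar>) \<longlonglongrightarrow> 0"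
      using tendsto_sandwich[OF _ _ tendsto_const lim[simplified]] by (simp add: always_eventually)
  qed
next
  case (lim f s)
  show ?case
  proof (rule L1_shift_continuous_approx[OF lim.hyps(4)])
    fix e :: real assume e: "e > 0"
    have "(\<lambda>i. LINT x|lborel. \<bar>f x - s i x\<bar>) \<longlonglongrightarrow> (LINT x|(lborel :: 'a measure). 0)"
    \<comment> \<open>The approximants of the induction rule satisfy
      \<open>\<bar>s i x\<bar> \<le> 2 * \<bar>f x\<bar>\<close>; together with \<open>f\<close>
      itself this makes 3.\<close>
    proof (rule integral_dominated_convergence[where w = "\<lambda>x. 3 * \<bar>f x\<bar>"])
      show "AE x in lborel. (\<lambda>i. \<bar>f x - s i x\<bar>) \<longlonglongrightarrow> 0"
      proof (intro AE_I2)
        fix x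
        have "(\<lambda>i. \<bar>f x - s i x\<bar>) \<longlonglongrightarrow> \<bar>f x - f x\<bar>"
          by (intro tendsto_rabs tendsto_diff tendsto_const lim.hyps(2)) simp
        then show "(\<lambda>i. \<bar>f x - s i x\<bar>) \<longlonglongrightarrow> 0" by simp
      qed
      show "AE x in lborel. norm \<bar>f x - s i x\<bar> \<le> 3 * \<bar>f x\<bar>" for i
      proof (intro AE_I2)
        fix x show "norm \<bar>f x - s i x\<bar> \<le> 3 * \<bar>f x\<bar>" using lim.hyps(3)[of x i] by auto
      qed
    qed (use lim.hyps in \<open>auto dest: borel_measurable_integrable\<close>)
    then have "eventually (\<lambda>i. (LINT x|lborel. \<bar>f x - s i x\<bar>) < e) sequentially"
      using e by (intro order_tendstoD) auto
    then obtain i where "(LINT x|lborel. \<bar>f x - s i x\<bar>) < e"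
      by (auto simp: eventually_sequentially)
    then show "\<exists>g. integrable lborel g \<and> L1_shift_continuous g \<and> (LINT x|lborel. \<bar>f x - g x\<bar>) \<le> e"
      using lim.hyps(1) lim.IH by (auto intro!: exI[of _ "s i"])
  qed
qed

text \<open>Back from sequences to a radius: otherwise shifts of norm below \<open>1 / Suc n\<close>
  would all violate the bound while tending to 0.\<close>

lemma integrable_shift_small:
  fixes f :: "'a::euclidean_space \<Rightarrow> real"
  assumes "integrable lborel f" "e > 0"
  obtains d where "d > 0" "\<And>h. norm h < d \<Longrightarrow> (LINT x|lborel. \<bar>f (x - h) - f x\<bar>) \<le> e"
proof (rule ccontr)
  assume *: "\<not> thesis"
  have "\<exists>h. norm h < 1 / Suc n \<and> (LINT x|lborel. \<bar>f (x - h) - f x\<bar>) > e" for n :: nat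
    using * that[of "1 / Suc n"] by (force simp: not_le)
  then obtain h where h: "\<And>n. norm (h n) < 1 / Suc n" "\<And>n. (LINT x|lborel. \<bar>f (x - h n) - f x\<bar>) > e"
    by metis
  have "h \<longlonglongrightarrow> 0"
    using LIMSEQ_norm_0 h(1) by blast
  then have "(\<lambda>n. LINT x|lborel. \<bar>f (x - h n) - f x\<bar>) \<longlonglongrightarrow> 0"
    using L1_shift_continuous_integrable[OF assms(1)] by (simp add: L1_shift_continuous_def)
  then have "eventually (\<lambda>n. (LINT x|lborel. \<bar>f (x - h n) - f x\<bar>) < e) sequentially"
    using assms(2) by (intro order_tendstoD) auto
  then show False using h(2) by (auto simp: eventually_sequentially) (metis le_refl less_asym)
qed

section \<open>Mollifiers\<close>

definition mollifier :: "real \<Rightarrow> ('a::euclidean_space \<Rightarrow> real) \<Rightarrow> bool" where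
  "mollifier r \<eta> \<longleftrightarrow> smooth_cs \<eta> \<and> (\<forall>x. 0 \<le> \<eta> x) \<and> (\<forall>x. \<eta> (- x) = \<eta> x) \<and>
     (\<forall>x. \<eta> x \<noteq> 0 \<longrightarrow> norm x < r) \<and> (LINT x|lborel. \<eta> x) = 1"

text \<open>A normalised product of one-dimensional bumps. Each coordinate is kept below
  \<open>r / DIM('a)\<close>, so the sum of the absolute coordinates, which dominates the norm,
  stays below \<open>r\<close>.\<close>

lemma mollifier_exists:
  assumes "r > 0"
  obtains \<eta> :: "'a::euclidean_space \<Rightarrow> real" where "mollifier r \<eta>"
proof -
  define \<delta> where "\<delta> = r / DIM('a)"
  have \<delta>: "\<delta> > 0" using assms by (simp add: \<delta>_def)
  \<comment> \<open>The two factors for \<open>b\<close> are nonzero exactly when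
    \<open>x \<bullet> b > - \<delta>\<close> and \<open>x \<bullet> b < \<delta>\<close>;
    reflection exchanges them, which gives evenness.\<close>
  define \<beta> where "\<beta> = (\<lambda>x::'a. \<Prod>b\<in>Basis. flat 1 ((b /\<^sub>R \<delta>) \<bullet> x + 1) * flat 1 ((- b /\<^sub>R \<delta>) \<bullet> x + 1))"
  have smooth: "smooth_on UNIV \<beta>"
    unfolding \<beta>_def by (intro smooth_on_prod smooth_on_mult smooth_on_flat_affine open_UNIV)
  have nonneg: "\<beta> x \<ge> 0" for x
    unfolding \<beta>_def by (intro prod_nonneg) (auto simp: flat_def)
  have supp: "norm x < r" if "\<beta> x \<noteq> 0" for x
  proof -
    have "\<bar>x \<bullet> b\<bar> < \<delta>" if "b \<in> Basis" for b
    proof -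
      have "flat 1 ((b /\<^sub>R \<delta>) \<bullet> x + 1) \<noteq> 0" "flat 1 ((- b /\<^sub>R \<delta>) \<bullet> x + 1) \<noteq> 0"
        using \<open>\<beta> x \<noteq> 0\<close> that by (auto simp: \<beta>_def)
      then have "(b /\<^sub>R \<delta>) \<bullet> x + 1 > 0" "(- b /\<^sub>R \<delta>) \<bullet> x + 1 > 0" by (auto simp: flat_def split: if_splits)
      then show ?thesis using \<delta> by (auto simp: field_simps inner_commute abs_less_iff)
    qed
    then have "(\<Sum>b\<in>Basis. \<bar>x \<bullet> b\<bar>) < (\<Sum>b\<in>(Basis::'a set). \<delta>)"
      by (intro sum_strict_mono) auto
    then show ?thesis using norm_le_l1[of x] by (simp add: \<delta>_def)
  qed
  have even: "\<beta> (- x) = \<beta> x" for x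
    unfolding \<beta>_def by (simp add: mult.commute)
  have cs: "smooth_cs \<beta>" using smooth supp by (auto simp: smooth_cs_def intro: less_imp_le)
  have int: "integrable lborel \<beta>" by (rule smooth_cs_integrable[OF cs])
  \<comment> \<open>Otherwise the open set where \<open>\<beta>\<close> is nonzero would be
    negligible, although it contains 0.\<close>
  have "(LINT x|lborel. \<beta> x) \<noteq> 0"
  proof
    assume "(LINT x|lborel. \<beta> x) = 0"
    then have "AE x in lborel. \<beta> x = 0"
      using integral_nonneg_eq_0_iff_AE[OF int] nonneg by auto
    then have "{x. \<beta> x \<noteq> 0} \<in> null_sets lborel"
      using smooth_cs_measurable[OF cs] by (subst (asm) AE_iff_null) auto
    then have "negligible {x. \<beta> x \<noteq> 0}"
      using negligible_iff_null_sets null_sets_completionI by blast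
    moreover have "open {x. \<beta> x \<noteq> 0}"
      by (intro open_Collect_neq smooth_cs_continuous cs continuous_on_const)
    moreover have "\<beta> 0 \<noteq> 0" by (simp add: \<beta>_def flat_def)
    ultimately show False using open_not_negligible by blast
  qed
  moreover have "(LINT x|lborel. \<beta> x) \<ge> 0" using nonneg by simp
  ultimately have pos: "(LINT x|lborel. \<beta> x) > 0" by simp
  define c where "c = inverse (LINT x|lborel. \<beta> x)"
  have "mollifier r (\<lambda>x. c * \<beta> x)"
    unfolding mollifier_def
  proof (intro conjI allI impI)
    show "smooth_cs (\<lambda>x. c * \<beta> x)" by (intro smooth_cs_mult cs smooth_on_const) simp
  qed (use nonneg even supp pos in \<open>auto simp: c_def\<close>)
  then show ?thesis by (rule that)
qed

lemma mollifier_smooth_cs: "mollifier r \<eta> \<Longrightarrow> smooth_cs \<eta>"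
  and mollifier_nonneg: "mollifier r \<eta> \<Longrightarrow> 0 \<le> \<eta> x"
  and mollifier_even: "mollifier r \<eta> \<Longrightarrow> \<eta> (- x) = \<eta> x"
  and mollifier_support: "mollifier r \<eta> \<Longrightarrow> \<eta> x \<noteq> 0 \<Longrightarrow> norm x < r"
  and mollifier_integral: "mollifier r \<eta> \<Longrightarrow> (LINT x|lborel. \<eta> x) = 1"
  by (auto simp: mollifier_def)

lemma mollifier_integrable: "mollifier r \<eta> \<Longrightarrow> integrable lborel \<eta>"
  by (simp add: mollifier_smooth_cs smooth_cs_integrable)

lemma mollifier_measurable: "mollifier r \<eta> \<Longrightarrow> \<eta> \<in> borel_measurable borel"
  by (simp add: mollifier_smooth_cs smooth_cs_measurable)

lemma mollifier_reflect_integrable: "mollifier r \<eta> \<Longrightarrow> integrable lborel (\<lambda>y. \<eta> (x - y))"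
  by (simp add: lborel_integrable_reflect mollifier_integrable mollifier_measurable)

lemma mollifier_reflect_integral: "mollifier r \<eta> \<Longrightarrow> (LINT y|lborel. \<eta> (x - y)) = 1"
  by (simp add: lborel_integral_reflect mollifier_integral mollifier_measurable)

text \<open>A mollification is an average, with total weight 1, of the values within distance
  \<open>r\<close>. The bound \<open>B\<close> makes the integrand integrable.\<close>

lemma conv_mollifier_mono:
  assumes "mollifier r \<eta>" and f: "f \<in> borel_measurable borel" "\<And>x. \<bar>f x\<bar> \<le> B"
    and "\<And>y. norm (x - y) < r \<Longrightarrow> f y \<le> C"
  shows "conv \<eta> f x \<le> C"
proof -
  have "conv \<eta> f x \<le> (LINT y|lborel. C * \<eta> (x - y))"
    unfolding conv_def
  proof (rule integral_mono)
    show "integrable lborel (\<lambda>y. \<eta> (x - y) * f y)"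
      using integrable_bounded_mult[OF mollifier_reflect_integrable[OF assms(1), of x], of f B] f
      by (simp add: mult.commute)
    show "\<eta> (x - y) * f y \<le> C * \<eta> (x - y)" for y
      using mollifier_nonneg[OF assms(1), of "x - y"] mollifier_support[OF assms(1), of "x - y"] assms(4)[of y]
      by (cases "\<eta> (x - y) = 0") (auto simp: mult.commute[of C] intro: mult_left_mono)
  qed (simp add: mollifier_reflect_integrable[OF assms(1)])
  then show ?thesis by (simp add: mollifier_reflect_integral[OF assms(1)])
qed

lemma conv_mollifier_ge:
  assumes "mollifier r \<eta>" and f: "f \<in> borel_measurable borel" "\<And>x. \<bar>f x\<bar> \<le> B"
    and "\<And>y. norm (x - y) < r \<Longrightarrow> C \<le> f y"
  shows "C \<le> conv \<eta> f x"
  using conv_mollifier_mono[OF assms(1), of "\<lambda>x. - f x" B x "- C"] assms by (simp add: conv_minus)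

text \<open>Minkowski's inequality: with the absolute value moved inside, Tonelli makes the integral
  in \<open>x\<close> the inner one, and \<open>small\<close> bounds it by \<open>e\<close> for
  every shift \<open>z\<close> in the support of \<open>\<eta>\<close>.\<close>

lemma conv_mollifier_L1:
  fixes f :: "'a::euclidean_space \<Rightarrow> real"
  assumes \<eta>: "mollifier r \<eta>" and f: "integrable lborel f"
    and small: "\<And>h. norm h < r \<Longrightarrow> (LINT x|lborel. \<bar>f (x - h) - f x\<bar>) \<le> e"
    and e: "e \<ge> 0"
  shows "(LINT x|lborel. \<bar>conv \<eta> f x - f x\<bar>) \<le> e"
proof -
  have [measurable]: "f \<in> borel_measurable borel" "\<eta> \<in> borel_measurable borel"
    using f mollifier_measurable[OF \<eta>] by (auto dest: borel_measurable_integrable)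
  obtain B where B: "\<And>x. \<bar>\<eta> x\<bar> \<le> B" using smooth_cs_bounded[OF mollifier_smooth_cs[OF \<eta>]] by metis
  have int: "integrable lborel (\<lambda>z. \<eta> z * f (x - z))" for x
    using f B by (intro integrable_bounded_mult[where B = B]) (auto simp: lborel_integrable_reflect)
  have intc: "integrable lborel (conv \<eta> f)"
    by (rule conv_integrable[OF f mollifier_integrable[OF \<eta>]])
  have eq: "conv \<eta> f x - f x = (LINT z|lborel. \<eta> z * (f (x - z) - f x))" for x
  proof -
    have "conv \<eta> f x = (LINT z|lborel. \<eta> z * f (x - z))"
      by (subst conv_commute) (auto simp: conv_def mult.commute)
    moreover have "f x = (LINT z|lborel. \<eta> z * f x)"
      by (simp add: mollifier_integral[OF \<eta>])
    ultimately show ?thesis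
      by (simp add: right_diff_distrib Bochner_Integration.integral_diff int mollifier_integrable[OF \<eta>])
  qed
  have "(\<integral>\<^sup>+x. ennreal \<bar>conv \<eta> f x - f x\<bar> \<partial>lborel) \<le>
      (\<integral>\<^sup>+x. (\<integral>\<^sup>+z. ennreal (\<eta> z * \<bar>f (x - z) - f x\<bar>) \<partial>lborel) \<partial>lborel)"
  proof (intro nn_integral_mono)
    fix x
    have "ennreal (norm (LINT z|lborel. \<eta> z * (f (x - z) - f x))) \<le>
        (\<integral>\<^sup>+z. norm (\<eta> z * (f (x - z) - f x)) \<partial>lborel)"
      by (rule integral_norm_bound_ennreal) (simp add: right_diff_distrib int mollifier_integrable[OF \<eta>])
    then show "ennreal \<bar>conv \<eta> f x - f x\<bar> \<le> (\<integral>\<^sup>+z. ennreal (\<eta> z * \<bar>f (x - z) - f x\<bar>) \<partial>lborel)"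
      by (simp add: eq abs_mult mollifier_nonneg[OF \<eta>])
  qed
  also have "\<dots> = (\<integral>\<^sup>+z. (\<integral>\<^sup>+x. ennreal (\<eta> z * \<bar>f (x - z) - f x\<bar>) \<partial>lborel) \<partial>lborel)"
    by (rule lborel_pair.Fubini'[symmetric]) measurable
  also have "\<dots> \<le> (\<integral>\<^sup>+z. ennreal (\<eta> z * e) \<partial>lborel)"
  proof (intro nn_integral_mono)
    fix z
    have "(\<integral>\<^sup>+x. ennreal (\<eta> z * \<bar>f (x - z) - f x\<bar>) \<partial>lborel) = ennreal (LINT x|lborel. \<eta> z * \<bar>f (x - z) - f x\<bar>)"
      by (rule nn_integral_eq_integral) (use f integrable_shift[OF f] mollifier_nonneg[OF \<eta>] in auto)
    moreover have "\<eta> z * (LINT x|lborel. \<bar>f (x - z) - f x\<bar>) \<le> \<eta> z * e"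
      using small[of z] mollifier_support[OF \<eta>, of z] mollifier_nonneg[OF \<eta>, of z]
      by (cases "\<eta> z = 0") (auto intro: mult_left_mono)
    ultimately show "(\<integral>\<^sup>+x. ennreal (\<eta> z * \<bar>f (x - z) - f x\<bar>) \<partial>lborel) \<le> ennreal (\<eta> z * e)"
      by (simp add: ennreal_leI)
  qed
  also have "\<dots> = ennreal (LINT z|lborel. \<eta> z * e)"
    by (rule nn_integral_eq_integral) (use e mollifier_integrable[OF \<eta>] mollifier_nonneg[OF \<eta>] in auto)
  also have "\<dots> = ennreal e" by (simp add: mollifier_integral[OF \<eta>])
  finally have "(\<integral>\<^sup>+x. ennreal \<bar>conv \<eta> f x - f x\<bar> \<partial>lborel) \<le> ennreal e" .
  moreover have "(\<integral>\<^sup>+x. ennreal \<bar>conv \<eta> f x - f x\<bar> \<partial>lborel) = ennreal (LINT x|lborel. \<bar>conv \<eta> f x - f x\<bar>)"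
    by (rule nn_integral_eq_integral) (use intc f in auto)
  ultimately show ?thesis using e by simp
qed

text \<open>A finite set of functions admits a common radius; the same mollifier later has to serve
  all terms of an index at once.\<close>

lemma mollifier_approx:
  fixes F :: "('a::euclidean_space \<Rightarrow> real) set"
  assumes "finite F" "\<And>f. f \<in> F \<Longrightarrow> integrable lborel f" "e > 0" "r > 0"
  obtains \<eta> where "mollifier r \<eta>" "\<And>f. f \<in> F \<Longrightarrow> (LINT x|lborel. \<bar>conv \<eta> f x - f x\<bar>) \<le> e"
proof -
  have "\<exists>d>0. \<forall>f\<in>F. \<forall>h. norm h < d \<longrightarrow> (LINT x|lborel. \<bar>f (x - h) - f x\<bar>) \<le> e"
    using assms(1,2)
  proof (induction F)
    case empty
    then show ?case by (auto intro: exI[of _ 1])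
  next
    case (insert f F)
    obtain d where d: "d > 0" "\<forall>f\<in>F. \<forall>h. norm h < d \<longrightarrow> (LINT x|lborel. \<bar>f (x - h) - f x\<bar>) \<le> e"
      using insert by auto
    obtain d' where d': "d' > 0" "\<And>h. norm h < d' \<Longrightarrow> (LINT x|lborel. \<bar>f (x - h) - f x\<bar>) \<le> e"
      using integrable_shift_small[of f e] insert.prems assms(3) by blast
    show ?case using d d' by (intro exI[of _ "min d d'"]) auto
  qed
  then obtain d where d: "d > 0" "\<And>f h. f \<in> F \<Longrightarrow> norm h < d \<Longrightarrow> (LINT x|lborel. \<bar>f (x - h) - f x\<bar>) \<le> e"
    by blast
  obtain \<eta> :: "'a \<Rightarrow> real" where \<eta>: "mollifier (min d r) \<eta>"
    using mollifier_exists[of "min d r"] d assms(4) by auto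
  have "mollifier r \<eta>" using \<eta> by (force simp: mollifier_def)
  moreover have "(LINT x|lborel. \<bar>conv \<eta> f x - f x\<bar>) \<le> e" if "f \<in> F" for f
    using assms(2)[OF that] d(2)[OF that] assms(3) by (intro conv_mollifier_L1[OF \<eta>]) auto
  ultimately show ?thesis by (rule that)
qed

section \<open>Cutoffs and partitions of unity\<close>

definition inset :: "'a::metric_space set \<Rightarrow> real \<Rightarrow> 'a set" where
  "inset \<Omega> r = {x. \<forall>y. y \<notin> \<Omega> \<longrightarrow> r \<le> dist x y}"

lemma inset_mono: "x \<in> inset \<Omega> r \<Longrightarrow> s \<le> r \<Longrightarrow> x \<in> inset \<Omega> s"
  by (fastforce simp: inset_def)

lemma inset_subset: "r > 0 \<Longrightarrow> inset \<Omega> r \<subseteq> \<Omega>"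
  by (force simp: inset_def)

lemma inset_shift:
  assumes "x \<in> inset \<Omega> r" "dist x y \<le> d"
  shows "y \<in> inset \<Omega> (r - d)"
  unfolding inset_def
proof safe
  fix z assume "z \<notin> \<Omega>"
  then have "r \<le> dist x z" using assms(1) by (auto simp: inset_def)
  then show "r - d \<le> dist y z" using assms(2) dist_triangle[of x z y] by linarith
qed

lemma closed_inset: "closed (inset \<Omega> r)"
proof -
  have "inset \<Omega> r = (\<Inter>y\<in>-\<Omega>. {x. r \<le> dist x y})" by (auto simp: inset_def)
  then show ?thesis
    by (auto intro!: closed_INT closed_Collect_le continuous_on_dist continuous_on_const continuous_on_id)
qed

lemma compact_inset:
  fixes \<Omega> :: "'a::euclidean_space set"
  assumes "bounded \<Omega>" "r > 0"
  shows "compact (inset \<Omega> r)"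
  unfolding compact_eq_bounded_closed
  using closed_inset bounded_subset[OF assms(1) inset_subset[OF assms(2)]] by blast

lemma compact_subset_inset:
  fixes \<Omega> :: "'a::euclidean_space set"
  assumes "compact K" "K \<subseteq> \<Omega>" "open \<Omega>"
  obtains r where "r > 0" "K \<subseteq> inset \<Omega> r"
proof -
  obtain d where d: "d > 0" "\<forall>x\<in>-\<Omega>. \<forall>y\<in>K. d \<le> dist x y"
    using separate_closed_compact[of "-\<Omega>" K] assms by blast
  have "K \<subseteq> inset \<Omega> d"
    using d(2) by (auto simp: inset_def dist_commute[of _ "_ :: 'a"]) (metis ComplI dist_commute)
  then show ?thesis using that d(1) by blast
qed

text \<open>The indicator of the intermediate set \<open>inset \<Omega> (s + d)\<close> is mollified
  at radius \<open>d = (r - s) / 2\<close>: balls of this radius around points of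
  \<open>inset \<Omega> r\<close> lie in the intermediate set, and those around points outside
  \<open>inset \<Omega> s\<close> miss it.\<close>

lemma smooth_cutoff:
  fixes \<Omega> :: "'a::euclidean_space set"
  assumes \<Omega>: "bounded \<Omega>" and sr: "0 < s" "s < r"
  obtains \<kappa> :: "'a \<Rightarrow> real" where "smooth_cs \<kappa>" "\<And>x. 0 \<le> \<kappa> x" "\<And>x. \<kappa> x \<le> 1"
    "\<And>x. x \<in> inset \<Omega> r \<Longrightarrow> \<kappa> x = 1" "\<And>x. x \<notin> inset \<Omega> s \<Longrightarrow> \<kappa> x = 0"
proof -
  define d where "d = (r - s) / 2"
  have d: "d > 0" using sr by (simp add: d_def)
  obtain \<rho> :: "'a \<Rightarrow> real" where \<rho>: "mollifier d \<rho>" using mollifier_exists[OF d] by blast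
  define K where "K = inset \<Omega> (s + d)"
  have K: "compact K" unfolding K_def using \<Omega> sr d by (intro compact_inset) auto
  have ind: "integrable lborel (indicator K :: 'a \<Rightarrow> real)"
    using emeasure_compact_finite[OF K] borel_compact[OF K] by (simp add: less_top)
  have meas: "(indicator K :: 'a \<Rightarrow> real) \<in> borel_measurable borel"
    using borel_compact[OF K] by simp
  define \<kappa> where "\<kappa> = conv \<rho> (indicator K)"
  have bnd: "0 \<le> \<kappa> x" "\<kappa> x \<le> 1" for x
    unfolding \<kappa>_def
    by (rule conv_mollifier_ge[OF \<rho> meas, of 1] conv_mollifier_mono[OF \<rho> meas, of 1]; simp add: indicator_def)+
  have one: "\<kappa> x = 1" if x: "x \<in> inset \<Omega> r" for x
  proof -
    have "y \<in> K" if "norm (x - y) < d" for y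
      using inset_shift[OF x, of y d] that by (simp add: K_def dist_norm d_def field_simps)
    then have "1 \<le> \<kappa> x"
      unfolding \<kappa>_def by (intro conv_mollifier_ge[OF \<rho> meas, of 1]) (auto simp: indicator_def)
    then show ?thesis using bnd(2)[of x] by simp
  qed
  have zero: "\<kappa> x = 0" if x: "x \<notin> inset \<Omega> s" for x
  proof (rule ccontr)
    assume "\<kappa> x \<noteq> 0"
    then obtain y where y: "\<rho> (x - y) \<noteq> 0" "indicator K y \<noteq> (0::real)"
      unfolding \<kappa>_def by (rule conv_nonzero)
    then have "y \<in> K" "dist y x \<le> d"
      using mollifier_support[OF \<rho>, of "x - y"] by (auto simp: indicator_def dist_norm norm_minus_commute split: if_splits)
    then show False using inset_shift[of y \<Omega> "s + d" x d] x by (simp add: K_def)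
  qed
  obtain R where R: "\<And>x. x \<in> inset \<Omega> s \<Longrightarrow> norm x \<le> R"
    using compact_inset[OF \<Omega> sr(1)] compact_imp_bounded bounded_iff by metis
  have "smooth_cs \<kappa>"
    unfolding smooth_cs_def
  proof (intro conjI exI[of _ R] allI impI)
    show "smooth_on UNIV \<kappa>" unfolding \<kappa>_def by (rule smooth_on_conv[OF mollifier_smooth_cs[OF \<rho>] ind])
    show "norm x \<le> R" if "\<kappa> x \<noteq> 0" for x using that R zero by blast
  qed
  then show ?thesis using that bnd one zero by blast
qed

lemma smooth_cs_diff:
  assumes "smooth_cs f" "smooth_cs g"
  shows "smooth_cs (\<lambda>x. f x - g x)"
proof -
  obtain R S where R: "\<And>x. f x \<noteq> 0 \<Longrightarrow> norm x \<le> R" and S: "\<And>x. g x \<noteq> 0 \<Longrightarrow> norm x \<le> S"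
    using assms unfolding smooth_cs_def by metis
  have "smooth_on UNIV (\<lambda>x. f x + - g x)"
    by (intro smooth_on_add smooth_on_bounded_linear[OF _ _ bounded_linear_minus[OF bounded_linear_ident]]
        smooth_cs_smooth assms open_UNIV)
  moreover have "norm x \<le> max R S" if "f x - g x \<noteq> 0" for x
    using R[of x] S[of x] that by fastforce
  ultimately show ?thesis unfolding smooth_cs_def by auto
qed

text \<open>Differences of nested cutoffs, whose sums telescope. The support of
  \<open>\<kappa> k\<close> lies in \<open>inset \<Omega> (1 / (real k + 2))\<close>, where
  \<open>\<kappa> (Suc k)\<close> is already 1; this makes the differences nonnegative.\<close>

lemma smooth_partition:
  fixes \<Omega> :: "'a::euclidean_space set"
  assumes \<Omega>: "bounded \<Omega>"
  obtains \<zeta> :: "nat \<Rightarrow> 'a \<Rightarrow> real" where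
    "\<And>i. smooth_cs (\<zeta> i)" "\<And>i x. 0 \<le> \<zeta> i x" "\<And>n x. (\<Sum>i<n. \<zeta> i x) \<le> 1"
    "\<And>i x. \<zeta> i x \<noteq> 0 \<Longrightarrow> x \<in> inset \<Omega> (1 / (real i + 2))"
    "\<And>i x. i > 0 \<Longrightarrow> x \<in> inset \<Omega> (1 / real i) \<Longrightarrow> \<zeta> i x = 0"
    "\<And>n x. n > 0 \<Longrightarrow> x \<in> inset \<Omega> (1 / real n) \<Longrightarrow> (\<Sum>i<n. \<zeta> i x) = 1"
proof -
  have "\<exists>\<kappa> :: 'a \<Rightarrow> real. smooth_cs \<kappa> \<and> (\<forall>x. 0 \<le> \<kappa> x \<and> \<kappa> x \<le> 1 \<and> (x \<in> inset \<Omega> (1 / (real i + 1)) \<longrightarrow> \<kappa> x = 1) \<and>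
      (x \<notin> inset \<Omega> (1 / (real i + 2)) \<longrightarrow> \<kappa> x = 0))" for i :: nat
    by (rule smooth_cutoff[OF \<Omega>, of "1 / (real i + 2)" "1 / (real i + 1)"]) (auto simp: field_simps)
  then obtain \<kappa> :: "nat \<Rightarrow> 'a \<Rightarrow> real" where \<kappa>: "\<And>i. smooth_cs (\<kappa> i)"
    "\<And>i x. 0 \<le> \<kappa> i x" "\<And>i x. \<kappa> i x \<le> 1"
    "\<And>i x. x \<in> inset \<Omega> (1 / (real i + 1)) \<Longrightarrow> \<kappa> i x = 1"
    "\<And>i x. x \<notin> inset \<Omega> (1 / (real i + 2)) \<Longrightarrow> \<kappa> i x = 0"
    by metis
  define \<zeta> where "\<zeta> i = (case i of 0 \<Rightarrow> \<kappa> 0 | Suc k \<Rightarrow> (\<lambda>x. \<kappa> (Suc k) x - \<kappa> k x))" for i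
  have \<zeta>: "\<zeta> 0 = \<kappa> 0" "\<zeta> (Suc k) = (\<lambda>x. \<kappa> (Suc k) x - \<kappa> k x)" for k by (simp_all add: \<zeta>_def)
  have sum: "(\<Sum>i<Suc n. \<zeta> i x) = \<kappa> n x" for n x
    by (induction n) (simp_all add: \<zeta>)
  have next1: "\<kappa> (Suc k) x = 1" if "\<kappa> k x \<noteq> 0" for k x
    using \<kappa>(4)[of x "Suc k"] \<kappa>(5)[of x k] that by (force simp: add.commute)
  show ?thesis
  proof (rule that)
    show "smooth_cs (\<zeta> i)" for i
      using \<kappa>(1) by (cases i) (auto simp: \<zeta> intro: smooth_cs_diff)
    show "0 \<le> \<zeta> i x" for i x
      using \<kappa>(2,3) next1[of "i - 1" x] by (cases i; cases "\<kappa> (i - 1) x = 0") (auto simp: \<zeta>)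
    show "(\<Sum>i<n. \<zeta> i x) \<le> 1" for n x
      using sum[where n = "n - 1" and x = x] \<kappa>(3) by (cases n) auto
    show "x \<in> inset \<Omega> (1 / (real i + 2))" if "\<zeta> i x \<noteq> 0" for i x
    proof (rule ccontr)
      assume *: "x \<notin> inset \<Omega> (1 / (real i + 2))"
      then have "\<kappa> i x = 0" by (rule \<kappa>(5))
      moreover have "\<kappa> k x = 0" if "i = Suc k" for k
        using next1[of k x] \<open>\<kappa> i x = 0\<close> that by auto
      ultimately show False using \<open>\<zeta> i x \<noteq> 0\<close> by (cases i) (auto simp: \<zeta>)
    qed
    show "\<zeta> i x = 0" if "i > 0" "x \<in> inset \<Omega> (1 / real i)" for i x
    proof -
      define k where "k = i - 1"
      then have k: "i = Suc k" using that(1) by simp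
      then have "\<kappa> k x = 1" using \<kappa>(4)[of x k] that(2) by (simp add: add.commute)
      then show ?thesis using next1[of k x] by (simp add: k \<zeta>)
    qed
    show "(\<Sum>i<n. \<zeta> i x) = 1" if "n > 0" "x \<in> inset \<Omega> (1 / real n)" for n x
    proof -
      define k where "k = n - 1"
      then have k: "n = Suc k" using that(1) by simp
      then show ?thesis using \<kappa>(4)[of x k] that(2) sum[where n = k and x = x] by (simp add: add.commute)
    qed
  qed
qed

section \<open>The error of a single mollified piece\<close>

lemma integral_mult_bounded_le:
  fixes f g :: "'a::euclidean_space \<Rightarrow> real"
  assumes "integrable M f" "g \<in> borel_measurable M" "\<And>x. \<bar>g x\<bar> \<le> B" "(LINT x|M. \<bar>f x\<bar>) \<le> e" "B \<ge> 0"
  shows "\<bar>LINT x|M. f x * g x\<bar> \<le> B * e"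
proof -
  have int: "integrable M (\<lambda>x. f x * g x)"
    using integrable_bounded_mult[OF assms(1-3)] by (simp add: mult.commute)
  have "norm (LINT x|M. f x * g x) \<le> (LINT x|M. B * \<bar>f x\<bar>)"
  proof (rule Bochner_Integration.integral_norm_bound_integral)
    show "norm (f x * g x) \<le> B * \<bar>f x\<bar>" for x
      using mult_left_mono[OF assms(3)[of x] abs_ge_zero[of "f x"]] by (simp add: abs_mult mult.commute)
  qed (use assms(1) int in auto)
  also have "\<dots> \<le> B * e" using assms(4,5) by (simp add: mult_left_mono)
  finally show ?thesis by simp
qed

lemma smooth_cs_mult_integrable:
  assumes "smooth_cs k" "integrable lborel g"
  shows "integrable lborel (\<lambda>x. k x * g x)"
proof -
  obtain B where "\<And>x. \<bar>k x\<bar> \<le> B" using smooth_cs_bounded[OF assms(1)] by blast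
  then show ?thesis
    using smooth_cs_measurable[OF assms(1)] by (intro integrable_bounded_mult[OF assms(2), of k B]) auto
qed

text \<open>
  \<open>f\<close> is a component of the test field and \<open>a\<close> the corresponding component of the potential. The
  third integral disappears on summation over a partition of unity.
\<close>

lemma mollify_error:
  fixes \<zeta> \<eta> f a p q :: "'a::euclidean_space \<Rightarrow> real" and v :: 'a
  defines "G \<equiv> conv \<eta> f"
    and "I1 \<equiv> \<lambda>x. conv \<eta> (\<lambda>y. \<zeta> y * p y) x * dir_deriv v f x - (a x * f x) * conv \<eta> (\<lambda>y. \<zeta> y * q y) x"
    and "I2 \<equiv> \<lambda>x. p x * dir_deriv v (\<lambda>y. \<zeta> y * conv \<eta> f y) x - (a x * (\<zeta> x * conv \<eta> f x)) * q x"
  assumes \<eta>: "mollifier r \<eta>" and \<zeta>: "smooth_cs \<zeta>" and f: "smooth_cs f" "\<And>x. \<bar>f x\<bar> \<le> 1"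
    and a: "a \<in> borel_measurable borel" "\<And>x. \<bar>a x * f x\<bar> \<le> M" "\<And>x. \<bar>a x * \<zeta> x\<bar> \<le> M"
    and p: "integrable lborel p" and q: "integrable lborel q"
    and e1: "(LINT x|lborel. \<bar>conv \<eta> (\<lambda>y. dir_deriv v \<zeta> y * p y) x - dir_deriv v \<zeta> x * p x\<bar>) \<le> e"
    and e2: "(LINT x|lborel. \<bar>conv \<eta> (\<lambda>y. \<zeta> y * q y) x - \<zeta> x * q x\<bar>) \<le> e"
    and e3: "(LINT x|lborel. \<bar>conv \<eta> (\<lambda>y. a y * \<zeta> y * q y) x - a x * \<zeta> x * q x\<bar>) \<le> e"
  shows "integrable lborel I1"
    and "integrable lborel I2"
    and "integrable lborel (\<lambda>x. dir_deriv v \<zeta> x * p x * f x)"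
    and "\<bar>(LINT x|lborel. I1 x) - (LINT x|lborel. I2 x) + (LINT x|lborel. dir_deriv v \<zeta> x * p x * f x)\<bar>
           \<le> (2 + M) * e"
proof -
  note d = smooth_cs_dir_deriv
  note [measurable] = smooth_cs_measurable[OF \<zeta>] smooth_cs_measurable[OF f(1)] smooth_cs_measurable[OF d[OF \<zeta>]]
    smooth_cs_measurable[OF d[OF f(1)]] mollifier_measurable[OF \<eta>] a(1)
  have [measurable]: "p \<in> borel_measurable borel" "q \<in> borel_measurable borel"
    using p q by (auto dest: borel_measurable_integrable)
  have cont: "continuous_on UNIV (conv \<eta> k)" if "integrable lborel k" for k
    by (intro smooth_on_continuous smooth_on_conv mollifier_smooth_cs[OF \<eta>] that)
  note cs_int = smooth_cs_mult_integrable
  have cs_int': "integrable lborel (\<lambda>x. g x * k x)" if "smooth_cs k" "integrable lborel g" for k g :: "'a \<Rightarrow> real"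
    using cs_int[OF that] by (simp add: mult.commute)
  have conv_bnd: "\<bar>conv \<eta> k x\<bar> \<le> B" if "k \<in> borel_measurable borel" "\<And>x. \<bar>k x\<bar> \<le> B" for k B x
    using conv_mollifier_mono[OF \<eta> that, of x B] conv_mollifier_ge[OF \<eta> that, of x "-B"] that(2)
    by (simp add: abs_le_iff) (metis minus_le_iff)
  have G: "smooth_on UNIV G" unfolding G_def
    by (rule smooth_on_conv[OF mollifier_smooth_cs[OF \<eta>] smooth_cs_integrable[OF f(1)]])
  have [measurable]: "G \<in> borel_measurable borel"
    by (intro borel_measurable_continuous_onI smooth_on_continuous G)
  have G1: "\<bar>G x\<bar> \<le> 1" for x unfolding G_def by (rule conv_bnd) (use f in auto)
  have \<zeta>p: "integrable lborel (\<lambda>y. \<zeta> y * p y)" and \<zeta>q: "integrable lborel (\<lambda>y. \<zeta> y * q y)"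
    and dp: "integrable lborel (\<lambda>y. dir_deriv v \<zeta> y * p y)"
    by (intro cs_int \<zeta> p q d)+
  have aq: "integrable lborel (\<lambda>y. a y * \<zeta> y * q y)"
    by (rule integrable_bounded_mult[OF q]) (use a in auto)
  have c\<zeta>p: "integrable lborel (conv \<eta> (\<lambda>y. \<zeta> y * p y))"
    and c\<zeta>q: "integrable lborel (conv \<eta> (\<lambda>y. \<zeta> y * q y))"
    and cdp: "integrable lborel (conv \<eta> (\<lambda>y. dir_deriv v \<zeta> y * p y))"
    and caq: "integrable lborel (conv \<eta> (\<lambda>y. a y * \<zeta> y * q y))"
    by (intro conv_integrable \<zeta>p \<zeta>q dp aq mollifier_integrable[OF \<eta>])+
  have i1: "integrable lborel (\<lambda>x. conv \<eta> (\<lambda>y. \<zeta> y * p y) x * dir_deriv v f x)"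
    by (intro cs_int' d f c\<zeta>p)
  have i2: "integrable lborel (\<lambda>x. (a x * f x) * conv \<eta> (\<lambda>y. \<zeta> y * q y) x)"
    by (rule integrable_bounded_mult[OF c\<zeta>q]) (use a in auto)
  show "integrable lborel I1" unfolding I1_def by (intro Bochner_Integration.integrable_diff i1 i2)
  obtain B where B: "\<And>x. \<bar>dir_deriv v f x\<bar> \<le> B" using smooth_cs_bounded[OF d[OF f(1)]] by blast
  have dG: "dir_deriv v G = conv \<eta> (dir_deriv v f)"
    unfolding G_def by (rule dir_deriv_conv_right) (use f mollifier_integrable[OF \<eta>] in auto)
  have dGb: "\<bar>dir_deriv v G x\<bar> \<le> B" for x
    unfolding dG by (rule conv_bnd) (use B in auto)
  have [measurable]: "dir_deriv v G \<in> borel_measurable borel"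
    by (intro borel_measurable_continuous_onI smooth_on_continuous smooth_on_dir_deriv G)
  have d\<zeta>G: "dir_deriv v (\<lambda>y. \<zeta> y * G y) x = \<zeta> x * dir_deriv v G x + dir_deriv v \<zeta> x * G x" for x
    by (rule dir_deriv_eq[OF has_derivative_mult[OF smooth_cs_has_derivative[OF \<zeta>] smooth_on_has_derivative[OF G UNIV_I]]])
  have j1: "integrable lborel (\<lambda>x. (\<zeta> x * p x) * dir_deriv v G x)"
    using integrable_bounded_mult[OF \<zeta>p, of "dir_deriv v G" B] dGb by (simp add: mult.commute)
  have j2: "integrable lborel (\<lambda>x. (dir_deriv v \<zeta> x * p x) * G x)"
    using integrable_bounded_mult[OF dp, of G 1] G1 by (simp add: mult.commute)
  have j3: "integrable lborel (\<lambda>x. (a x * \<zeta> x * q x) * G x)"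
    using integrable_bounded_mult[OF aq, of G 1] G1 by (simp add: mult.commute)
  \<comment> \<open>Product rule for \<open>\<zeta> * G\<close>; the middle term is the one that the
    third integral of the statement has to compensate.\<close>
  have I2_eq: "I2 = (\<lambda>x. (\<zeta> x * p x) * dir_deriv v G x + (dir_deriv v \<zeta> x * p x) * G x - (a x * \<zeta> x * q x) * G x)"
    unfolding I2_def G_def[symmetric] unfolding d\<zeta>G by (rule ext) (simp add: algebra_simps)
  show "integrable lborel I2"
    unfolding I2_eq by (intro Bochner_Integration.integrable_diff Bochner_Integration.integrable_add j1 j2 j3)
  show k1: "integrable lborel (\<lambda>x. dir_deriv v \<zeta> x * p x * f x)" by (intro cs_int' dp f)
  have even: "\<eta> (- x) = \<eta> x" for x by (rule mollifier_even[OF \<eta>])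
  have s1: "(LINT x|lborel. conv \<eta> (\<lambda>y. \<zeta> y * p y) x * dir_deriv v f x) = (LINT x|lborel. (\<zeta> x * p x) * dir_deriv v G x)"
    unfolding dG by (rule conv_self_adjoint[OF \<zeta>p mollifier_integrable[OF \<eta>] even, where B = B]) (use B in auto)
  have s2: "(LINT x|lborel. conv \<eta> (\<lambda>y. dir_deriv v \<zeta> y * p y) x * f x) = (LINT x|lborel. (dir_deriv v \<zeta> x * p x) * G x)"
    unfolding G_def by (rule conv_self_adjoint[OF dp mollifier_integrable[OF \<eta>] even, where B = 1]) (use f in auto)
  have s3: "(LINT x|lborel. conv \<eta> (\<lambda>y. a y * \<zeta> y * q y) x * f x) = (LINT x|lborel. (a x * \<zeta> x * q x) * G x)"
    unfolding G_def by (rule conv_self_adjoint[OF aq mollifier_integrable[OF \<eta>] even, where B = 1]) (use f in auto)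
  \<comment> \<open>\<open>E1\<close> and \<open>E3\<close> test a mollification error against
    \<open>f\<close>, at most 1 in absolute value, and \<open>E2\<close> tests one against
    \<open>a x * f x\<close>, at most \<open>M\<close>; hence the factor \<open>2 + M\<close>. The
    difference \<open>E3 - E2\<close> is the commutator of mollification with multiplication by
    \<open>a\<close>, split at the integral of \<open>\<zeta> x * q x * (a x * f x)\<close>.\<close>
  define E1 where "E1 = (LINT x|lborel. (conv \<eta> (\<lambda>y. dir_deriv v \<zeta> y * p y) x - dir_deriv v \<zeta> x * p x) * f x)"
  define E2 where "E2 = (LINT x|lborel. (conv \<eta> (\<lambda>y. \<zeta> y * q y) x - \<zeta> x * q x) * (a x * f x))"
  define E3 where "E3 = (LINT x|lborel. (conv \<eta> (\<lambda>y. a y * \<zeta> y * q y) x - a x * \<zeta> x * q x) * f x)"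
  have E1_eq: "E1 = (LINT x|lborel. (dir_deriv v \<zeta> x * p x) * G x) - (LINT x|lborel. dir_deriv v \<zeta> x * p x * f x)"
    unfolding E1_def s2[symmetric] left_diff_distrib
    by (intro Bochner_Integration.integral_diff cs_int' cdp f dp)
  have l1: "integrable lborel (\<lambda>x. \<zeta> x * q x * (a x * f x))"
    using integrable_bounded_mult[OF \<zeta>q, of "\<lambda>x. a x * f x" M] a by (simp add: mult.commute)
  have l2: "integrable lborel (\<lambda>x. conv \<eta> (\<lambda>y. \<zeta> y * q y) x * (a x * f x))"
    using i2 by (simp add: mult.commute)
  have E2_eq: "E2 = (LINT x|lborel. (a x * f x) * conv \<eta> (\<lambda>y. \<zeta> y * q y) x) - (LINT x|lborel. \<zeta> x * q x * (a x * f x))"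
    unfolding E2_def left_diff_distrib
    by (subst Bochner_Integration.integral_diff[OF l2 l1]) (simp add: mult.commute)
  have E3_eq: "E3 = (LINT x|lborel. (a x * \<zeta> x * q x) * G x) - (LINT x|lborel. \<zeta> x * q x * (a x * f x))"
  proof -
    have "E3 = (LINT x|lborel. (a x * \<zeta> x * q x) * G x) - (LINT x|lborel. (a x * \<zeta> x * q x) * f x)"
      unfolding E3_def s3[symmetric] left_diff_distrib
      by (intro Bochner_Integration.integral_diff cs_int' caq f aq)
    then show ?thesis by (simp add: mult_ac)
  qed
  have "(LINT x|lborel. I1 x) = (LINT x|lborel. (\<zeta> x * p x) * dir_deriv v G x)
      - (LINT x|lborel. (a x * f x) * conv \<eta> (\<lambda>y. \<zeta> y * q y) x)"
    by (simp add: I1_def Bochner_Integration.integral_diff[OF i1 i2] s1)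
  moreover have "(LINT x|lborel. I2 x) = (LINT x|lborel. (\<zeta> x * p x) * dir_deriv v G x)
      + (LINT x|lborel. (dir_deriv v \<zeta> x * p x) * G x) - (LINT x|lborel. (a x * \<zeta> x * q x) * G x)"
    unfolding I2_eq using j1 j2 j3
    by (simp add: Bochner_Integration.integral_diff Bochner_Integration.integral_add)
  ultimately have "(LINT x|lborel. I1 x) - (LINT x|lborel. I2 x) + (LINT x|lborel. dir_deriv v \<zeta> x * p x * f x)
      = - E1 - E2 + E3"
    using E1_eq E2_eq E3_eq by linarith
  moreover have "\<bar>E1\<bar> \<le> 1 * e" unfolding E1_def
    by (rule integral_mult_bounded_le) (use cdp dp f e1 in auto)
  moreover have M: "0 \<le> M" using a(2)[of 0] by (meson abs_ge_zero order_trans)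
  then have "\<bar>E2\<bar> \<le> M * e" unfolding E2_def
    by (intro integral_mult_bounded_le) (use c\<zeta>q \<zeta>q a e2 in auto)
  moreover have "\<bar>E3\<bar> \<le> 1 * e" unfolding E3_def
    by (rule integral_mult_bounded_le) (use caq aq f e3 in auto)
  ultimately show "\<bar>(LINT x|lborel. I1 x) - (LINT x|lborel. I2 x) + (LINT x|lborel. dir_deriv v \<zeta> x * p x * f x)\<bar>
           \<le> (2 + M) * e"
    by (simp add: distrib_right)
qed

section \<open>Test fields and the regularised functions\<close>

lemma dir_deriv_sum:
  assumes "\<And>i. i \<in> I \<Longrightarrow> f i differentiable (at x)"
  shows "dir_deriv v (\<lambda>y. \<Sum>i\<in>I. f i y) x = (\<Sum>i\<in>I. dir_deriv v (f i) x)"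
  by (rule dir_deriv_eq[OF has_derivative_sum]) (use assms has_derivative_dir_deriv in blast)

lemma smooth_cs_differentiable: "smooth_cs f \<Longrightarrow> f differentiable (at x)"
  using smooth_cs_has_derivative differentiableI by blast

lemma divergence_eq_sum_dir_deriv:
  "divergence \<phi> x = (\<Sum>j\<in>UNIV. dir_deriv (axis j 1) (\<lambda>y. \<phi> y $ j) x)"
  by (simp add: divergence_def dir_deriv_def)

lemma test_field_support:
  assumes "open \<Omega>" "\<phi> \<in> test_fields \<Omega>"
  obtains s where "s > 0" "\<And>x. \<phi> x \<noteq> 0 \<Longrightarrow> x \<in> inset \<Omega> s"
proof -
  have "compact (closure (support_on UNIV \<phi>))" "closure (support_on UNIV \<phi>) \<subseteq> \<Omega>"
    using assms(2) by (auto simp: test_fields_def)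
  then obtain s where s: "s > 0" "closure (support_on UNIV \<phi>) \<subseteq> inset \<Omega> s"
    using compact_subset_inset assms(1) by metis
  have "x \<in> inset \<Omega> s" if "\<phi> x \<noteq> 0" for x
  proof -
    have "x \<in> support_on UNIV \<phi>" using that by (simp add: support_on_def)
    then show ?thesis using s(2) closure_subset by blast
  qed
  then show ?thesis using that s(1) by blast
qed

text \<open>\<open>test_fields\<close> asks for smoothness on \<open>\<Omega>\<close>. Any other
  point lies in the complement of the closed support, an open set on which the field is 0.\<close>

lemma test_field_smooth:
  assumes "open \<Omega>" "\<phi> \<in> test_fields \<Omega>"
  shows "smooth_on UNIV \<phi>"
proof (rule smooth_on_local)
  fix x
  let ?K = "closure (support_on UNIV \<phi>)"
  show "\<exists>T. open T \<and> x \<in> T \<and> smooth_on T \<phi>"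
  proof (cases "x \<in> \<Omega>")
    case True
    then show ?thesis using assms by (auto simp: test_fields_def)
  next
    case False
    have "smooth_on (- ?K) \<phi>"
    proof (rule smooth_on_cong[where f = "\<lambda>x. 0"])
      show "0 = \<phi> y" if "y \<in> - ?K" for y
      proof (rule ccontr)
        assume "0 \<noteq> \<phi> y"
        then have "y \<in> support_on UNIV \<phi>" by (simp add: support_on_def)
        then show False using that closure_subset by blast
      qed
    qed (auto intro: smooth_on_const)
    moreover have "x \<in> - ?K" using False assms(2) by (auto simp: test_fields_def)
    ultimately show ?thesis by (intro exI[of _ "- ?K"]) auto
  qed
qed

lemma test_field_component:
  fixes \<phi> :: "real ^ 'n \<Rightarrow> real ^ 'n"
  assumes "open \<Omega>" "\<phi> \<in> test_fields \<Omega>"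
  shows "smooth_cs (\<lambda>x. \<phi> x $ j)"
proof -
  have "compact (closure (support_on UNIV \<phi>))" using assms(2) by (auto simp: test_fields_def)
  then obtain R where R: "\<And>x. x \<in> closure (support_on UNIV \<phi>) \<Longrightarrow> norm x \<le> R"
    using compact_imp_bounded bounded_iff by metis
  have "norm x \<le> R" if "\<phi> x $ j \<noteq> 0" for x
  proof -
    have "x \<in> support_on UNIV \<phi>" using that by (auto simp: support_on_def)
    then show ?thesis using R closure_subset by blast
  qed
  then show ?thesis
    using smooth_on_bounded_linear[OF open_UNIV test_field_smooth[OF assms] bounded_linear_vec_nth, of j]
    by (auto simp: smooth_cs_def)
qed

lemma test_fieldI:
  fixes \<phi> :: "real ^ 'n \<Rightarrow> real ^ 'n"
  assumes "bounded \<Omega>" "s > 0" "\<And>j. smooth_on UNIV (\<lambda>x. \<phi> x $ j)" "\<And>x. \<phi> x \<noteq> 0 \<Longrightarrow> x \<in> inset \<Omega> s"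
  shows "\<phi> \<in> test_fields \<Omega>"
proof -
  have "smooth_on UNIV (\<lambda>x. \<Sum>j\<in>UNIV. (\<phi> x $ j) *\<^sub>R (axis j 1 :: real ^ 'n))"
    by (intro smooth_on_sum smooth_on_bounded_linear[OF _ assms(3)] bounded_linear_scaleR_left open_UNIV)
  moreover have "(\<Sum>j\<in>UNIV. (\<phi> x $ j) *\<^sub>R axis j 1) = \<phi> x" for x
    using basis_expansion[of "\<phi> x"] by (simp add: scalar_mult_eq_scaleR)
  ultimately have "smooth_on UNIV \<phi>" by (simp only:)
  then have "smooth_on \<Omega> \<phi>" by (rule smooth_on_subset) simp
  moreover have sub: "closure (support_on UNIV \<phi>) \<subseteq> inset \<Omega> s"
    by (rule closure_minimal[OF _ closed_inset]) (use assms(4) in \<open>auto simp: support_on_def\<close>)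
  moreover have "compact (closure (support_on UNIV \<phi>))"
    using closed_Int_compact[OF closed_closure compact_inset[OF assms(1,2)], of "support_on UNIV \<phi>"] sub
    by (simp add: Int_absorb2)
  ultimately show ?thesis
    using inset_subset[OF assms(2), of \<Omega>] by (auto simp: test_fields_def)
qed

text \<open>
  \<open>C1\<close> is the supremum of \<open>pairing A (Re u) (Im u)\<close> and \<open>C2\<close> that of \<open>pairing (-A) (Im u) (Re u)\<close>
  over the same set of test fields.
\<close>

definition pairing ::
    "(real ^ 'n \<Rightarrow> real ^ 'n) \<Rightarrow> (real ^ 'n \<Rightarrow> real) \<Rightarrow> (real ^ 'n \<Rightarrow> real) \<Rightarrow> (real ^ 'n \<Rightarrow> real ^ 'n) \<Rightarrow> real" where
  "pairing A p q \<phi> = (LINT x|lborel. p x * divergence \<phi> x - (A x \<bullet> \<phi> x) * q x)"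

lemma test_field_zero_near:
  assumes supp: "\<And>x. \<phi> x \<noteq> 0 \<Longrightarrow> x \<in> inset \<Omega> s" and x: "x \<notin> inset \<Omega> s"
  shows "dir_deriv v (\<lambda>y. \<phi> y $ j) x = 0"
proof (rule dir_deriv_eq_0[of "- inset \<Omega> s"])
  show "\<phi> y $ j = 0" if "y \<in> - inset \<Omega> s" for y
  proof -
    have "\<phi> y = 0" using supp[of y] that by auto
    then show ?thesis by simp
  qed
qed (use x closed_inset in auto)

lemma conv_sum_right:
  fixes g :: "'a::euclidean_space \<Rightarrow> real"
  assumes g: "g \<in> borel_measurable borel" "\<And>x. \<bar>g x\<bar> \<le> B" and f: "\<And>j. j \<in> I \<Longrightarrow> integrable lborel (f j)"
  shows "conv g (\<lambda>y. \<Sum>j\<in>I. c j * f j y) x = (\<Sum>j\<in>I. c j * conv g (f j) x)"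
proof -
  have "integrable lborel (\<lambda>y. c j * (g (x - y) * f j y))" if "j \<in> I" for j
    using conv_integrand[OF f[OF that] g] by simp
  then have "(LINT y|lborel. (\<Sum>j\<in>I. c j * (g (x - y) * f j y))) = (\<Sum>j\<in>I. LINT y|lborel. c j * (g (x - y) * f j y))"
    by (rule Bochner_Integration.integral_sum)
  then show ?thesis by (simp add: conv_def sum_distrib_left mult.left_commute)
qed

section \<open>Regularisation by mollified pieces\<close>

locale partition_mollifiers =
  fixes \<Omega> :: "(real ^ 'n) set" and \<zeta> \<eta> :: "nat \<Rightarrow> real ^ 'n \<Rightarrow> real"
  assumes open_dom: "open \<Omega>" and bounded_dom: "bounded \<Omega>"
    and zeta_smooth: "smooth_cs (\<zeta> i)" and zeta_nonneg: "0 \<le> \<zeta> i x"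
    and zeta_sum_le: "(\<Sum>i<n. \<zeta> i x) \<le> 1"
    and zeta_support: "\<zeta> i x \<noteq> 0 \<Longrightarrow> x \<in> inset \<Omega> (1 / (real i + 2))"
    and zeta_zero: "i > 0 \<Longrightarrow> x \<in> inset \<Omega> (1 / real i) \<Longrightarrow> \<zeta> i x = 0"
    and zeta_sum: "n > 0 \<Longrightarrow> x \<in> inset \<Omega> (1 / real n) \<Longrightarrow> (\<Sum>i<n. \<zeta> i x) = 1"
    and eta: "mollifier (1 / (real i + 1)) (\<eta> i)"
begin

text \<open>The mollifier radius \<open>1 / (real i + 1)\<close> exceeds the depth
  \<open>1 / (real i + 2)\<close> guaranteed on the support of \<open>\<zeta> i\<close>, so a piece
  may spill out of \<open>\<Omega>\<close>. What counts is local finiteness inside: for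
  \<open>i > 0\<close>, \<open>\<zeta> i\<close> vanishes on
  \<open>inset \<Omega> (1 / real i)\<close>, hence the piece vanishes on
  \<open>inset \<Omega> (2 / real i)\<close>.\<close>

definition piece :: "(real ^ 'n \<Rightarrow> real) \<Rightarrow> nat \<Rightarrow> real ^ 'n \<Rightarrow> real" where
  "piece p i = conv (\<eta> i) (\<lambda>y. \<zeta> i y * p y)"

text \<open>The sum is locally finite on \<open>\<Omega>\<close>; elsewhere the series need not converge.\<close>

definition mollify :: "(real ^ 'n \<Rightarrow> real) \<Rightarrow> real ^ 'n \<Rightarrow> real" where
  "mollify p x = (\<Sum>i. piece p i x)"

lemma zeta_le_1: "\<zeta> i x \<le> 1"
proof -
  have "\<zeta> i x \<le> (\<Sum>k<Suc i. \<zeta> k x)" by (simp add: sum_nonneg zeta_nonneg)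
  then show ?thesis using zeta_sum_le[where n = "Suc i" and x = x] by linarith
qed

lemma level_exists:
  assumes "s > 0"
  obtains n :: nat where "n > 0" "2 / real n \<le> s"
proof -
  obtain n :: nat where n: "2 / s < real n" using reals_Archimedean2 by blast
  have "0 < 2 / s" using assms by simp
  then have "n > 0" using n by (cases n) auto
  moreover have "2 / real n \<le> s" using n assms \<open>n > 0\<close> by (simp add: field_simps)
  ultimately show ?thesis by (rule that)
qed

text \<open>Of the depth \<open>2 / real n \<le> s\<close>, one half pays for the mollifier radius,
  which is at most \<open>1 / real n\<close>, and the other half keeps \<open>y\<close> in the
  region where \<open>\<zeta> i\<close> is 0.\<close>

lemma zeta_near_zero:
  assumes n: "n > 0" "2 / real n \<le> s" "n \<le> i" and x: "x \<in> inset \<Omega> s" and y: "\<eta> i (x - y) \<noteq> 0 \<or> \<eta> i (y - x) \<noteq> 0"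
  shows "\<zeta> i y = 0"
proof (rule zeta_zero)
  show "i > 0" using n by simp
  have "norm (x - y) \<le> 1 / (real i + 1)"
    using mollifier_support[OF eta, of i "x - y"] mollifier_support[OF eta, of i "y - x"] y
    by (auto simp: norm_minus_commute)
  also have "\<dots> \<le> 1 / real n" using n by (intro divide_left_mono) auto
  finally have "y \<in> inset \<Omega> (s - 1 / real n)"
    using inset_shift[OF x, of y "1 / real n"] by (simp add: dist_norm)
  moreover have "1 / real i \<le> 1 / real n" using n by (intro divide_left_mono) auto
  then have "1 / real i \<le> s - 1 / real n" using n(2) by simp
  ultimately show "y \<in> inset \<Omega> (1 / real i)" by (rule inset_mono)
qed

lemma piece_zero:
  assumes "n > 0" "2 / real n \<le> s" "n \<le> i" "x \<in> inset \<Omega> s"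
  shows "piece p i x = 0"
proof (rule ccontr)
  assume "piece p i x \<noteq> 0"
  then obtain y where "\<eta> i (x - y) \<noteq> 0" "\<zeta> i y * p y \<noteq> 0"
    unfolding piece_def by (rule conv_nonzero)
  then show False using zeta_near_zero[OF assms, of y] by simp
qed

lemma mollify_eq:
  assumes "n > 0" "2 / real n \<le> s" "x \<in> inset \<Omega> s"
  shows "mollify p x = (\<Sum>i<n. piece p i x)"
  unfolding mollify_def by (rule suminf_finite) (use piece_zero[OF assms(1,2) _ assms(3)] in auto)

lemma piece_smooth: "integrable lborel p \<Longrightarrow> smooth_on UNIV (piece p i)"
  unfolding piece_def
  by (intro smooth_on_conv smooth_cs_mult_integrable zeta_smooth mollifier_smooth_cs[OF eta])

lemma piece_measurable: "integrable lborel p \<Longrightarrow> piece p i \<in> borel_measurable borel"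
  by (intro borel_measurable_continuous_onI smooth_on_continuous piece_smooth)

lemma zeta_integrable: "integrable lborel p \<Longrightarrow> integrable lborel (\<lambda>y. \<zeta> i y * p y)"
  by (intro smooth_cs_mult_integrable zeta_smooth)

lemma piece_integrable: "integrable lborel p \<Longrightarrow> integrable lborel (piece p i)"
  unfolding piece_def by (intro conv_integrable zeta_integrable mollifier_integrable[OF eta])

lemma mollify_measurable: "integrable lborel p \<Longrightarrow> mollify p \<in> borel_measurable borel"
  unfolding mollify_def[abs_def] by (intro borel_measurable_suminf piece_measurable)

lemma inset_exhausts:
  assumes "x \<in> \<Omega>"
  obtains s where "s > 0" "x \<in> inset \<Omega> s"
  using compact_subset_inset[of "{x}" \<Omega>] open_dom assms by auto

text \<open>A ball of radius \<open>s / 2\<close> around a point of \<open>inset \<Omega> s\<close>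
  stays in \<open>inset \<Omega> (s / 2)\<close>, where all but a fixed finite number of pieces
  vanish.\<close>

lemma mollify_smooth:
  assumes p: "integrable lborel p"
  shows "smooth_on \<Omega> (mollify p)"
proof (rule smooth_on_local)
  fix x assume "x \<in> \<Omega>"
  then obtain s where s: "s > 0" "x \<in> inset \<Omega> s" by (rule inset_exhausts)
  obtain n where n: "n > 0" "2 / real n \<le> s / 2" using level_exists[of "s / 2"] s(1) by auto
  have "smooth_on (ball x (s / 2)) (mollify p)"
  proof (rule smooth_on_cong[where f = "\<lambda>y. \<Sum>i<n. piece p i y"])
    show "(\<Sum>i<n. piece p i y) = mollify p y" if "y \<in> ball x (s / 2)" for y
      using mollify_eq[OF n, of y p] inset_shift[OF s(2), of y "s / 2"] that by auto
    show "smooth_on (ball x (s / 2)) (\<lambda>y. \<Sum>i<n. piece p i y)"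
      by (intro smooth_on_sum smooth_on_subset[OF piece_smooth[OF p]]) auto
  qed simp
  then show "\<exists>T. open T \<and> x \<in> T \<and> smooth_on T (mollify p)"
    using s(1) by (intro exI[of _ "ball x (s / 2)"]) auto
qed

text \<open>On \<open>\<Omega>\<close> the \<open>\<zeta> i\<close> sum to 1, so
  \<open>mollify p x - p x\<close> is the sum of the errors of the pieces, and the integrals of
  these add up in \<open>ennreal\<close>. The indicator removes the outside, where the series is
  uncontrolled.\<close>

lemma mollify_L1:
  assumes p: "integrable lborel p" and e: "\<And>i. 0 \<le> e i" "summable e"
    and close: "\<And>i. (LINT x|lborel. \<bar>piece p i x - \<zeta> i x * p x\<bar>) \<le> e i"
  shows "integrable lborel (\<lambda>x. indicator \<Omega> x * mollify p x)"
    and "(LINT x|lborel. indicator \<Omega> x * \<bar>mollify p x - p x\<bar>) \<le> suminf e"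
proof -
  have [measurable]: "\<Omega> \<in> sets borel" using open_dom by simp
  note [measurable] = mollify_measurable[OF p]
  have pm[measurable]: "p \<in> borel_measurable borel" using p by (auto dest: borel_measurable_integrable)
  note [measurable] = piece_measurable[OF p] smooth_cs_measurable[OF zeta_smooth]
  let ?d = "\<lambda>i x. \<bar>piece p i x - \<zeta> i x * p x\<bar>"
  have pointwise: "ennreal (indicator \<Omega> x * \<bar>mollify p x - p x\<bar>) \<le> (\<Sum>i. ennreal (?d i x))" for x
  proof (cases "x \<in> \<Omega>")
    case True
    then obtain s where s: "s > 0" "x \<in> inset \<Omega> s" by (rule inset_exhausts)
    obtain n where n: "n > 0" "2 / real n \<le> s" using level_exists[OF s(1)] by auto
    have "1 / real n \<le> s" using n by (simp add: field_simps)
    then have "(\<Sum>i<n. \<zeta> i x) = 1" using n(1) inset_mono[OF s(2)] by (intro zeta_sum) auto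
    then have "p x = (\<Sum>i<n. \<zeta> i x * p x)" by (simp flip: sum_distrib_right)
    then have "mollify p x - p x = (\<Sum>i<n. piece p i x - \<zeta> i x * p x)"
      by (simp add: mollify_eq[OF n s(2)] sum_subtractf)
    then have "\<bar>mollify p x - p x\<bar> \<le> (\<Sum>i<n. ?d i x)" by (simp add: sum_abs)
    then have "ennreal \<bar>mollify p x - p x\<bar> \<le> (\<Sum>i<n. ennreal (?d i x))"
      by (simp add: sum_ennreal ennreal_leI)
    also have "\<dots> \<le> (\<Sum>i. ennreal (?d i x))" by (rule sum_le_suminf) auto
    finally show ?thesis using True by simp
  qed simp
  have "(\<integral>\<^sup>+x. ennreal (indicator \<Omega> x * \<bar>mollify p x - p x\<bar>) \<partial>lborel)
      \<le> (\<integral>\<^sup>+x. (\<Sum>i. ennreal (?d i x)) \<partial>lborel)"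
    by (intro nn_integral_mono pointwise)
  also have "\<dots> = (\<Sum>i. \<integral>\<^sup>+x. ennreal (?d i x) \<partial>lborel)" by (rule nn_integral_suminf) measurable
  also have "\<dots> \<le> (\<Sum>i. ennreal (e i))"
  proof (intro suminf_le allI)
    fix i
    have "(\<integral>\<^sup>+x. ennreal (?d i x) \<partial>lborel) = ennreal (LINT x|lborel. ?d i x)"
      by (rule nn_integral_eq_integral) (use piece_integrable[OF p] zeta_integrable[OF p] in auto)
    then show "(\<integral>\<^sup>+x. ennreal (?d i x) \<partial>lborel) \<le> ennreal (e i)" by (simp add: ennreal_leI close)
  qed auto
  also have "\<dots> = ennreal (suminf e)" by (rule suminf_ennreal2) (use e in auto)
  finally have le: "(\<integral>\<^sup>+x. ennreal (indicator \<Omega> x * \<bar>mollify p x - p x\<bar>) \<partial>lborel) \<le> ennreal (suminf e)" .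
  have int: "integrable lborel (\<lambda>x. indicator \<Omega> x * (mollify p x - p x))"
    by (rule integrableI_bounded) (use le in \<open>auto simp: abs_mult less_top[symmetric] top_unique\<close>)
  have "integrable lborel (\<lambda>x. indicator \<Omega> x * p x)"
    by (rule integrable_bounded_mult[OF p, of _ 1]) (auto simp: indicator_def)
  from Bochner_Integration.integrable_add[OF int this]
  show "integrable lborel (\<lambda>x. indicator \<Omega> x * mollify p x)" by (simp add: algebra_simps)
  have "integrable lborel (\<lambda>x. indicator \<Omega> x * \<bar>mollify p x - p x\<bar>)"
    using Bochner_Integration.integrable_norm[OF int] by (simp add: abs_mult)
  then have "(\<integral>\<^sup>+x. ennreal (indicator \<Omega> x * \<bar>mollify p x - p x\<bar>) \<partial>lborel)
      = ennreal (LINT x|lborel. indicator \<Omega> x * \<bar>mollify p x - p x\<bar>)"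
    by (intro nn_integral_eq_integral) auto
  then show "(LINT x|lborel. indicator \<Omega> x * \<bar>mollify p x - p x\<bar>) \<le> suminf e"
    using le suminf_nonneg[OF e(2,1)] by (simp add: ennreal_le_iff)
qed

text \<open>Both \<open>\<psi>\<close> and \<open>n\<close> depend on \<open>\<phi>\<close>, but the
  bound is a partial sum of the prescribed errors and so can be made uniform in
  \<open>\<phi>\<close>. The compact support of \<open>\<phi>\<close> is what reduces all series to
  finite sums.\<close>

lemma pairing_mollify:
  fixes A :: "real ^ 'n \<Rightarrow> real ^ 'n" and p q :: "real ^ 'n \<Rightarrow> real"
    and M :: real
  assumes p: "integrable lborel p" and q: "integrable lborel q"
    and A: "continuous_on UNIV A" and AM: "\<And>x. x \<in> \<Omega> \<Longrightarrow> norm (A x) \<le> M" and M: "M \<ge> 0"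
    and e1: "\<And>i j. (LINT x|lborel. \<bar>conv (\<eta> i) (\<lambda>y. dir_deriv (axis j 1) (\<zeta> i) y * p y) x
              - dir_deriv (axis j 1) (\<zeta> i) x * p x\<bar>) \<le> e i"
    and e2: "\<And>i. (LINT x|lborel. \<bar>conv (\<eta> i) (\<lambda>y. \<zeta> i y * q y) x - \<zeta> i x * q x\<bar>) \<le> e i"
    and e3: "\<And>i j. (LINT x|lborel. \<bar>conv (\<eta> i) (\<lambda>y. A y $ j * \<zeta> i y * q y) x - A x $ j * \<zeta> i x * q x\<bar>) \<le> e i"
    and \<phi>: "\<phi> \<in> test_fields \<Omega>" "\<And>x. norm (\<phi> x) \<le> 1"
  obtains \<psi> n where "\<psi> \<in> test_fields \<Omega>" "\<And>x. norm (\<psi> x) \<le> 1"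
    "\<bar>pairing A (mollify p) (mollify q) \<phi> - pairing A p q \<psi>\<bar>
       \<le> real CARD('n) * (2 + M) * (\<Sum>i<n. e i)"
proof -
  define f where "f = (\<lambda>j x. \<phi> x $ j)"
  have f: "smooth_cs (f j)" for j
    unfolding f_def by (rule test_field_component[OF open_dom \<phi>(1)])
  have f1: "\<bar>f j x\<bar> \<le> 1" for j x
    using component_le_norm_cart[of "\<phi> x" j] \<phi>(2)[of x] by (simp add: f_def)
  obtain s where s: "s > 0" and supp: "\<And>x. \<phi> x \<noteq> 0 \<Longrightarrow> x \<in> inset \<Omega> s"
    using test_field_support[OF open_dom \<phi>(1)] by blast
  obtain n where n: "n > 0" "2 / real n \<le> s" using level_exists[OF s] by blast
  have fzero: "f j x = 0" "dir_deriv v (f j) x = 0" if "x \<notin> inset \<Omega> s" for j x v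
  proof -
    have "\<phi> x = 0" using that supp by blast
    then show "f j x = 0" by (simp add: f_def)
    show "dir_deriv v (f j) x = 0" using test_field_zero_near[OF supp that] by (simp add: f_def)
  qed
  define G where "G = (\<lambda>i j. conv (\<eta> i) (f j))"
  define \<psi> where "\<psi> x = (\<chi> j. \<Sum>i<n. \<zeta> i x * G i j x)" for x
  have G: "smooth_on UNIV (G i j)" for i j
    unfolding G_def by (rule smooth_on_conv[OF mollifier_smooth_cs[OF eta] smooth_cs_integrable[OF f]])
  have \<zeta>G: "smooth_on UNIV (\<lambda>x. \<zeta> i x * G i j x)" for i j
    by (intro smooth_on_mult smooth_cs_smooth zeta_smooth G open_UNIV)
  have \<psi>_test: "\<psi> \<in> test_fields \<Omega>"
  \<comment> \<open>The indices run below \<open>n\<close>, so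
    \<open>real i + 2 \<le> real n + 1\<close>.\<close>
  proof (rule test_fieldI[OF bounded_dom, of "1 / (real n + 1)"])
    show "smooth_on UNIV (\<lambda>x. \<psi> x $ j)" for j
      unfolding \<psi>_def vec_lambda_beta by (intro smooth_on_sum \<zeta>G open_UNIV)
    show "x \<in> inset \<Omega> (1 / (real n + 1))" if "\<psi> x \<noteq> 0" for x
    proof -
      obtain i where i: "i < n" "\<zeta> i x \<noteq> 0"
      proof (rule ccontr)
        assume "\<not> thesis"
        then have "\<zeta> i x = 0" if "i < n" for i using that \<open>\<And>i. i < n \<Longrightarrow> \<zeta> i x \<noteq> 0 \<Longrightarrow> thesis\<close> by blast
        then have "\<psi> x = 0" by (simp add: \<psi>_def vec_eq_iff)
        then show False using \<open>\<psi> x \<noteq> 0\<close> by simp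
      qed
      have "1 / (real n + 1) \<le> 1 / (real i + 2)" using i(1) by (intro divide_left_mono) auto
      then show ?thesis using inset_mono[OF zeta_support[OF i(2)]] by blast
    qed
  qed simp
  have \<psi>_le: "norm (\<psi> x) \<le> 1" for x
  proof -
    \<comment> \<open>Testing against \<open>w = \<psi> x\<close> itself: every average of
      \<open>w \<bullet> \<phi> y\<close> is at most \<open>norm w\<close>, and the weights
      \<open>\<zeta> i x\<close> sum to at most 1, so \<open>w \<bullet> w \<le> norm w\<close>.
      Estimating the components separately would lose a dimensional factor.\<close>
    define w where "w = \<psi> x"
    have inner_le: "\<bar>w \<bullet> \<phi> y\<bar> \<le> norm w" for y
      using Cauchy_Schwarz_ineq2[of w "\<phi> y"] mult_left_mono[OF \<phi>(2)[of y] norm_ge_zero[of w]] by simp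
    have "(\<Sum>j\<in>UNIV. w $ j * G i j x) \<le> norm w" for i
    proof -
      obtain B where B: "\<And>x. \<bar>\<eta> i x\<bar> \<le> B" using smooth_cs_bounded[OF mollifier_smooth_cs[OF eta]] by metis
      have "(\<Sum>j\<in>UNIV. w $ j * G i j x) = conv (\<eta> i) (\<lambda>y. \<Sum>j\<in>UNIV. w $ j * f j y) x"
        unfolding G_def
        by (rule conv_sum_right[symmetric, OF mollifier_measurable[OF eta] B smooth_cs_integrable[OF f]])
      also have "(\<lambda>y. \<Sum>j\<in>UNIV. w $ j * f j y) = (\<lambda>y. w \<bullet> \<phi> y)"
        by (simp add: f_def inner_vec_def)
      also have "conv (\<eta> i) (\<lambda>y. w \<bullet> \<phi> y) x \<le> norm w"
      proof (rule conv_mollifier_mono[OF eta, of _ "norm w"])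
        show "(\<lambda>y. w \<bullet> \<phi> y) \<in> borel_measurable borel"
          by (intro borel_measurable_continuous_onI continuous_on_inner continuous_on_const
              smooth_on_continuous test_field_smooth[OF open_dom \<phi>(1)])
        show "w \<bullet> \<phi> y \<le> norm w" for y using inner_le[of y] by simp
      qed (rule inner_le)
      finally show ?thesis .
    qed
    then have "(\<Sum>i<n. \<zeta> i x * (\<Sum>j\<in>UNIV. w $ j * G i j x)) \<le> (\<Sum>i<n. \<zeta> i x * norm w)"
      by (intro sum_mono mult_left_mono zeta_nonneg)
    also have "\<dots> \<le> 1 * norm w"
      unfolding sum_distrib_right[symmetric] by (intro mult_right_mono zeta_sum_le) simp
    also have "(\<Sum>i<n. \<zeta> i x * (\<Sum>j\<in>UNIV. w $ j * G i j x)) = w \<bullet> \<psi> x"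
      unfolding \<psi>_def inner_vec_def vec_lambda_beta sum_distrib_left
      by (subst sum.swap) (simp add: sum_distrib_left mult_ac)
    finally have "norm w * norm w \<le> 1 * norm w" by (simp add: w_def norm_eq_sqrt_inner)
    then show ?thesis unfolding w_def[symmetric]
      by (metis mult_right_le_imp_le norm_ge_zero order_le_less zero_le_one)
  qed
  define I1 where "I1 = (\<lambda>i j x. piece p i x * dir_deriv (axis j 1) (f j) x - (A x $ j * f j x) * piece q i x)"
  define I2 where "I2 = (\<lambda>i j x. p x * dir_deriv (axis j 1) (\<lambda>y. \<zeta> i y * G i j y) x - (A x $ j * (\<zeta> i x * G i j x)) * q x)"
  define I3 where "I3 = (\<lambda>i j x. dir_deriv (axis j 1) (\<zeta> i) x * p x * f j x)"
  have a_meas: "(\<lambda>x. A x $ j) \<in> borel_measurable borel" for j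
    by (intro borel_measurable_continuous_onI continuous_on_component A)
  have aM: "\<bar>A x $ j\<bar> \<le> M" if "x \<in> \<Omega>" for x j
    using component_le_norm_cart[of "A x" j] AM[OF that] by linarith
  have af: "\<bar>A x $ j * f j x\<bar> \<le> M" for x j
  proof (cases "x \<in> inset \<Omega> s")
    case True
    then have "x \<in> \<Omega>" using inset_subset[OF s] by blast
    from mult_mono[OF aM[OF this, of j] f1[of j x] M abs_ge_zero] show ?thesis by (simp add: abs_mult)
  qed (simp add: fzero M)
  have a\<zeta>: "\<bar>A x $ j * \<zeta> i x\<bar> \<le> M" for x i j
  proof (cases "\<zeta> i x = 0")
    case False
    then have "x \<in> \<Omega>" using zeta_support[OF False] inset_subset[of "1 / (real i + 2)" \<Omega>] by auto
    from mult_mono[OF aM[OF this, of j] zeta_le_1[of i x] M zeta_nonneg] show ?thesis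
      by (simp add: abs_mult zeta_nonneg)
  qed (simp add: M)
  note err = mollify_error[OF eta zeta_smooth f f1 a_meas af a\<zeta> p q e1 e2 e3]
  have I1: "integrable lborel (I1 i j)" for i j
    unfolding I1_def piece_def using err(1) by blast
  have I2: "integrable lborel (I2 i j)" for i j
    unfolding I2_def G_def using err(2) by blast
  have I3: "integrable lborel (I3 i j)" for i j
    unfolding I3_def using err(3) by blast
  have E: "\<bar>(LINT x|lborel. I1 i j x) - (LINT x|lborel. I2 i j x) + (LINT x|lborel. I3 i j x)\<bar> \<le> (2 + M) * e i" for i j
    unfolding I1_def I2_def I3_def piece_def G_def using err(4) by blast
  have div\<phi>: "divergence \<phi> x = (\<Sum>j\<in>UNIV. dir_deriv (axis j 1) (f j) x)" for x
    by (simp add: divergence_eq_sum_dir_deriv f_def)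
  have A\<phi>: "A x \<bullet> \<phi> x = (\<Sum>j\<in>UNIV. A x $ j * f j x)" for x
    by (simp add: inner_vec_def f_def)
  \<comment> \<open>On \<open>inset \<Omega> s\<close> the first \<open>n\<close> pieces make up the
    whole series. Elsewhere \<open>\<phi>\<close> and its derivatives vanish, so whatever value
    \<open>mollify\<close> takes there is multiplied by 0.\<close>
  have "mollify p x * divergence \<phi> x - (A x \<bullet> \<phi> x) * mollify q x = (\<Sum>j\<in>UNIV. \<Sum>i<n. I1 i j x)" for x
  proof (cases "x \<in> inset \<Omega> s")
    case True
    have "(\<Sum>j\<in>UNIV. \<Sum>i<n. I1 i j x) = (\<Sum>j\<in>UNIV. (\<Sum>i<n. piece p i x) * dir_deriv (axis j 1) (f j) x
        - (A x $ j * f j x) * (\<Sum>i<n. piece q i x))"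
      by (simp add: I1_def sum_subtractf sum_distrib_left sum_distrib_right)
    also have "\<dots> = (\<Sum>i<n. piece p i x) * divergence \<phi> x - (A x \<bullet> \<phi> x) * (\<Sum>i<n. piece q i x)"
      unfolding div\<phi> A\<phi> sum_subtractf by (simp add: sum_distrib_left[symmetric] sum_distrib_right[symmetric])
    finally show ?thesis by (simp add: mollify_eq[OF n True])
  next
    case False
    then show ?thesis by (simp add: div\<phi> A\<phi> I1_def fzero)
  qed
  then have P1: "pairing A (mollify p) (mollify q) \<phi> = (\<Sum>j\<in>UNIV. \<Sum>i<n. LINT x|lborel. I1 i j x)"
    unfolding pairing_def by (simp add: Bochner_Integration.integral_sum I1)
  have div\<psi>: "divergence \<psi> x = (\<Sum>j\<in>UNIV. \<Sum>i<n. dir_deriv (axis j 1) (\<lambda>y. \<zeta> i y * G i j y) x)" for x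
    unfolding divergence_eq_sum_dir_deriv \<psi>_def vec_lambda_beta
    by (intro sum.cong refl dir_deriv_sum smooth_on_differentiable[OF \<zeta>G UNIV_I])
  have "p x * divergence \<psi> x - (A x \<bullet> \<psi> x) * q x = (\<Sum>j\<in>UNIV. \<Sum>i<n. I2 i j x)" for x
    unfolding div\<psi> I2_def sum_subtractf inner_vec_def \<psi>_def vec_lambda_beta inner_real_def
    by (simp add: sum_distrib_left sum_distrib_right)
  then have P2: "pairing A p q \<psi> = (\<Sum>j\<in>UNIV. \<Sum>i<n. LINT x|lborel. I2 i j x)"
    unfolding pairing_def by (simp add: Bochner_Integration.integral_sum I2)
  \<comment> \<open>On the support of \<open>\<phi>\<close> the \<open>\<zeta> i\<close> sum to 1 in
    a whole neighbourhood, thanks to the strict inequality \<open>1 / real n < s\<close>, so the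
    derivative of the sum is 0.\<close>
  have "(\<Sum>i<n. I3 i j x) = 0" for j x
  proof (cases "x \<in> inset \<Omega> s")
    case True
    have "1 / real n < 2 / real n" using n(1) by (simp add: divide_strict_right_mono)
    then have n': "1 / real n < s" using n(2) by linarith
    have "(\<Sum>i<n. dir_deriv (axis j 1) (\<zeta> i) x) = dir_deriv (axis j 1) (\<lambda>y. \<Sum>i<n. \<zeta> i y) x"
      by (intro dir_deriv_sum[symmetric] smooth_cs_differentiable zeta_smooth)
    also have "\<dots> = 0"
    proof (rule dir_deriv_eq_0[of "ball x (s - 1 / real n)"])
      show "(\<Sum>i<n. \<zeta> i y) = 1" if "y \<in> ball x (s - 1 / real n)" for y
        using inset_shift[OF True, of y "s - 1 / real n"] that n(1) by (intro zeta_sum) auto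
    qed (use n' in auto)
    finally show ?thesis
      by (simp add: I3_def mult.assoc sum_distrib_right[symmetric])
  qed (simp add: I3_def fzero)
  then have "(\<Sum>i<n. LINT x|lborel. I3 i j x) = 0" for j
    by (simp add: Bochner_Integration.integral_sum[symmetric] I3)
  then have "pairing A (mollify p) (mollify q) \<phi> - pairing A p q \<psi> = (\<Sum>j\<in>UNIV. \<Sum>i<n.
      (LINT x|lborel. I1 i j x) - (LINT x|lborel. I2 i j x) + (LINT x|lborel. I3 i j x))"
    unfolding P1 P2 by (simp add: sum.distrib sum_subtractf)
  also have "\<bar>\<dots>\<bar> \<le> (\<Sum>j\<in>(UNIV::'n set). \<Sum>i<n. (2 + M) * e i)"
    by (intro order_trans[OF sum_abs] sum_mono order_trans[OF sum_abs] E)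
  also have "\<dots> = real CARD('n) * (2 + M) * (\<Sum>i<n. e i)"
    by (simp add: sum_distrib_left mult.assoc)
  finally have "\<bar>pairing A (mollify p) (mollify q) \<phi> - pairing A p q \<psi>\<bar> \<le> real CARD('n) * (2 + M) * (\<Sum>i<n. e i)" .
  then show ?thesis using that \<psi>_test \<psi>_le by blast
qed

end

section \<open>Approximation\<close>

lemma locally_lipschitz_continuous:
  assumes "locally_lipschitz f"
  shows "continuous_on UNIV f"
proof (rule continuous_at_imp_continuous_on, rule ballI)
  fix x
  obtain r L where "r > 0" "L-lipschitz_on (ball x r) f"
    using assms unfolding locally_lipschitz_def by blast
  then have "continuous_on (ball x r) f" "x \<in> ball x r"
    using lipschitz_on_continuous_on by auto
  then show "isCont f x"
    using continuous_on_eq_continuous_at[OF open_ball] by blast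
qed

lemma pairing_approximation:
  fixes A :: "real ^ 'n \<Rightarrow> real ^ 'n" and p q :: "real ^ 'n \<Rightarrow> real"
  assumes \<Omega>: "open \<Omega>" "bounded \<Omega>" and A: "continuous_on UNIV A"
    and p: "integrable lborel p" and q: "integrable lborel q" and \<epsilon>: "\<epsilon> > 0"
  defines "T \<equiv> {\<phi> \<in> test_fields \<Omega>. \<forall>x. norm (\<phi> x) \<le> 1}"
  shows "\<exists>P Q. smooth_on \<Omega> P \<and> smooth_on \<Omega> Q \<and>
    integrable lborel (\<lambda>x. indicator \<Omega> x * P x) \<and> integrable lborel (\<lambda>x. indicator \<Omega> x * Q x) \<and>
    (LINT x|lborel. indicator \<Omega> x * \<bar>P x - p x\<bar>) \<le> \<epsilon> \<and> (LINT x|lborel. indicator \<Omega> x * \<bar>Q x - q x\<bar>) \<le> \<epsilon> \<and>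
    (\<forall>\<phi>\<in>T. \<exists>\<psi>\<in>T. pairing A P Q \<phi> \<le> pairing A p q \<psi> + \<epsilon>) \<and>
    (\<forall>\<phi>\<in>T. \<exists>\<psi>\<in>T. pairing (\<lambda>x. - A x) Q P \<phi> \<le> pairing (\<lambda>x. - A x) q p \<psi> + \<epsilon>)"
proof -
  have "bounded (A ` closure \<Omega>)"
    using \<Omega>(2) by (intro compact_imp_bounded compact_continuous_image continuous_on_subset[OF A]) auto
  then obtain M0 where M0: "\<And>x. x \<in> closure \<Omega> \<Longrightarrow> norm (A x) \<le> M0" unfolding bounded_iff by blast
  define M where "M = max M0 0"
  have M: "M \<ge> 0" "\<And>x. x \<in> \<Omega> \<Longrightarrow> norm (A x) \<le> M"
    using M0 closure_subset by (fastforce simp: M_def)+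
  \<comment> \<open>The added 1 makes \<open>C \<ge> 1\<close>, so that the total
    \<open>\<epsilon> / C\<close> of the geometric errors \<open>e i\<close> bounds both the
    distance in the mean and, after multiplication by the factor of \<open>pairing_mollify\<close>,
    the error of the pairings.\<close>
  define C where "C = real CARD('n) * (2 + M) + 1"
  have C: "C \<ge> 1" "real CARD('n) * (2 + M) \<le> C" using M(1) by (auto simp: C_def)
  define e where "e i = \<epsilon> / C * (1 / 2) ^ Suc i" for i
  have e_pos: "e i > 0" for i using \<epsilon> C by (simp add: e_def)
  have e_sums: "e sums (\<epsilon> / C)"
    using sums_mult[OF power_half_series, of "\<epsilon> / C"] by (simp add: e_def[abs_def])
  have e_sum: "summable e" "suminf e = \<epsilon> / C" using e_sums by (auto simp: sums_iff)
  have "\<epsilon> / C \<le> \<epsilon>" using \<epsilon> C by (simp add: field_simps)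
  have e_partial: "real CARD('n) * (2 + M) * (\<Sum>i<n. e i) \<le> \<epsilon>" for n
  proof -
    have "(\<Sum>i<n. e i) \<le> \<epsilon> / C"
      using sum_le_suminf[OF e_sum(1), of "{..<n}"] e_pos e_sum(2) by (simp add: less_imp_le)
    then have "real CARD('n) * (2 + M) * (\<Sum>i<n. e i) \<le> C * (\<epsilon> / C)"
      using C sum_nonneg[of "{..<n}" e] e_pos by (intro mult_mono) (auto simp: less_imp_le)
    then show ?thesis using C by simp
  qed
  obtain \<zeta> :: "nat \<Rightarrow> real ^ 'n \<Rightarrow> real" where \<zeta>:
    "\<And>i. smooth_cs (\<zeta> i)" "\<And>i x. 0 \<le> \<zeta> i x" "\<And>n x. (\<Sum>i<n. \<zeta> i x) \<le> 1"
    "\<And>i x. \<zeta> i x \<noteq> 0 \<Longrightarrow> x \<in> inset \<Omega> (1 / (real i + 2))"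
    "\<And>i x. i > 0 \<Longrightarrow> x \<in> inset \<Omega> (1 / real i) \<Longrightarrow> \<zeta> i x = 0"
    "\<And>n x. n > 0 \<Longrightarrow> x \<in> inset \<Omega> (1 / real n) \<Longrightarrow> (\<Sum>i<n. \<zeta> i x) = 1"
    by (rule smooth_partition[OF \<Omega>(2)]) (rule that)
  define B where "B i k = (\<lambda>j y. dir_deriv (axis j 1) (\<zeta> i) y * k y)" for i and k :: "real ^ 'n \<Rightarrow> real"
  define D where "D i k A' = (\<lambda>j y. A' y $ j * \<zeta> i y * k y)" for i and k :: "real ^ 'n \<Rightarrow> real" and A' :: "real ^ 'n \<Rightarrow> real ^ 'n"
  \<comment> \<open>All functions that the mollifier of index \<open>i\<close> has to reproduce
    within \<open>e i\<close>: the pieces of unity times \<open>p\<close> and \<open>q\<close>, the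
    terms with a derivative of \<open>\<zeta> i\<close>, and the products with the potential, for
    \<open>C1\<close> and \<open>C2\<close> together.\<close>
  define F where "F i = {\<lambda>y. \<zeta> i y * p y, \<lambda>y. \<zeta> i y * q y} \<union> range (B i p) \<union> range (B i q)
      \<union> range (D i q A) \<union> range (D i p (\<lambda>x. - A x))" for i
  have A_int: "integrable lborel (D i k A' j)"
    if k: "integrable lborel k" and A': "continuous_on UNIV A'" "\<And>x. x \<in> \<Omega> \<Longrightarrow> norm (A' x) \<le> M"
    for i j k and A' :: "real ^ 'n \<Rightarrow> real ^ 'n"
  proof -
    have meas: "(\<lambda>y. A' y $ j) \<in> borel_measurable borel"
      by (intro borel_measurable_continuous_onI continuous_on_component A')
    have bnd: "\<bar>A' x $ j * \<zeta> i x\<bar> \<le> M" for x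
    proof (cases "\<zeta> i x = 0")
      case False
      then have "x \<in> \<Omega>" using \<zeta>(4)[OF False] inset_subset[of "1 / (real i + 2)" \<Omega>] by auto
      then have "\<bar>A' x $ j\<bar> \<le> M" using component_le_norm_cart[of "A' x" j] A'(2)[of x] by linarith
      moreover have "\<zeta> i x \<le> (\<Sum>k<Suc i. \<zeta> k x)" by (simp add: sum_nonneg \<zeta>(2))
      then have "\<zeta> i x \<le> 1" using \<zeta>(3)[of x "Suc i"] by linarith
      ultimately have "\<bar>A' x $ j\<bar> * \<zeta> i x \<le> M * 1" using \<zeta>(2) M(1) by (intro mult_mono) auto
      then show ?thesis using \<zeta>(2) by (simp add: abs_mult)
    qed (simp add: M)
    show ?thesis unfolding D_def
      by (rule integrable_bounded_mult[OF k, of _ M]) (use meas smooth_cs_measurable[OF \<zeta>(1)] bnd in auto)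
  qed
  have nA: "continuous_on UNIV (\<lambda>x. - A x)" "\<And>x. x \<in> \<Omega> \<Longrightarrow> norm (- A x) \<le> M"
    using A M(2) by (auto intro: continuous_on_minus)
  have F_int: "integrable lborel k" if "k \<in> F i" for k i
    using that unfolding F_def B_def
    by (auto intro: A_int[OF q A M(2)] A_int[OF p nA] smooth_cs_mult_integrable smooth_cs_dir_deriv \<zeta>(1) p q)
  have F_fin: "finite (F i)" for i by (simp add: F_def)
  have "\<exists>\<eta>. mollifier (1 / (real i + 1)) \<eta> \<and> (\<forall>k\<in>F i. (LINT x|lborel. \<bar>conv \<eta> k x - k x\<bar>) \<le> e i)" for i
  proof -
    have "1 / (real i + 1) > 0" by simp
    then obtain \<eta> where "mollifier (1 / (real i + 1)) \<eta>" "\<And>k. k \<in> F i \<Longrightarrow> (LINT x|lborel. \<bar>conv \<eta> k x - k x\<bar>) \<le> e i"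
      using mollifier_approx[OF F_fin[of i] F_int[of _ i] e_pos[of i]] by blast
    then show ?thesis by blast
  qed
  then obtain \<eta> where \<eta>: "\<And>i. mollifier (1 / (real i + 1)) (\<eta> i)"
    "\<And>i k. k \<in> F i \<Longrightarrow> (LINT x|lborel. \<bar>conv (\<eta> i) k x - k x\<bar>) \<le> e i" by metis
  have pm: "partition_mollifiers \<Omega> \<zeta> \<eta>"
    using \<Omega> \<zeta> \<eta>(1) by unfold_locales
  define mollify where "mollify = partition_mollifiers.mollify \<zeta> \<eta>"
  note mollify_L1 = partition_mollifiers.mollify_L1[OF pm, folded mollify_def, unfolded partition_mollifiers.piece_def[OF pm]]
  note mollify_smooth = partition_mollifiers.mollify_smooth[OF pm, folded mollify_def]
  note pairing_mollify = partition_mollifiers.pairing_mollify[OF pm, folded mollify_def]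
  have F_mem: "(\<lambda>y. \<zeta> i y * p y) \<in> F i" "(\<lambda>y. \<zeta> i y * q y) \<in> F i" "B i p j \<in> F i" "B i q j \<in> F i"
    "D i q A j \<in> F i" "D i p (\<lambda>x. - A x) j \<in> F i" for i j
    by (auto simp: F_def)
  note E = \<eta>(2)[OF F_mem(1)] \<eta>(2)[OF F_mem(2)] \<eta>(2)[OF F_mem(3), unfolded B_def] \<eta>(2)[OF F_mem(4), unfolded B_def]
    \<eta>(2)[OF F_mem(5), unfolded D_def] \<eta>(2)[OF F_mem(6), unfolded D_def]
  have L1p: "integrable lborel (\<lambda>x. indicator \<Omega> x * mollify p x)"
      "(LINT x|lborel. indicator \<Omega> x * \<bar>mollify p x - p x\<bar>) \<le> suminf e"
    using mollify_L1[OF p _ e_sum(1) E(1)] e_pos by (auto simp: less_imp_le)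
  have L1q: "integrable lborel (\<lambda>x. indicator \<Omega> x * mollify q x)"
      "(LINT x|lborel. indicator \<Omega> x * \<bar>mollify q x - q x\<bar>) \<le> suminf e"
    using mollify_L1[OF q _ e_sum(1) E(2)] e_pos by (auto simp: less_imp_le)
  have J1: "\<exists>\<psi>\<in>T. pairing A (mollify p) (mollify q) \<phi> \<le> pairing A p q \<psi> + \<epsilon>" if "\<phi> \<in> T" for \<phi>
  proof -
    have \<phi>: "\<phi> \<in> test_fields \<Omega>" "\<And>x. norm (\<phi> x) \<le> 1" using that by (auto simp: T_def)
    obtain \<psi> n where \<psi>: "\<psi> \<in> test_fields \<Omega>" "\<And>x. norm (\<psi> x) \<le> 1"
      "\<bar>pairing A (mollify p) (mollify q) \<phi> - pairing A p q \<psi>\<bar> \<le> real CARD('n) * (2 + M) * (\<Sum>i<n. e i)"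
      using pairing_mollify[OF p q A M(2,1) E(3) E(2) E(5) \<phi>] by blast
    have "pairing A (mollify p) (mollify q) \<phi> \<le> pairing A p q \<psi> + \<epsilon>" using \<psi>(3) e_partial[of n] by linarith
    then show ?thesis using \<psi>(1,2) by (auto simp: T_def)
  qed
  have J2: "\<exists>\<psi>\<in>T. pairing (\<lambda>x. - A x) (mollify q) (mollify p) \<phi> \<le> pairing (\<lambda>x. - A x) q p \<psi> + \<epsilon>" if "\<phi> \<in> T" for \<phi>
  proof -
    have \<phi>: "\<phi> \<in> test_fields \<Omega>" "\<And>x. norm (\<phi> x) \<le> 1" using that by (auto simp: T_def)
    obtain \<psi> n where \<psi>: "\<psi> \<in> test_fields \<Omega>" "\<And>x. norm (\<psi> x) \<le> 1"
      "\<bar>pairing (\<lambda>x. - A x) (mollify q) (mollify p) \<phi> - pairing (\<lambda>x. - A x) q p \<psi>\<bar> \<le> real CARD('n) * (2 + M) * (\<Sum>i<n. e i)"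
      using pairing_mollify[OF q p nA M(1) E(4) E(1) E(6) \<phi>] by blast
    have "pairing (\<lambda>x. - A x) (mollify q) (mollify p) \<phi> \<le> pairing (\<lambda>x. - A x) q p \<psi> + \<epsilon>"
      using \<psi>(3) e_partial[of n] by linarith
    then show ?thesis using \<psi>(1,2) by (auto simp: T_def)
  qed
  show ?thesis
    using mollify_smooth[OF p] mollify_smooth[OF q] L1p L1q J1 J2 \<open>\<epsilon> / C \<le> \<epsilon>\<close> e_sum(2)
    by (intro exI[of _ "mollify p"] exI[of _ "mollify q"]) auto
qed

text \<open>Convergence for each fixed element bounds the suprema from below asymptotically, as for
  lower semicontinuity; the comparison element \<open>\<psi>\<close> bounds them from above by the
  limit plus \<open>\<epsilon> k\<close>.\<close>

lemma SUP_tendsto_of_approx: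
  fixes F :: "nat \<Rightarrow> 'a \<Rightarrow> real"
  assumes "T \<noteq> {}" and upper: "\<And>k \<phi>. \<phi> \<in> T \<Longrightarrow> \<exists>\<psi>\<in>T. F k \<phi> \<le> G \<psi> + \<epsilon> k" and \<epsilon>: "\<epsilon> \<longlonglongrightarrow> 0"
    and lim: "\<And>\<phi>. \<phi> \<in> T \<Longrightarrow> (\<lambda>k. F k \<phi>) \<longlonglongrightarrow> G \<phi>"
  shows "(\<lambda>k. SUP \<phi>\<in>T. ereal (F k \<phi>)) \<longlonglongrightarrow> (SUP \<phi>\<in>T. ereal (G \<phi>))"
proof (rule order_tendstoI)
  fix a assume "a < (SUP \<phi>\<in>T. ereal (G \<phi>))"
  then obtain \<phi> where \<phi>: "\<phi> \<in> T" "a < ereal (G \<phi>)" by (auto simp: less_SUP_iff)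
  have "(\<lambda>k. ereal (F k \<phi>)) \<longlonglongrightarrow> ereal (G \<phi>)" using lim[OF \<phi>(1)] by simp
  then have "eventually (\<lambda>k. a < ereal (F k \<phi>)) sequentially" using \<phi>(2) by (rule order_tendstoD)
  then show "eventually (\<lambda>k. a < (SUP \<phi>\<in>T. ereal (F k \<phi>))) sequentially"
    by eventually_elim (use \<phi>(1) in \<open>auto simp: less_SUP_iff\<close>)
next
  define S where "S = (SUP \<phi>\<in>T. ereal (G \<phi>))"
  fix a assume "(SUP \<phi>\<in>T. ereal (G \<phi>)) < a"
  then have a: "S < a" by (simp add: S_def)
  \<comment> \<open>A supremum below \<open>a\<close> is not \<infinity>, and over a nonempty set it
    is not -\<infinity>, so it is a real \<open>s\<close> and real arithmetic applies.\<close>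
  obtain \<phi> where "\<phi> \<in> T" using assms(1) by blast
  then have "ereal (G \<phi>) \<le> S" unfolding S_def by (rule SUP_upper)
  then obtain s where s: "S = ereal s" using a by (cases S) auto
  have "(\<lambda>k. ereal (s + \<epsilon> k)) \<longlonglongrightarrow> ereal (s + 0)"
    unfolding lim_ereal by (intro tendsto_add tendsto_const \<epsilon>)
  then have "eventually (\<lambda>k. ereal (s + \<epsilon> k) < a) sequentially"
    using a s by (intro order_tendstoD(2)) auto
  moreover have "(SUP \<phi>\<in>T. ereal (F k \<phi>)) \<le> ereal (s + \<epsilon> k)" for k
  proof (rule SUP_least)
    fix \<phi> assume "\<phi> \<in> T"
    then obtain \<psi> where \<psi>: "\<psi> \<in> T" "F k \<phi> \<le> G \<psi> + \<epsilon> k" using upper by blast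
    have "ereal (G \<psi>) \<le> S" unfolding S_def using \<psi>(1) by (rule SUP_upper)
    then show "ereal (F k \<phi>) \<le> ereal (s + \<epsilon> k)" using \<psi>(2) s by simp
  qed
  ultimately show "eventually (\<lambda>k. (SUP \<phi>\<in>T. ereal (F k \<phi>)) < a) sequentially"
    by (auto elim!: eventually_mono intro: le_less_trans)
qed

section \<open>From Lebesgue integrals over the domain to Borel integrals over the space\<close>

lemma integral_lebesgue_on_eq_lborel:
  fixes h H :: "'a::euclidean_space \<Rightarrow> real"
  assumes \<Omega>: "open \<Omega>" and h: "h \<in> borel_measurable (lebesgue_on \<Omega>)" and H: "H \<in> borel_measurable borel"
    and eq: "AE x in lborel. x \<in> \<Omega> \<longrightarrow> h x = H x" and zero: "\<And>x. x \<notin> \<Omega> \<Longrightarrow> H x = 0"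
  shows "(LINT x|lebesgue_on \<Omega>. h x) = (LINT x|lborel. H x)"
proof -
  have \<Omega>': "\<Omega> \<inter> space lebesgue \<in> sets lebesgue"
    using \<Omega> sets_completionI_sets[of \<Omega> lborel] by simp
  have "(LINT x|lebesgue_on \<Omega>. h x) = (LINT x|lebesgue. indicator \<Omega> x *\<^sub>R h x)"
    by (rule integral_restrict_space[OF \<Omega>'])
  also have "\<dots> = (LINT x|lebesgue. H x)"
  proof (rule integral_cong_AE)
    show "(\<lambda>x. indicator \<Omega> x *\<^sub>R h x) \<in> borel_measurable lebesgue"
      using h borel_measurable_restrict_space_iff[OF \<Omega>', of h] by simp
    show "H \<in> borel_measurable lebesgue" using H by (simp add: measurable_completion)
    show "AE x in lebesgue. indicator \<Omega> x *\<^sub>R h x = H x"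
      using AE_completion[OF eq] by eventually_elim (auto simp: zero indicator_def)
  qed
  also have "\<dots> = (LINT x|lborel. H x)" by (rule integral_completion) (use H in simp)
  finally show ?thesis .
qed

text \<open>Convolution and Fubini are set up over \<open>lborel\<close>. Extended by zero, a
  Lebesgue integrable function agrees almost everywhere with a Borel one.\<close>

lemma L1_borel_version:
  fixes f :: "'a::euclidean_space \<Rightarrow> real"
  assumes \<Omega>: "open \<Omega>" and f: "integrable (lebesgue_on \<Omega>) f"
  obtains p where "integrable lborel p" "AE x in lborel. x \<in> \<Omega> \<longrightarrow> f x = p x"
proof -
  have \<Omega>': "\<Omega> \<inter> space lebesgue \<in> sets lebesgue"
    using \<Omega> sets_completionI_sets[of \<Omega> lborel] by simp
  let ?f = "\<lambda>x. indicator \<Omega> x *\<^sub>R f x"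
  have f': "integrable lebesgue ?f" using f integrable_restrict_space[OF \<Omega>', of f] by simp
  then obtain p where p: "p \<in> borel_measurable lborel" "AE x in lborel. ?f x = p x"
    using completion_ex_borel_measurable_real[OF borel_measurable_integrable] by blast
  have "integrable lebesgue p"
    by (rule integrable_cong_AE_imp[OF f'])
       (use p AE_completion[OF p(2)] in \<open>auto simp: measurable_completion eq_commute\<close>)
  then have "integrable lborel p" using integrable_completion[OF p(1)] by simp
  moreover have "AE x in lborel. x \<in> \<Omega> \<longrightarrow> f x = p x"
    using p(2) by eventually_elim auto
  ultimately show ?thesis by (rule that)
qed

lemma test_field_continuous: "open \<Omega> \<Longrightarrow> \<phi> \<in> test_fields \<Omega> \<Longrightarrow> continuous_on UNIV \<phi>"
  by (intro smooth_on_continuous test_field_smooth)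

lemma test_field_zero:
  assumes "open \<Omega>" "\<phi> \<in> test_fields \<Omega>" "x \<notin> \<Omega>"
  shows "\<phi> x = 0" "divergence \<phi> x = 0"
proof -
  obtain s where s: "s > 0" "\<And>x. \<phi> x \<noteq> 0 \<Longrightarrow> x \<in> inset \<Omega> s"
    using test_field_support[OF assms(1,2)] by blast
  have x: "x \<notin> inset \<Omega> s" using inset_subset[OF s(1)] assms(3) by blast
  then show "\<phi> x = 0" using s(2) by blast
  show "divergence \<phi> x = 0"
    unfolding divergence_eq_sum_dir_deriv
    by (rule sum.neutral) (use test_field_zero_near[of \<phi>, OF s(2) x] in blast)
qed

lemma divergence_measurable:
  "open \<Omega> \<Longrightarrow> \<phi> \<in> test_fields \<Omega> \<Longrightarrow> divergence \<phi> \<in> borel_measurable borel"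
  unfolding divergence_eq_sum_dir_deriv[abs_def]
  by (intro borel_measurable_sum smooth_cs_measurable smooth_cs_dir_deriv test_field_component)

lemma divergence_bounded:
  assumes "open \<Omega>" "\<phi> \<in> test_fields \<Omega>"
  obtains B where "\<And>x. \<bar>divergence \<phi> x\<bar> \<le> B"
proof -
  have "\<forall>j. \<exists>b. \<forall>x. \<bar>dir_deriv (axis j 1) (\<lambda>y. \<phi> y $ j) x\<bar> \<le> b"
    using smooth_cs_bounded[OF smooth_cs_dir_deriv[OF test_field_component[OF assms]]] by metis
  then obtain b where b: "\<And>j x. \<bar>dir_deriv (axis j 1) (\<lambda>y. \<phi> y $ j) x\<bar> \<le> b j" by metis
  have "\<bar>divergence \<phi> x\<bar> \<le> (\<Sum>j\<in>UNIV. b j)" for x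
    unfolding divergence_eq_sum_dir_deriv by (intro order_trans[OF sum_abs] sum_mono b)
  then show ?thesis by (rule that)
qed

text \<open>For a continuous field the part of \<open>\<Omega>\<close> where the norm exceeds 1 is
  open, and an open null set is empty. Outside \<open>\<Omega>\<close> the field is 0.\<close>

lemma Linf_norm_le_1_iff:
  assumes \<Omega>: "open \<Omega>" and \<phi>: "\<phi> \<in> test_fields \<Omega>"
  shows "Linf_norm \<Omega> \<phi> \<le> 1 \<longleftrightarrow> (\<forall>x. norm (\<phi> x) \<le> 1)"
proof
  have cont: "continuous_on UNIV (\<lambda>x. norm (\<phi> x))"
    by (intro continuous_on_norm test_field_continuous[OF assms])
  {
    assume le: "Linf_norm \<Omega> \<phi> \<le> 1"
    have "AE x in lebesgue_on \<Omega>. ereal (norm (\<phi> x)) \<le> 1"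
      by (rule eventually_mono[OF esssup_AE]) (rule order_trans[OF _ le[unfolded Linf_norm_def]])
    then have "AE x in lebesgue. x \<in> \<Omega> \<longrightarrow> norm (\<phi> x) \<le> 1"
      using \<Omega> by (subst (asm) AE_restrict_space_iff) (auto simp: one_ereal_def)
    then have ae: "AE x in lborel. \<not> (x \<in> \<Omega> \<and> norm (\<phi> x) > 1)"
      unfolding AE_completion_iff by eventually_elim auto
    have op: "open {x \<in> \<Omega>. norm (\<phi> x) > 1}"
      using open_Int[OF \<Omega> open_Collect_less[OF continuous_on_const cont, of 1]] by (simp add: Int_def)
    then have "{x \<in> \<Omega>. norm (\<phi> x) > 1} \<in> null_sets lborel"
      using ae by (subst (asm) AE_iff_null) auto
    then have "negligible {x \<in> \<Omega>. norm (\<phi> x) > 1}"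
      using negligible_iff_null_sets null_sets_completionI by blast
    then have "{x \<in> \<Omega>. norm (\<phi> x) > 1} = {}"
      using open_not_negligible[OF op] by blast
    then have "norm (\<phi> x) \<le> 1" if "x \<in> \<Omega>" for x
      using that by (auto simp: not_less)
    then show "\<forall>x. norm (\<phi> x) \<le> 1" using test_field_zero(1)[OF assms] by (metis norm_zero zero_le_one)
  next
    assume "\<forall>x. norm (\<phi> x) \<le> 1"
    moreover have "(\<lambda>x. ereal (norm (\<phi> x))) \<in> borel_measurable (lebesgue_on \<Omega>)"
      by (intro borel_measurable_ereal measurable_restrict_space1 measurable_completion)
         (simp add: borel_measurable_continuous_onI[OF cont])
    ultimately show "Linf_norm \<Omega> \<phi> \<le> 1"
      unfolding Linf_norm_def by (intro esssup_I) (auto simp: one_ereal_def)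
  }
qed

lemma lebesgue_pairing_eq:
  fixes A :: "real ^ 'n \<Rightarrow> real ^ 'n" and f g p q :: "real ^ 'n \<Rightarrow> real"
  assumes \<Omega>: "open \<Omega>" and A: "continuous_on UNIV A" and \<phi>: "\<phi> \<in> test_fields \<Omega>"
    and [measurable]: "f \<in> borel_measurable (lebesgue_on \<Omega>)" "g \<in> borel_measurable (lebesgue_on \<Omega>)"
    and [measurable]: "p \<in> borel_measurable borel" "q \<in> borel_measurable borel"
    and ae: "AE x in lborel. x \<in> \<Omega> \<longrightarrow> f x = p x" "AE x in lborel. x \<in> \<Omega> \<longrightarrow> g x = q x"
  shows "(LINT x|lebesgue_on \<Omega>. f x * divergence \<phi> x - (A x \<bullet> \<phi> x) * g x) = pairing A p q \<phi>"
  unfolding pairing_def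
proof (rule integral_lebesgue_on_eq_lborel[OF \<Omega>])
  have [measurable]: "divergence \<phi> \<in> borel_measurable borel" by (rule divergence_measurable[OF \<Omega> \<phi>])
  have [measurable]: "(\<lambda>x. A x \<bullet> \<phi> x) \<in> borel_measurable borel"
    by (intro borel_measurable_continuous_onI continuous_on_inner A test_field_continuous[OF \<Omega> \<phi>])
  have [measurable]: "k \<in> borel_measurable (lebesgue_on \<Omega>)" if "k \<in> borel_measurable borel" for k :: "real ^ 'n \<Rightarrow> real"
    using that by (intro measurable_restrict_space1 measurable_completion) simp
  show "(\<lambda>x. f x * divergence \<phi> x - (A x \<bullet> \<phi> x) * g x) \<in> borel_measurable (lebesgue_on \<Omega>)" by measurable
  show "(\<lambda>x. p x * divergence \<phi> x - (A x \<bullet> \<phi> x) * q x) \<in> borel_measurable borel" by measurable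
  show "AE x in lborel. x \<in> \<Omega> \<longrightarrow> f x * divergence \<phi> x - (A x \<bullet> \<phi> x) * g x
      = p x * divergence \<phi> x - (A x \<bullet> \<phi> x) * q x"
    using ae by eventually_elim auto
  show "p x * divergence \<phi> x - (A x \<bullet> \<phi> x) * q x = 0" if "x \<notin> \<Omega>" for x
    using test_field_zero[OF \<Omega> \<phi> that] by simp
qed

text \<open>Applied both to \<open>u\<close>, with its Borel representatives, and to the smooth
  approximants, cut off by the indicator of \<open>\<Omega>\<close>. The plus sign in
  \<open>C2\<close> is absorbed by the potential \<open>-A\<close>.\<close>

lemma C1_C2_eq_SUP_pairing:
  fixes A :: "real ^ 'n \<Rightarrow> real ^ 'n" and u :: "real ^ 'n \<Rightarrow> complex"
  assumes \<Omega>: "open \<Omega>" and A: "continuous_on UNIV A" and u: "integrable (lebesgue_on \<Omega>) u"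
    and pq: "p \<in> borel_measurable borel" "q \<in> borel_measurable borel"
    and ae: "AE x in lborel. x \<in> \<Omega> \<longrightarrow> Re (u x) = p x" "AE x in lborel. x \<in> \<Omega> \<longrightarrow> Im (u x) = q x"
  defines "T \<equiv> {\<phi> \<in> test_fields \<Omega>. \<forall>x. norm (\<phi> x) \<le> 1}"
  shows "C1 A \<Omega> u = (SUP \<phi>\<in>T. ereal (pairing A p q \<phi>))"
    and "C2 A \<Omega> u = (SUP \<phi>\<in>T. ereal (pairing (\<lambda>x. - A x) q p \<phi>))"
proof -
  have T: "{\<phi>\<in>test_fields \<Omega>. Linf_norm \<Omega> \<phi> \<le> 1} = T"
    using Linf_norm_le_1_iff[OF \<Omega>] by (auto simp: T_def)
  have m: "(\<lambda>x. Re (u x)) \<in> borel_measurable (lebesgue_on \<Omega>)" "(\<lambda>x. Im (u x)) \<in> borel_measurable (lebesgue_on \<Omega>)"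
    using borel_measurable_integrable[OF u] by auto
  show "C1 A \<Omega> u = (SUP \<phi>\<in>T. ereal (pairing A p q \<phi>))"
    unfolding C1_def T
    by (intro SUP_cong refl arg_cong[of _ _ ereal] lebesgue_pairing_eq[OF \<Omega> A _ m pq ae]) (simp add: T_def)
  have nA: "continuous_on UNIV (\<lambda>x. - A x)" by (intro continuous_on_minus A)
  have "(LINT x|lebesgue_on \<Omega>. Im (u x) * divergence \<phi> x + (A x \<bullet> \<phi> x) * Re (u x)) = pairing (\<lambda>x. - A x) q p \<phi>"
    if "\<phi> \<in> T" for \<phi>
    using lebesgue_pairing_eq[OF \<Omega> nA _ m(2,1) pq(2,1) ae(2,1), of \<phi>] that by (simp add: T_def)
  then show "C2 A \<Omega> u = (SUP \<phi>\<in>T. ereal (pairing (\<lambda>x. - A x) q p \<phi>))"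
    unfolding C2_def T by (intro SUP_cong refl arg_cong[of _ _ ereal])
qed

text \<open>For a fixed field, \<open>divergence \<phi>\<close> and
  \<open>A x \<bullet> \<phi> x\<close> are bounded, so the pairing is continuous under convergence
  in the mean on \<open>\<Omega>\<close>.\<close>

lemma pairing_tendsto:
  fixes A :: "real ^ 'n \<Rightarrow> real ^ 'n"
  assumes \<Omega>: "open \<Omega>" and A: "continuous_on UNIV A" and \<phi>: "\<phi> \<in> test_fields \<Omega>"
    and p: "integrable lborel p" and q: "integrable lborel q"
    and P: "\<And>k. integrable lborel (\<lambda>x. indicator \<Omega> x * P k x)" and Q: "\<And>k. integrable lborel (\<lambda>x. indicator \<Omega> x * Q k x)"
    and limP: "(\<lambda>k. LINT x|lborel. indicator \<Omega> x * \<bar>P k x - p x\<bar>) \<longlonglongrightarrow> 0"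
    and limQ: "(\<lambda>k. LINT x|lborel. indicator \<Omega> x * \<bar>Q k x - q x\<bar>) \<longlonglongrightarrow> 0"
  shows "(\<lambda>k. pairing A (P k) (Q k) \<phi>) \<longlonglongrightarrow> pairing A p q \<phi>"
proof -
  obtain B where B: "\<And>x. \<bar>divergence \<phi> x\<bar> \<le> B" using divergence_bounded[OF \<Omega> \<phi>] by blast
  let ?K = "closure (support_on UNIV \<phi>)"
  have cont: "continuous_on UNIV (\<lambda>x. A x \<bullet> \<phi> x)"
    by (intro continuous_on_inner A test_field_continuous[OF \<Omega> \<phi>])
  have "bounded ((\<lambda>x. A x \<bullet> \<phi> x) ` ?K)"
    using \<phi> by (intro compact_imp_bounded compact_continuous_image continuous_on_subset[OF cont]) (auto simp: test_fields_def)
  then obtain M where M: "\<And>x. x \<in> ?K \<Longrightarrow> \<bar>A x \<bullet> \<phi> x\<bar> \<le> M" unfolding bounded_iff by auto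
  have M': "\<bar>A x \<bullet> \<phi> x\<bar> \<le> max M 0" for x
  proof (cases "\<phi> x = 0")
    case False
    then have "x \<in> support_on UNIV \<phi>" by (simp add: support_on_def)
    then have "x \<in> ?K" using closure_subset by blast
    then show ?thesis using M[of x] by simp
  qed simp
  have dm: "divergence \<phi> \<in> borel_measurable borel" by (rule divergence_measurable[OF \<Omega> \<phi>])
  have am: "(\<lambda>x. A x \<bullet> \<phi> x) \<in> borel_measurable borel" by (rule borel_measurable_continuous_onI[OF cont])
  have ind: "integrable lborel (\<lambda>x. indicator \<Omega> x * k x)" if "integrable lborel k" for k :: "real ^ 'n \<Rightarrow> real"
  proof (rule integrable_bounded_mult[OF that, of _ 1])
    show "indicator \<Omega> \<in> borel_measurable lborel" using \<Omega> by simp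
  qed (simp add: indicator_def)
  have d: "integrable lborel (\<lambda>x. indicator \<Omega> x * (P k x - p x))" "integrable lborel (\<lambda>x. indicator \<Omega> x * (Q k x - q x))" for k
    using Bochner_Integration.integrable_diff[OF P ind[OF p]] Bochner_Integration.integrable_diff[OF Q ind[OF q]]
    by (auto simp: right_diff_distrib)
  \<comment> \<open>The indicator can be inserted because \<open>\<phi>\<close> and its divergence
    vanish off \<open>\<Omega>\<close>; integrability of \<open>P k\<close> is known only on
    \<open>\<Omega>\<close>.\<close>
  have split: "pairing A p' q' \<phi> = (LINT x|lborel. divergence \<phi> x * (indicator \<Omega> x * p' x))
      - (LINT x|lborel. (A x \<bullet> \<phi> x) * (indicator \<Omega> x * q' x))"
    if "integrable lborel (\<lambda>x. indicator \<Omega> x * p' x)" "integrable lborel (\<lambda>x. indicator \<Omega> x * q' x)" for p' q'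
  proof -
    have "p' x * divergence \<phi> x - (A x \<bullet> \<phi> x) * q' x =
        divergence \<phi> x * (indicator \<Omega> x * p' x) - (A x \<bullet> \<phi> x) * (indicator \<Omega> x * q' x)" for x
      by (cases "x \<in> \<Omega>") (auto simp: test_field_zero[OF \<Omega> \<phi>])
    then show ?thesis unfolding pairing_def
      using integrable_bounded_mult[OF that(1), of "divergence \<phi>" B] integrable_bounded_mult[OF that(2), of "\<lambda>x. A x \<bullet> \<phi> x" "max M 0"]
        dm am B M' by simp
  qed
  have bound: "norm (pairing A (P k) (Q k) \<phi> - pairing A p q \<phi>) \<le>
      B * (LINT x|lborel. indicator \<Omega> x * \<bar>P k x - p x\<bar>) + max M 0 * (LINT x|lborel. indicator \<Omega> x * \<bar>Q k x - q x\<bar>)" for k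
  proof -
    have "pairing A (P k) (Q k) \<phi> - pairing A p q \<phi> = pairing A (\<lambda>x. P k x - p x) (\<lambda>x. Q k x - q x) \<phi>"
    proof -
      have b: "integrable lborel (\<lambda>x. divergence \<phi> x * h x)" "integrable lborel (\<lambda>x. (A x \<bullet> \<phi> x) * h x)"
        if "integrable lborel h" for h :: "real ^ 'n \<Rightarrow> real"
        using integrable_bounded_mult[OF that, of "divergence \<phi>" B] integrable_bounded_mult[OF that, of "\<lambda>x. A x \<bullet> \<phi> x" "max M 0"]
          dm am B M' by auto
      show ?thesis
        unfolding split[OF P Q] split[OF ind[OF p] ind[OF q]] split[OF d]
        using b[OF P[of k]] b[OF Q[of k]] b[OF ind[OF p]] b[OF ind[OF q]]
        by (simp add: right_diff_distrib)
    qed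
    also have "\<dots> = (LINT x|lborel. (indicator \<Omega> x * (P k x - p x)) * divergence \<phi> x)
        - (LINT x|lborel. (indicator \<Omega> x * (Q k x - q x)) * (A x \<bullet> \<phi> x))"
      unfolding split[OF d] by (simp add: mult.commute)
    finally have eq: "pairing A (P k) (Q k) \<phi> - pairing A p q \<phi> = \<dots>" .
    have "B \<ge> 0" using B[of 0] by linarith
    then have "\<bar>LINT x|lborel. (indicator \<Omega> x * (P k x - p x)) * divergence \<phi> x\<bar>
        \<le> B * (LINT x|lborel. indicator \<Omega> x * \<bar>P k x - p x\<bar>)"
      using dm B by (intro integral_mult_bounded_le d(1)) (auto simp: abs_mult)
    moreover have "\<bar>LINT x|lborel. (indicator \<Omega> x * (Q k x - q x)) * (A x \<bullet> \<phi> x)\<bar>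
        \<le> max M 0 * (LINT x|lborel. indicator \<Omega> x * \<bar>Q k x - q x\<bar>)"
      using am M' by (intro integral_mult_bounded_le d(2)) (auto simp: abs_mult)
    ultimately show ?thesis unfolding eq by simp
  qed
  have "(\<lambda>k. B * (LINT x|lborel. indicator \<Omega> x * \<bar>P k x - p x\<bar>)
      + max M 0 * (LINT x|lborel. indicator \<Omega> x * \<bar>Q k x - q x\<bar>)) \<longlonglongrightarrow> B * 0 + max M 0 * 0"
    by (intro tendsto_add tendsto_mult tendsto_const limP limQ)
  then have lim0: "(\<lambda>k. B * (LINT x|lborel. indicator \<Omega> x * \<bar>P k x - p x\<bar>)
      + max M 0 * (LINT x|lborel. indicator \<Omega> x * \<bar>Q k x - q x\<bar>)) \<longlonglongrightarrow> 0"
    by simp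
  have "(\<lambda>k. pairing A (P k) (Q k) \<phi> - pairing A p q \<phi>) \<longlonglongrightarrow> 0"
    by (rule Lim_null_comparison[OF _ lim0]) (intro always_eventually allI bound)
  then show ?thesis by (rule LIM_zero_cancel)
qed

text \<open>Non-vacuity of the locale: the mollifier radii depend on the index alone, so the two
  families can be chosen independently.\<close>

lemma partition_mollifiers_exist:
  fixes \<Omega> :: "(real ^ 'n) set"
  assumes "open \<Omega>" "bounded \<Omega>"
  obtains \<zeta> \<eta> where "partition_mollifiers \<Omega> \<zeta> \<eta>"
proof -
  obtain \<zeta> :: "nat \<Rightarrow> real ^ 'n \<Rightarrow> real" where \<zeta>:
    "\<And>i. smooth_cs (\<zeta> i)" "\<And>i x. 0 \<le> \<zeta> i x" "\<And>n x. (\<Sum>i<n. \<zeta> i x) \<le> 1"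
    "\<And>i x. \<zeta> i x \<noteq> 0 \<Longrightarrow> x \<in> inset \<Omega> (1 / (real i + 2))"
    "\<And>i x. i > 0 \<Longrightarrow> x \<in> inset \<Omega> (1 / real i) \<Longrightarrow> \<zeta> i x = 0"
    "\<And>n x. n > 0 \<Longrightarrow> x \<in> inset \<Omega> (1 / real n) \<Longrightarrow> (\<Sum>i<n. \<zeta> i x) = 1"
    using smooth_partition[OF assms(2)] by metis
  have "\<exists>\<eta> :: real ^ 'n \<Rightarrow> real. mollifier (1 / (real i + 1)) \<eta>" for i
    by (rule mollifier_exists[of "1 / (real i + 1)"]) auto
  then obtain \<eta> :: "nat \<Rightarrow> real ^ 'n \<Rightarrow> real" where "\<And>i. mollifier (1 / (real i + 1)) (\<eta> i)"
    by metis
  with assms \<zeta> have "partition_mollifiers \<Omega> \<zeta> \<eta>" by unfold_locales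
  then show ?thesis by (rule that)
qed

theorem lemma3p10:
  fixes A :: "real ^ 'n \<Rightarrow> real ^ 'n"
    and \<Omega> :: "(real ^ 'n) set"
    and u :: "real ^ 'n \<Rightarrow> complex"
  assumes "locally_lipschitz A"
    and "open \<Omega>" and "bounded \<Omega>"
    and "u \<in> BV A \<Omega>"
  shows "\<exists>U :: nat \<Rightarrow> real ^ 'n \<Rightarrow> complex.
      (\<forall>k. smooth_on \<Omega> (U k) \<and> integrable (lebesgue_on \<Omega>) (U k)) \<and>
      (\<lambda>k. LINT x|lebesgue_on \<Omega>. norm1 (U k x - u x)) \<longlonglongrightarrow> 0 \<and>
      (\<lambda>k. magnetic_variation A \<Omega> (U k)) \<longlonglongrightarrow> magnetic_variation A \<Omega> u"
proof -
  note \<Omega> = assms(2)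
  have A: "continuous_on UNIV A" by (rule locally_lipschitz_continuous[OF assms(1)])
  have nA: "continuous_on UNIV (\<lambda>x. - A x)" by (intro continuous_on_minus A)
  have u: "integrable (lebesgue_on \<Omega>) u" and fin: "magnetic_variation A \<Omega> u < \<infinity>"
    using assms(4) by (auto simp: BV_def)
  have um: "u \<in> borel_measurable (lebesgue_on \<Omega>)" using u by (rule borel_measurable_integrable)
  have \<Omega>': "\<Omega> \<inter> space lebesgue \<in> sets lebesgue"
    using \<Omega> sets_completionI_sets[of \<Omega> lborel] by simp
  have \<Omega>b[measurable]: "\<Omega> \<in> sets borel" using \<Omega> by simp
  obtain p where p: "integrable lborel p" "AE x in lborel. x \<in> \<Omega> \<longrightarrow> Re (u x) = p x"
    using L1_borel_version[OF \<Omega>, of "\<lambda>x. Re (u x)"] u by auto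
  obtain q where q: "integrable lborel q" "AE x in lborel. x \<in> \<Omega> \<longrightarrow> Im (u x) = q x"
    using L1_borel_version[OF \<Omega>, of "\<lambda>x. Im (u x)"] u by auto
  have pqm[measurable]: "p \<in> borel_measurable borel" "q \<in> borel_measurable borel"
    using p q by (auto dest: borel_measurable_integrable)
  define T where "T = {\<phi> \<in> test_fields \<Omega>. \<forall>x. norm (\<phi> x) \<le> 1}"
  define \<epsilon> where "\<epsilon> k = 1 / real (Suc k)" for k
  have \<epsilon>: "\<epsilon> k > 0" "\<epsilon> \<longlonglongrightarrow> 0" for k
    using LIMSEQ_inverse_real_of_nat by (auto simp: \<epsilon>_def[abs_def] inverse_eq_divide)
  define R where "R k P Q \<longleftrightarrow> smooth_on \<Omega> P \<and> smooth_on \<Omega> Q \<and>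
    integrable lborel (\<lambda>x. indicator \<Omega> x * P x) \<and> integrable lborel (\<lambda>x. indicator \<Omega> x * Q x) \<and>
    (LINT x|lborel. indicator \<Omega> x * \<bar>P x - p x\<bar>) \<le> \<epsilon> k \<and> (LINT x|lborel. indicator \<Omega> x * \<bar>Q x - q x\<bar>) \<le> \<epsilon> k \<and>
    (\<forall>\<phi>\<in>T. \<exists>\<psi>\<in>T. pairing A P Q \<phi> \<le> pairing A p q \<psi> + \<epsilon> k) \<and>
    (\<forall>\<phi>\<in>T. \<exists>\<psi>\<in>T. pairing (\<lambda>x. - A x) Q P \<phi> \<le> pairing (\<lambda>x. - A x) q p \<psi> + \<epsilon> k)" for k P Q
  have "\<exists>P Q. R k P Q" for k
    unfolding R_def T_def by (intro pairing_approximation \<Omega> assms(3) A p(1) q(1) \<epsilon>(1))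
  then obtain P Q where PQ: "\<And>k. R k (P k) (Q k)" by metis
  have smooth: "\<And>k. smooth_on \<Omega> (P k)" "\<And>k. smooth_on \<Omega> (Q k)"
    and int: "\<And>k. integrable lborel (\<lambda>x. indicator \<Omega> x * P k x)" "\<And>k. integrable lborel (\<lambda>x. indicator \<Omega> x * Q k x)"
    and close: "\<And>k. (LINT x|lborel. indicator \<Omega> x * \<bar>P k x - p x\<bar>) \<le> \<epsilon> k" "\<And>k. (LINT x|lborel. indicator \<Omega> x * \<bar>Q k x - q x\<bar>) \<le> \<epsilon> k"
    and upper: "\<And>k \<phi>. \<phi> \<in> T \<Longrightarrow> \<exists>\<psi>\<in>T. pairing A (P k) (Q k) \<phi> \<le> pairing A p q \<psi> + \<epsilon> k"
      "\<And>k \<phi>. \<phi> \<in> T \<Longrightarrow> \<exists>\<psi>\<in>T. pairing (\<lambda>x. - A x) (Q k) (P k) \<phi> \<le> pairing (\<lambda>x. - A x) q p \<psi> + \<epsilon> k"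
    using PQ unfolding R_def by simp_all
  have lim: "(\<lambda>k. LINT x|lborel. indicator \<Omega> x * \<bar>P k x - p x\<bar>) \<longlonglongrightarrow> 0"
    "(\<lambda>k. LINT x|lborel. indicator \<Omega> x * \<bar>Q k x - q x\<bar>) \<longlonglongrightarrow> 0"
    by (rule tendsto_sandwich[OF _ _ tendsto_const \<epsilon>(2)]; simp add: close always_eventually)+
  define U where "U k x = complex_of_real (P k x) + \<i> * complex_of_real (Q k x)" for k x
  have U_Re: "Re (U k x) = P k x" and U_Im: "Im (U k x) = Q k x" for k x by (simp_all add: U_def)
  have "bounded_linear (\<lambda>r. \<i> * complex_of_real r)"
    by (rule bounded_linear_compose[OF bounded_linear_mult_right bounded_linear_of_real])
  then have U_smooth: "smooth_on \<Omega> (U k)" for k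
    unfolding U_def[abs_def]
    by (intro smooth_on_add \<Omega> smooth_on_bounded_linear[OF \<Omega> smooth(1) bounded_linear_of_real]
        smooth_on_bounded_linear[OF \<Omega> smooth(2)])
  have U_int: "integrable (lebesgue_on \<Omega>) (U k)" for k
  proof -
    have "integrable lborel (\<lambda>x. complex_of_real (indicator \<Omega> x * P k x) + \<i> * complex_of_real (indicator \<Omega> x * Q k x))"
      using int by (intro Bochner_Integration.integrable_add integrable_mult_right integrable_of_real)
    then have "integrable lborel (\<lambda>x. indicator \<Omega> x *\<^sub>R U k x)"
      by (rule Bochner_Integration.integrable_cong[THEN iffD1, rotated -1])
         (auto simp: U_def indicator_def)
    then have "integrable lebesgue (\<lambda>x. indicator \<Omega> x *\<^sub>R U k x)"
      using integrable_completion[OF borel_measurable_integrable] by blast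
    then show ?thesis using integrable_restrict_space[OF \<Omega>', of "U k"] by simp
  qed
  have Um: "U k \<in> borel_measurable (lebesgue_on \<Omega>)" for k using U_int by (rule borel_measurable_integrable)
  have mI: "(\<lambda>x. indicator \<Omega> x * P k x) \<in> borel_measurable borel" "(\<lambda>x. indicator \<Omega> x * Q k x) \<in> borel_measurable borel" for k
    using int[of k] by (auto dest: borel_measurable_integrable)
  have aeU: "AE x in lborel. x \<in> \<Omega> \<longrightarrow> Re (U k x) = indicator \<Omega> x * P k x"
    "AE x in lborel. x \<in> \<Omega> \<longrightarrow> Im (U k x) = indicator \<Omega> x * Q k x" for k
    by (auto simp: U_Re U_Im)
  \<comment> \<open>The approximants are uncontrolled outside \<open>\<Omega>\<close>, so their
    Borel versions carry the indicator; test fields do not see it.\<close>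
  have ind_pairing: "pairing B (\<lambda>x. indicator \<Omega> x * f x) (\<lambda>x. indicator \<Omega> x * g x) \<phi> = pairing B f g \<phi>"
    if "\<phi> \<in> T" for B f g \<phi>
    unfolding pairing_def
    by (intro Bochner_Integration.integral_cong refl)
       (use that test_field_zero[OF \<Omega>, of \<phi>] in \<open>auto simp: T_def indicator_def\<close>)
  have C1U: "C1 A \<Omega> (U k) = (SUP \<phi>\<in>T. ereal (pairing A (P k) (Q k) \<phi>))"
    and C2U: "C2 A \<Omega> (U k) = (SUP \<phi>\<in>T. ereal (pairing (\<lambda>x. - A x) (Q k) (P k) \<phi>))" for k
    using C1_C2_eq_SUP_pairing[OF \<Omega> A U_int mI aeU] ind_pairing
    by (auto simp: T_def[symmetric] intro!: SUP_cong)
  have C1u: "C1 A \<Omega> u = (SUP \<phi>\<in>T. ereal (pairing A p q \<phi>))"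
    and C2u: "C2 A \<Omega> u = (SUP \<phi>\<in>T. ereal (pairing (\<lambda>x. - A x) q p \<phi>))"
    using C1_C2_eq_SUP_pairing[OF \<Omega> A u pqm p(2) q(2)] by (simp_all add: T_def)
  \<comment> \<open>The zero field makes \<open>T\<close> nonempty and all the suprema
    nonnegative.\<close>
  have "(\<lambda>x. 0) \<in> test_fields \<Omega>"
    by (rule test_fieldI[OF assms(3), of 1]) (auto intro: smooth_on_const)
  then have zero: "(\<lambda>x. 0) \<in> T" by (simp add: T_def)
  have pairing_zero: "pairing B f g (\<lambda>x. 0) = 0" for B :: "real ^ 'n \<Rightarrow> real ^ 'n" and f g
    by (simp add: pairing_def divergence_def)
  have nonneg: "0 \<le> (SUP \<phi>\<in>T. ereal (pairing B f g \<phi>))" for B f g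
    using SUP_upper[OF zero, of "\<lambda>\<phi>. ereal (pairing B f g \<phi>)"] by (simp add: pairing_zero zero_ereal_def)
  \<comment> \<open>Addition of extended reals is continuous at finite limits. The two suprema are
    nonnegative and have a finite sum because \<open>u\<close> is in \<open>BV A \<Omega>\<close>,
    so each is finite.\<close>
  have finite: "\<bar>C1 A \<Omega> u\<bar> \<noteq> \<infinity>" "\<bar>C2 A \<Omega> u\<bar> \<noteq> \<infinity>"
    using fin nonneg[of A p q] nonneg[of "\<lambda>x. - A x" q p] unfolding magnetic_variation_def C1u[symmetric] C2u[symmetric]
    by (cases "C1 A \<Omega> u"; cases "C2 A \<Omega> u"; simp)+
  have "(\<lambda>k. C1 A \<Omega> (U k)) \<longlonglongrightarrow> C1 A \<Omega> u"
    unfolding C1U C1u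
    by (rule SUP_tendsto_of_approx[OF _ upper(1) \<epsilon>(2) pairing_tendsto[OF \<Omega> A _ p(1) q(1) int lim]])
       (use zero in \<open>auto simp: T_def\<close>)
  moreover have "(\<lambda>k. C2 A \<Omega> (U k)) \<longlonglongrightarrow> C2 A \<Omega> u"
    unfolding C2U C2u
    by (rule SUP_tendsto_of_approx[OF _ upper(2) \<epsilon>(2) pairing_tendsto[OF \<Omega> nA _ q(1) p(1) int(2,1) lim(2,1)]])
       (use zero in \<open>auto simp: T_def\<close>)
  ultimately have var: "(\<lambda>k. magnetic_variation A \<Omega> (U k)) \<longlonglongrightarrow> magnetic_variation A \<Omega> u"
    unfolding magnetic_variation_def by (intro tendsto_add_ereal finite)
  have "(LINT x|lebesgue_on \<Omega>. norm1 (U k x - u x)) =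
      (LINT x|lborel. indicator \<Omega> x * \<bar>P k x - p x\<bar>) + (LINT x|lborel. indicator \<Omega> x * \<bar>Q k x - q x\<bar>)" for k
  proof -
    \<comment> \<open>The indicator is distributed over the differences because Borel measurability
      is at hand for \<open>indicator \<Omega> x * P k x\<close>, not for \<open>P k\<close>
      alone.\<close>
    let ?H = "\<lambda>x. \<bar>indicator \<Omega> x * P k x - indicator \<Omega> x * p x\<bar> + \<bar>indicator \<Omega> x * Q k x - indicator \<Omega> x * q x\<bar>"
    note [measurable] = mI um Um
    have "(LINT x|lebesgue_on \<Omega>. norm1 (U k x - u x)) = (LINT x|lborel. ?H x)"
    proof (rule integral_lebesgue_on_eq_lborel[OF \<Omega>])
      show "(\<lambda>x. norm1 (U k x - u x)) \<in> borel_measurable (lebesgue_on \<Omega>)" unfolding norm1_def by measurable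
      show "?H \<in> borel_measurable borel" by measurable
      show "AE x in lborel. x \<in> \<Omega> \<longrightarrow> norm1 (U k x - u x) = ?H x"
        using p(2) q(2) by eventually_elim (auto simp: norm1_def U_Re U_Im)
    qed simp
    moreover have ind: "integrable lborel (\<lambda>x. indicator \<Omega> x * f x)" if "integrable lborel f" for f :: "real ^ 'n \<Rightarrow> real"
      by (rule integrable_bounded_mult[OF that, of _ 1]) (auto simp: indicator_def)
    have "(LINT x|lborel. ?H x) = (LINT x|lborel. \<bar>indicator \<Omega> x * P k x - indicator \<Omega> x * p x\<bar>)
        + (LINT x|lborel. \<bar>indicator \<Omega> x * Q k x - indicator \<Omega> x * q x\<bar>)"
      by (intro Bochner_Integration.integral_add Bochner_Integration.integrable_abs
          Bochner_Integration.integrable_diff int ind p(1) q(1))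
    moreover have "\<bar>indicator \<Omega> x * a - indicator \<Omega> x * b\<bar> = indicator \<Omega> x * \<bar>a - b\<bar>" for x and a b :: real
      by (simp add: indicator_def)
    ultimately show ?thesis by (simp only:)
  qed
  then have "(\<lambda>k. LINT x|lebesgue_on \<Omega>. norm1 (U k x - u x)) \<longlonglongrightarrow> 0"
    using tendsto_add[OF lim] by simp
  then show ?thesis using U_smooth U_int var by blast
qed

end
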